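(* Let $\Bbbk$ be a field, let $\mathcal{P}$ be a finite pointed lower saturated poset, let $(\mathbf{X},\mathbf{A})=\{(X_v,A_v)\mid v\in V_\mathcal{P}\}$ be a collection of pairs of spaces, and let $h^*$ be a generalised cohomology theory with values in $\Bbbk$-vector spaces that satisfies the strong form of the Künneth formula. Let $\mathbf{a}=\{a_v\colon h^*(X_v)\to h^*(A_v)\mid v\in V_\mathcal{P}\}$ be the collection of maps induced by the inclusions $A_v\subseteq X_v$, and assume that $a_v$ has a section for each $v$. Then $$h^*(\mathcal{Z}_\mathcal{P}(\mathbf{X},\mathbf{A}))\cong \mathcal{T}_\mathcal{P}(\mathbf{a}).$$
   Context: A poset $\mathcal{P}$ is regarded as a small category with exactly one morphism $\iota_{x,y}\colon x\to y$ whenever $x\le y$. It is pointed if it has an initial (least) object $*$. A vertex of $\mathcal{P}$ is an object $v\ne *$ such that $y<v$ implies $y=*$. $V_\mathcal{P}$ is the set of vertices, and $V(x)=\{v\in V_\mathcal{P}\mid v\le x\}$. For objects $x,y$, $[x\vee y]$ is the set of minimal upper bounds of $\{x,y\}$ and $[x\wedge y]$ the set of maximal lower bounds. $\mathcal{P}$ is lower saturated if for each pair of objects $x,y$ with $[x\vee y]\ne\emptyset$ there is $w\in[x\wedge y]$ with $V(w)=V(x)\cap V(y)$. Polyhedral product: $\mathcal{Z}^\mathcal{P}_{\mathbf{X},\mathbf{A}}\colon\mathcal{P}\to\mathbf{Top}$ is the functor with $\mathcal{Z}^\mathcal{P}_{\mathbf{X},\mathbf{A}}(x)=\prod_{v\in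 V_\mathcal{P}}Y_v$, where $Y_v=X_v$ if $v\in V(x)$ and $Y_v=A_v$ otherwise, and which sends $\iota_{x,y}$ to the obvious inclusion. Then $\mathcal{Z}_\mathcal{P}(\mathbf{X},\mathbf{A})=\operatorname{hocolim}_{\mathcal{P}}\mathcal{Z}^\mathcal{P}_{\mathbf{X},\mathbf{A}}$. The strong form of the Künneth formula means $h^*(X\times Y)\cong h^*(X)\otimes h^*(Y)$ for spaces $X,Y$ (naturally in $X$ and $Y$). Polyhedral tensor product: for a collection $\mathbf{a}=\{a_v\colon M_v\to N_v\}$ of morphisms of $\Bbbk$-modules, $\mathcal{T}_{\mathcal{P},\mathbf{a}}$ is the functor from $\mathcal{P}^{\mathrm{op}}$ to $\Bbbk$-modules with $\mathcal{T}_{\mathcal{P},\mathbf{a}}(p)=\bigotimes_{v\in V_\mathcal{P}}C_{p,v}$, $C_{p,v}=M_v$ if $v\in V(p)$ and $N_v$ if $v\notin V(p)$. For $p\le q$, $\mathcal{T}_{\mathcal{P},\mathbf{a}}(\iota_{p,q})=\bigotimes_v f_v\colon \mathcal{T}_{\mathcal{P},\mathbf{a}}(q)\to \mathcal{T}_{\mathcal{P},\mathbf{a}}(p)$ with $f_v=1_{M_v}$ if $v\in V(p)$, $f_v=a_v$ if $v\in V(q)\setminus V(p)$, $f_v=1_{N_v}$ if $v\notin V(q)$. Then $\mathcal{T}_\mathcal{P}(\mathbf{a})=\lim_{\mathcal{P}}\mathcal{T}_{\mathcal{P},\mathbf{a}}$. A section of $a_v$ is a morphism $s_v\colon N_v\to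 M_v$ with $a_v\circ s_v=1_{N_v}$. For $\mathbf{a}$ as in the claim, $M_v=h^*(X_v)$, $N_v=h^*(A_v)$, and the Künneth isomorphism identifies $\mathcal{T}_{\mathcal{P},\mathbf{a}}$ with $h^*\circ\mathcal{Z}^\mathcal{P}_{\mathbf{X},\mathbf{A}}$.
   Formalization: When P has no vertices (P = {*}), the formal theorem additionally assumes h*(pt) ≅ k, the empty case of the Künneth formula; without it the claim fails for the zero theory, where h*(Z_P) = 0 but T_P(a) = k. *)

theory Defs
  imports "HOL-Analysis.Analysis" "HOL-Library.Function_Algebras"
begin

section \<open>Finite pointed posets\<close>

text \<open>A poset is a subset \<open>P\<close> of an ordered type, with the induced order.\<close>

definition least_in :: "'p::order set \<Rightarrow> 'p \<Rightarrow> bool" where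
  "least_in P b \<longleftrightarrow> b \<in> P \<and> (\<forall>x\<in>P. b \<le> x)"

definition pointed :: "'p::order set \<Rightarrow> bool" where
  "pointed P \<longleftrightarrow> (\<exists>b. least_in P b)"

definition vertices :: "'p::order set \<Rightarrow> 'p set" where
  "vertices P = {v \<in> P. \<not> least_in P v \<and> (\<forall>y\<in>P. y < v \<longrightarrow> least_in P y)}"

definition vertices_below :: "'p::order set \<Rightarrow> 'p \<Rightarrow> 'p set" where
  "vertices_below P x = {v \<in> vertices P. v \<le> x}"

definition joins :: "'p::order set \<Rightarrow> 'p \<Rightarrow> 'p \<Rightarrow> 'p set" where
  "joins P x y = {z \<in> P. x \<le> z \<and> y \<le> z \<and> \<not> (\<exists>w\<in>P. x \<le> w \<and> y \<le> w \<and> w < z)}"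

definition meets :: "'p::order set \<Rightarrow> 'p \<Rightarrow> 'p \<Rightarrow> 'p set" where
  "meets P x y = {z \<in> P. z \<le> x \<and> z \<le> y \<and> \<not> (\<exists>w\<in>P. w \<le> x \<and> w \<le> y \<and> z < w)}"

definition lower_saturated :: "'p::order set \<Rightarrow> bool" where
  "lower_saturated P \<longleftrightarrow>
     (\<forall>x\<in>P. \<forall>y\<in>P. joins P x y \<noteq> {} \<longrightarrow>
        (\<exists>w\<in>meets P x y. vertices_below P w = vertices_below P x \<inter> vertices_below P y))"


section \<open>Homotopy colimits and polyhedral products\<close>

definition quotient_topology :: "'a topology \<Rightarrow> ('a \<times> 'a) set \<Rightarrow> 'a set topology" where
  "quotient_topology X E =
     topology (\<lambda>U. U \<subseteq> topspace X // E \<and> openin X {x \<in> topspace X. E `` {x} \<in> U})"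

lemma openin_quotient_topology:
  "openin (quotient_topology X E) U \<longleftrightarrow>
     U \<subseteq> topspace X // E \<and> openin X {x \<in> topspace X. E `` {x} \<in> U}"
proof -
  have "{x \<in> topspace X. E `` {x} \<in> S \<inter> T} =
        {x \<in> topspace X. E `` {x} \<in> S} \<inter> {x \<in> topspace X. E `` {x} \<in> T}" for S T
    by blast
  moreover have "{x \<in> topspace X. E `` {x} \<in> \<Union>\<K>} = (\<Union>S\<in>\<K>. {x \<in> topspace X. E `` {x} \<in> S})" for \<K>
    by blast
  ultimately have
    "istopology (\<lambda>U. U \<subseteq> topspace X // E \<and> openin X {x \<in> topspace X. E `` {x} \<in> U})"
    unfolding istopology_def by (auto simp del: UN_iff Union_iff intro!: openin_Union)
  then show ?thesis
    by (simp add: quotient_topology_def topology_inverse')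
qed

text \<open>The geometric realisation of the nerve of \<open>{q \<in> P. p \<le> q}\<close>, in barycentric coordinates; the
  topology is the right one because \<open>P\<close> is finite.\<close>

definition nerve_above :: "'p::order set \<Rightarrow> 'p \<Rightarrow> ('p \<Rightarrow> real) topology" where
  "nerve_above P p = subtopology (powertop_real UNIV)
     {t. (\<forall>q. 0 \<le> t q) \<and> (\<forall>q. t q \<noteq> 0 \<longrightarrow> q \<in> P \<and> p \<le> q) \<and> (\<Sum>q\<in>P. t q) = 1 \<and>
         (\<forall>q r. t q \<noteq> 0 \<and> t r \<noteq> 0 \<longrightarrow> q \<le> r \<or> r \<le> q)}"

text \<open>The Bousfield--Kan homotopy colimit of a functor \<open>F\<close> on \<open>P\<close>, as the coend of \<open>F\<close> and
  \<open>p \<mapsto> nerve_above P p\<close>: the quotient of the coproduct of all \<open>F p \<times> nerve_above P p\<close> by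
  the identifications \<open>(y, t) \<sim> (\<phi> p q y, t)\<close> for \<open>p \<le> q\<close>, \<open>y \<in> F p\<close>, \<open>t \<in> nerve_above P q\<close>.\<close>

definition hocolim_sum ::
    "'p::order set \<Rightarrow> ('p \<Rightarrow> 'b topology) \<Rightarrow> ('p \<times> 'b \<times> ('p \<Rightarrow> real)) topology" where
  "hocolim_sum P F = sum_topology (\<lambda>p. prod_topology (F p) (nerve_above P p)) P"

definition hocolim_glue ::
    "'p::order set \<Rightarrow> ('p \<Rightarrow> 'b topology) \<Rightarrow> ('p \<Rightarrow> 'p \<Rightarrow> 'b \<Rightarrow> 'b) \<Rightarrow>
       (('p \<times> 'b \<times> ('p \<Rightarrow> real)) \<times> ('p \<times> 'b \<times> ('p \<Rightarrow> real))) set" where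
  "hocolim_glue P F \<phi> = {((p, y, t), (q, \<phi> p q y, t)) | p q y t.
     p \<in> P \<and> q \<in> P \<and> p \<le> q \<and> y \<in> topspace (F p) \<and> t \<in> topspace (nerve_above P q)}"

definition hocolim ::
    "'p::order set \<Rightarrow> ('p \<Rightarrow> 'b topology) \<Rightarrow> ('p \<Rightarrow> 'p \<Rightarrow> 'b \<Rightarrow> 'b) \<Rightarrow>
       ('p \<times> 'b \<times> ('p \<Rightarrow> real)) set topology" where
  "hocolim P F \<phi> = quotient_topology (hocolim_sum P F)
     ((hocolim_glue P F \<phi> \<union> (hocolim_glue P F \<phi>)\<inverse>)\<^sup>*)"

text \<open>Pairs of spaces are families of topologies \<open>X v\<close> and subsets \<open>A v\<close>.\<close>

definition polyhedral_diagram ::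
    "'p::order set \<Rightarrow> ('p \<Rightarrow> 'u topology) \<Rightarrow> ('p \<Rightarrow> 'u set) \<Rightarrow> 'p \<Rightarrow> ('p \<Rightarrow> 'u) topology" where
  "polyhedral_diagram P X A x =
     product_topology
       (\<lambda>v. if v \<in> vertices_below P x then X v else subtopology (X v) (A v)) (vertices P)"

definition polyhedral_product ::
    "'p::order set \<Rightarrow> ('p \<Rightarrow> 'u topology) \<Rightarrow> ('p \<Rightarrow> 'u set) \<Rightarrow>
       ('p \<times> ('p \<Rightarrow> 'u) \<times> ('p \<Rightarrow> real)) set topology" where
  "polyhedral_product P X A = hocolim P (polyhedral_diagram P X A) (\<lambda>x y. id)"


section \<open>Vector spaces and tensor products\<close>

text \<open>A \<open>\<bbbk>\<close>-vector space is a linear subspace of an ambient type with a scalar multiplication;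
  \<open>fun_scale s\<close> is the pointwise scalar multiplication on functions.\<close>

definition fun_scale :: "('k \<Rightarrow> 'b \<Rightarrow> 'b) \<Rightarrow> 'k \<Rightarrow> ('i \<Rightarrow> 'b) \<Rightarrow> 'i \<Rightarrow> 'b" where
  "fun_scale s c f = (\<lambda>i. s c (f i))"

lemma vector_space_fun_scale:
  assumes "vector_space s" shows "vector_space (fun_scale s)"
proof -
  interpret vector_space s by fact
  show ?thesis
    by unfold_locales (auto simp: fun_scale_def scale_left_distrib scale_right_distrib)
qed

definition lin_on ::
    "('k \<Rightarrow> 'b::ab_group_add \<Rightarrow> 'b) \<Rightarrow> ('k \<Rightarrow> 'c::ab_group_add \<Rightarrow> 'c) \<Rightarrow>
       'b set \<Rightarrow> 'c set \<Rightarrow> ('b \<Rightarrow> 'c) \<Rightarrow> bool" where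
  "lin_on s t V W f \<longleftrightarrow>
     f ` V \<subseteq> W \<and> (\<forall>x\<in>V. \<forall>y\<in>V. f (x + y) = f x + f y) \<and> (\<forall>c. \<forall>x\<in>V. f (s c x) = t c (f x))"

definition lin_iso ::
    "('k \<Rightarrow> 'b::ab_group_add \<Rightarrow> 'b) \<Rightarrow> ('k \<Rightarrow> 'c::ab_group_add \<Rightarrow> 'c) \<Rightarrow>
       'b set \<Rightarrow> 'c set \<Rightarrow> ('b \<Rightarrow> 'c) \<Rightarrow> bool" where
  "lin_iso s t V W f \<longleftrightarrow> lin_on s t V W f \<and> bij_betw f V W"

definition multilinear_on ::
    "('k \<Rightarrow> 'b::ab_group_add \<Rightarrow> 'b) \<Rightarrow> ('k \<Rightarrow> 'c::ab_group_add \<Rightarrow> 'c) \<Rightarrow>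
       'i set \<Rightarrow> ('i \<Rightarrow> 'b set) \<Rightarrow> (('i \<Rightarrow> 'b) \<Rightarrow> 'c) \<Rightarrow> bool" where
  "multilinear_on s t I V \<beta> \<longleftrightarrow>
     (\<forall>x\<in>Pi\<^sub>E I V. \<forall>i\<in>I. \<forall>y\<in>V i.
        (\<forall>z\<in>V i. \<beta> (x(i := y + z)) = \<beta> (x(i := y)) + \<beta> (x(i := z))) \<and>
        (\<forall>c. \<beta> (x(i := s c y)) = t c (\<beta> (x(i := y)))))"

text \<open>The tensor product of a family of vector spaces over a field, realised as the span of the
  pure tensors in the dual of the space of multilinear forms; the pure tensor of \<open>x\<close> is evaluation
  at \<open>x\<close>. The universal property is \<open>tensor_universal\<close> below.\<close>

type_synonym ('i, 'b, 'k) tensor = "(('i \<Rightarrow> 'b) \<Rightarrow> 'k) \<Rightarrow> 'k"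

definition pure_tensor ::
    "('k::field \<Rightarrow> 'b::ab_group_add \<Rightarrow> 'b) \<Rightarrow> 'i set \<Rightarrow> ('i \<Rightarrow> 'b set) \<Rightarrow> ('i \<Rightarrow> 'b) \<Rightarrow> ('i, 'b, 'k) tensor"
  where "pure_tensor s I V x = (\<lambda>B. if multilinear_on s (*) I V B then B x else 0)"

definition tensor ::
    "('k::field \<Rightarrow> 'b::ab_group_add \<Rightarrow> 'b) \<Rightarrow> 'i set \<Rightarrow> ('i \<Rightarrow> 'b set) \<Rightarrow> ('i, 'b, 'k) tensor set" where
  "tensor s I V = module.span (fun_scale (*)) (pure_tensor s I V ` Pi\<^sub>E I V)"

text \<open>The tensor product of linear maps \<open>f i\<close> into \<open>W i\<close>; see \<open>tensor_map_pure\<close>.\<close>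

definition tensor_map ::
    "('k::field \<Rightarrow> 'b::ab_group_add \<Rightarrow> 'b) \<Rightarrow> 'i set \<Rightarrow> ('i \<Rightarrow> 'b set) \<Rightarrow> ('i \<Rightarrow> 'b \<Rightarrow> 'b) \<Rightarrow>
       ('i, 'b, 'k) tensor \<Rightarrow> ('i, 'b, 'k) tensor" where
  "tensor_map s I W f z =
     (\<lambda>B. if multilinear_on s (*) I W B then z (\<lambda>x. B (\<lambda>i\<in>I. f i (x i))) else 0)"

lemma tensor_map_pure:
  assumes f: "\<And>i. i \<in> I \<Longrightarrow> lin_on s s (V i) (W i) (f i)" and x: "x \<in> Pi\<^sub>E I V"
  shows "tensor_map s I W f (pure_tensor s I V x) = pure_tensor s I W (\<lambda>i\<in>I. f i (x i))"
proof -
  have "multilinear_on s (*) I V (\<lambda>x. B (\<lambda>i\<in>I. f i (x i)))" if B: "multilinear_on s (*) I W B" for B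
    unfolding multilinear_on_def
  proof (intro ballI)
    fix x i y assume H: "x \<in> Pi\<^sub>E I V" "i \<in> I" "y \<in> V i"
    let ?g = "\<lambda>x. (\<lambda>i\<in>I. f i (x i))"
    have W: "f j u \<in> W j" if "j \<in> I" "u \<in> V j" for j u
      using f[OF that(1)] that(2) unfolding lin_on_def by blast
    have upd: "?g (x(i := u)) = (?g x)(i := f i u)" for u
      using H(2) by (simp add: restrict_def fun_eq_iff)
    have gx: "?g x \<in> Pi\<^sub>E I W"
      using W H(1) by (simp add: PiE_iff)
    have add: "f i (y + z) = f i y + f i z" if "z \<in> V i" for z
      using f[OF H(2)] H(3) that unfolding lin_on_def by blast
    have sc: "f i (s c y) = s c (f i y)" for c
      using f[OF H(2)] H(3) unfolding lin_on_def by blast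
    have B': "(\<forall>z\<in>W i. B ((?g x)(i := f i y + z)) = B ((?g x)(i := f i y)) + B ((?g x)(i := z))) \<and>
              (\<forall>c. B ((?g x)(i := s c (f i y))) = c * B ((?g x)(i := f i y)))"
      using B[unfolded multilinear_on_def, THEN bspec, OF gx, THEN bspec, OF H(2), THEN bspec, OF W[OF H(2,3)]] .
    show "(\<forall>z\<in>V i. B (?g (x(i := y + z))) = B (?g (x(i := y))) + B (?g (x(i := z)))) \<and>
          (\<forall>c. B (?g (x(i := s c y))) = c * B (?g (x(i := y))))"
    proof (intro conjI ballI allI)
      fix z assume z: "z \<in> V i"
      show "B (?g (x(i := y + z))) = B (?g (x(i := y))) + B (?g (x(i := z)))"
        unfolding upd add[OF z] by (rule B'[THEN conjunct1, THEN bspec, OF W[OF H(2) z]])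
    next
      fix c
      show "B (?g (x(i := s c y))) = c * B (?g (x(i := y)))"
        unfolding upd sc by (rule B'[THEN conjunct2, THEN spec])
    qed
  qed
  then show ?thesis
    by (auto simp: tensor_map_def pure_tensor_def)
qed

lemma tensor_universal:
  fixes s :: "'k::field \<Rightarrow> 'b::ab_group_add \<Rightarrow> 'b" and t :: "'k \<Rightarrow> 'c::ab_group_add \<Rightarrow> 'c"
  assumes t: "vector_space t" and \<beta>: "multilinear_on s t I V \<beta>"
  shows "\<exists>g. lin_on (fun_scale (*)) t (tensor s I V) UNIV g \<and>
             (\<forall>x\<in>Pi\<^sub>E I V. g (pure_tensor s I V x) = \<beta> x) \<and>
             (\<forall>g'. lin_on (fun_scale (*)) t (tensor s I V) UNIV g' \<and>
                   (\<forall>x\<in>Pi\<^sub>E I V. g' (pure_tensor s I V x) = \<beta> x) \<longrightarrow>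
                   (\<forall>z\<in>tensor s I V. g' z = g z))"
proof -
  have K: "vector_space ((*) :: 'k \<Rightarrow> 'k \<Rightarrow> 'k)"
    by unfold_locales (auto simp: algebra_simps)
  let ?s = "fun_scale (*) :: 'k \<Rightarrow> ('i, 'b, 'k) tensor \<Rightarrow> ('i, 'b, 'k) tensor"
  interpret S: vector_space ?s
    by (intro vector_space_fun_scale K)
  interpret T: vector_space t by fact
  interpret ST: vector_space_pair ?s t ..
  interpret TK: vector_space_pair t "(*) :: 'k \<Rightarrow> 'k \<Rightarrow> 'k" ..
  interpret SK: vector_space_pair ?s "(*) :: 'k \<Rightarrow> 'k \<Rightarrow> 'k" ..
  let ?pt = "pure_tensor s I V"
  obtain B where B: "B \<subseteq> ?pt ` Pi\<^sub>E I V" "S.independent B" "?pt ` Pi\<^sub>E I V \<subseteq> S.span B"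
    using S.maximal_independent_subset by blast
  have "\<forall>b\<in>B. \<exists>x. x \<in> Pi\<^sub>E I V \<and> ?pt x = b"
    using B(1) by blast
  then obtain rep where rep: "\<And>b. b \<in> B \<Longrightarrow> rep b \<in> Pi\<^sub>E I V \<and> ?pt (rep b) = b"
    by metis
  obtain g where g: "Vector_Spaces.linear ?s t g" "\<And>b. b \<in> B \<Longrightarrow> g b = \<beta> (rep b)"
    using ST.linear_independent_extend[OF B(2), of "\<beta> \<circ> rep"] by auto
  interpret g: Vector_Spaces.linear ?s t g by fact
  have gx: "g (?pt x) = \<beta> x" if x: "x \<in> Pi\<^sub>E I V" for x
  proof (rule ccontr)
    define w where "w = g (?pt x) - \<beta> x"
    assume "g (?pt x) \<noteq> \<beta> x"
    then have "w \<noteq> 0" by (simp add: w_def)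
    then have "T.independent {w}" by simp
    from TK.linear_independent_extend[OF this, of "\<lambda>_. 1"]
    obtain \<phi> where \<phi>: "Vector_Spaces.linear t (*) \<phi>" "\<phi> w = 1" by auto
    interpret \<phi>: Vector_Spaces.linear t "(*) :: 'k \<Rightarrow> 'k \<Rightarrow> 'k" \<phi> by fact
    have ml: "multilinear_on s (*) I V (\<phi> \<circ> \<beta>)"
      using \<beta> by (simp add: multilinear_on_def \<phi>.add \<phi>.scale)
    have ev: "Vector_Spaces.linear ?s (*) (\<lambda>z. z (\<phi> \<circ> \<beta>))"
      by unfold_locales (auto simp: fun_scale_def)
    have comp: "Vector_Spaces.linear ?s (*) (\<phi> \<circ> g)"
      using g(1) \<phi>(1) by (rule Vector_Spaces.linear_compose)
    have "(\<phi> \<circ> g) (?pt x) = (\<lambda>z. z (\<phi> \<circ> \<beta>)) (?pt x)"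
    proof (rule SK.linear_eq_on[OF comp ev])
      show "?pt x \<in> S.span B" using B(3) x by blast
    next
      fix b assume b: "b \<in> B"
      have "b (\<phi> \<circ> \<beta>) = ?pt (rep b) (\<phi> \<circ> \<beta>)" using rep[OF b] by simp
      also have "\<dots> = \<phi> (\<beta> (rep b))" using ml by (simp add: pure_tensor_def)
      finally show "(\<phi> \<circ> g) b = b (\<phi> \<circ> \<beta>)" using g(2)[OF b] by simp
    qed
    then have "\<phi> (g (?pt x)) = \<phi> (\<beta> x)" using ml by (simp add: pure_tensor_def)
    then have "\<phi> w = 0" by (simp add: w_def \<phi>.diff)
    with \<phi>(2) show False by simp
  qed
  have "g' z = g z"
    if "lin_on ?s t (tensor s I V) UNIV g'" "\<forall>x\<in>Pi\<^sub>E I V. g' (?pt x) = \<beta> x"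
      and z: "z \<in> tensor s I V" for g' z
  proof -
    have "z \<in> tensor s I V \<and> g' z = g z"
      using z unfolding tensor_def
    proof (induction rule: S.span_induct_alt)
      case base
      have "g' (0 + 0) = g' 0 + g' 0"
        using that(1) S.span_zero unfolding lin_on_def tensor_def by blast
      then have "g' 0 = 0" by simp
      then show ?case using S.span_zero g.zero by metis
    next
      case (step c x y)
      then have "x \<in> S.span (?pt ` Pi\<^sub>E I V)" "y \<in> S.span (?pt ` Pi\<^sub>E I V)"
        by (auto intro: S.span_base)
      moreover have "?s c x \<in> S.span (?pt ` Pi\<^sub>E I V)"
        using calculation by (auto intro: S.span_scale)
      moreover have "g' (?s c x + y) = g' (?s c x) + g' y" "g' (?s c x) = t c (g' x)"
        using that(1) calculation unfolding lin_on_def tensor_def by blast+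
      moreover have "g' x = g x"
        using step.hyps that(2) gx by auto
      ultimately show ?case
        using step.IH g.add g.scale S.span_add by metis
    qed
    then show ?thesis by simp
  qed
  moreover have "lin_on ?s t (tensor s I V) UNIV g"
    by (simp add: lin_on_def g.add g.scale)
  ultimately show ?thesis using gx by blast
qed


section \<open>Polyhedral tensor products\<close>

definition polyhedral_tensor_family ::
    "'p::order set \<Rightarrow> ('p \<Rightarrow> 'b set) \<Rightarrow> ('p \<Rightarrow> 'b set) \<Rightarrow> 'p \<Rightarrow> 'p \<Rightarrow> 'b set" where
  "polyhedral_tensor_family P M N p v = (if v \<in> vertices_below P p then M v else N v)"

definition polyhedral_tensor_diagram ::
    "('k::field \<Rightarrow> 'b::ab_group_add \<Rightarrow> 'b) \<Rightarrow> 'p::order set \<Rightarrow> ('p \<Rightarrow> 'b set) \<Rightarrow> ('p \<Rightarrow> 'b set) \<Rightarrow>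
       'p \<Rightarrow> ('p, 'b, 'k) tensor set" where
  "polyhedral_tensor_diagram s P M N p = tensor s (vertices P) (polyhedral_tensor_family P M N p)"

text \<open>The map from the value at \<open>q\<close> to the value at \<open>p\<close>, for \<open>p \<le> q\<close>.\<close>

definition polyhedral_tensor_map ::
    "('k::field \<Rightarrow> 'b::ab_group_add \<Rightarrow> 'b) \<Rightarrow> 'p::order set \<Rightarrow> ('p \<Rightarrow> 'b set) \<Rightarrow> ('p \<Rightarrow> 'b set) \<Rightarrow>
       ('p \<Rightarrow> 'b \<Rightarrow> 'b) \<Rightarrow> 'p \<Rightarrow> 'p \<Rightarrow> ('p, 'b, 'k) tensor \<Rightarrow> ('p, 'b, 'k) tensor" where
  "polyhedral_tensor_map s P M N a p q =
     tensor_map s (vertices P) (polyhedral_tensor_family P M N p)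
       (\<lambda>v. if v \<in> vertices_below P p then id else if v \<in> vertices_below P q then a v else id)"

text \<open>The limit of the diagram: compatible families, normalised to be zero outside \<open>P\<close>.\<close>

definition polyhedral_tensor_product ::
    "('k::field \<Rightarrow> 'b::ab_group_add \<Rightarrow> 'b) \<Rightarrow> 'p::order set \<Rightarrow> ('p \<Rightarrow> 'b set) \<Rightarrow> ('p \<Rightarrow> 'b set) \<Rightarrow>
       ('p \<Rightarrow> 'b \<Rightarrow> 'b) \<Rightarrow> ('p \<Rightarrow> ('p, 'b, 'k) tensor) set" where
  "polyhedral_tensor_product s P M N a =
     {\<tau>. (\<forall>p\<in>P. \<tau> p \<in> polyhedral_tensor_diagram s P M N p) \<and> (\<forall>p. p \<notin> P \<longrightarrow> \<tau> p = 0) \<and>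
         (\<forall>p\<in>P. \<forall>q\<in>P. p \<le> q \<longrightarrow> polyhedral_tensor_map s P M N a p q (\<tau> q) = \<tau> p)}"


section \<open>Generalised cohomology theories\<close>

definition pair_map :: "'u topology \<Rightarrow> 'u set \<Rightarrow> 'u topology \<Rightarrow> 'u set \<Rightarrow> ('u \<Rightarrow> 'u) \<Rightarrow> bool" where
  "pair_map X A Y B f \<longleftrightarrow> A \<subseteq> topspace X \<and> B \<subseteq> topspace Y \<and> continuous_map X Y f \<and> f ` A \<subseteq> B"

text \<open>The Eilenberg--Steenrod axioms without the dimension axiom, for all pairs of topological spaces
  whose points lie in a type \<open>'u\<close>, which plays the role of a universe. The vector spaces
  \<open>H n X A\<close> are embedded in a common ambient vector space \<open>'m\<close>. The map induced by
  \<open>f\<close> from \<open>(X, A)\<close> to \<open>(Y, B)\<close> is \<open>ind n X A Y B f\<close>, from \<open>H n Y B\<close> to \<open>H n X A\<close>, and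
  \<open>bd n X A\<close> is the coboundary from \<open>H n A\<close> to \<open>H (n + 1) X A\<close>. No additivity axiom for infinite
  coproducts is imposed.\<close>

locale cohomology_theory = vector_space sc
  for sc :: "'k::field \<Rightarrow> 'm::ab_group_add \<Rightarrow> 'm" +
  fixes H :: "int \<Rightarrow> 'u topology \<Rightarrow> 'u set \<Rightarrow> 'm set"
    and ind :: "int \<Rightarrow> 'u topology \<Rightarrow> 'u set \<Rightarrow> 'u topology \<Rightarrow> 'u set \<Rightarrow> ('u \<Rightarrow> 'u) \<Rightarrow> 'm \<Rightarrow> 'm"
    and bd :: "int \<Rightarrow> 'u topology \<Rightarrow> 'u set \<Rightarrow> 'm \<Rightarrow> 'm"
  assumes subspace_H: "A \<subseteq> topspace X \<Longrightarrow> subspace (H n X A)"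
    and lin_ind: "pair_map X A Y B f \<Longrightarrow> lin_on sc sc (H n Y B) (H n X A) (ind n X A Y B f)"
    and lin_bd: "A \<subseteq> topspace X \<Longrightarrow>
      lin_on sc sc (H n (subtopology X A) {}) (H (n + 1) X A) (bd n X A)"
    and ind_id: "\<lbrakk>A \<subseteq> topspace X; z \<in> H n X A\<rbrakk> \<Longrightarrow> ind n X A X A id z = z"
    and ind_comp: "\<lbrakk>pair_map X A Y B f; pair_map Y B Z C g; z \<in> H n Z C\<rbrakk> \<Longrightarrow>
      ind n X A Z C (g \<circ> f) z = ind n X A Y B f (ind n Y B Z C g z)"
    and bd_natural: "\<lbrakk>pair_map X A Y B f; z \<in> H n (subtopology Y B) {}\<rbrakk> \<Longrightarrow>
      bd n X A (ind n (subtopology X A) {} (subtopology Y B) {} f z) =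
      ind (n + 1) X A Y B f (bd n Y B z)"
    and homotopy: "\<lbrakk>A \<subseteq> topspace X; B \<subseteq> topspace Y; homotopic_with (\<lambda>h. h ` A \<subseteq> B) X Y f g; z \<in> H n Y B\<rbrakk>
      \<Longrightarrow> ind n X A Y B f z = ind n X A Y B g z"
    and exact_space: "A \<subseteq> topspace X \<Longrightarrow>
      ind n X {} X A id ` H n X A = {z \<in> H n X {}. ind n (subtopology X A) {} X {} id z = 0}"
    and exact_subspace: "A \<subseteq> topspace X \<Longrightarrow>
      ind n (subtopology X A) {} X {} id ` H n X {} = {z \<in> H n (subtopology X A) {}. bd n X A z = 0}"
    and exact_pair: "A \<subseteq> topspace X \<Longrightarrow>
      bd n X A ` H n (subtopology X A) {} = {z \<in> H (n + 1) X A. ind (n + 1) X {} X A id z = 0}"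
    and excision: "\<lbrakk>A \<subseteq> topspace X; U \<subseteq> A; X closure_of U \<subseteq> X interior_of A\<rbrakk> \<Longrightarrow>
      bij_betw (ind n (subtopology X (topspace X - U)) (A - U) X A id)
        (H n X A) (H n (subtopology X (topspace X - U)) (A - U))"

text \<open>The total cohomology \<open>h\<^sup>*(X)\<close>, the direct sum of all \<open>H n X\<close>.\<close>

definition hstar :: "(int \<Rightarrow> 'u topology \<Rightarrow> 'u set \<Rightarrow> 'm::zero set) \<Rightarrow> 'u topology \<Rightarrow> (int \<Rightarrow> 'm) set" where
  "hstar H X = {x. finite {n. x n \<noteq> 0} \<and> (\<forall>n. x n \<in> H n X {})}"

definition hstar_map ::
    "(int \<Rightarrow> 'u topology \<Rightarrow> 'u set \<Rightarrow> 'u topology \<Rightarrow> 'u set \<Rightarrow> ('u \<Rightarrow> 'u) \<Rightarrow> 'm \<Rightarrow> 'm) \<Rightarrow>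
       'u topology \<Rightarrow> 'u topology \<Rightarrow> ('u \<Rightarrow> 'u) \<Rightarrow> (int \<Rightarrow> 'm) \<Rightarrow> int \<Rightarrow> 'm" where
  "hstar_map ind X Y f x = (\<lambda>n. ind n X {} Y {} f (x n))"

definition homogeneous :: "int \<Rightarrow> (int \<Rightarrow> 'm::zero) \<Rightarrow> bool" where
  "homogeneous d x \<longleftrightarrow> (\<forall>n. n \<noteq> d \<longrightarrow> x n = 0)"

text \<open>The part of degree \<open>n\<close> of a tensor product of graded vector spaces.\<close>

definition tensor_degree ::
    "('k::field \<Rightarrow> (int \<Rightarrow> 'm::ab_group_add) \<Rightarrow> (int \<Rightarrow> 'm)) \<Rightarrow> 'i set \<Rightarrow> ('i \<Rightarrow> (int \<Rightarrow> 'm) set) \<Rightarrow> int \<Rightarrow>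
       ('i, int \<Rightarrow> 'm, 'k) tensor set" where
  "tensor_degree s I V n = module.span (fun_scale (*))
     (pure_tensor s I V ` {x \<in> Pi\<^sub>E I V. \<exists>d. (\<forall>i\<in>I. homogeneous (d i) (x i)) \<and> (\<Sum>i\<in>I. d i) = n})"


section \<open>The strong Kuenneth formula\<close>

text \<open>The product of two spaces with points in \<open>'u\<close>, transported to \<open>'u\<close> along an injection
  \<open>pr\<close> of \<open>'u \<times> 'u\<close> into \<open>'u\<close>.\<close>

definition space_prod :: "('u \<times> 'u \<Rightarrow> 'u) \<Rightarrow> 'u topology \<Rightarrow> 'u topology \<Rightarrow> 'u topology" where
  "space_prod pr X Y = pullback_topology (range pr) (inv pr) (prod_topology X Y)"

definition prod_map :: "('u \<times> 'u \<Rightarrow> 'u) \<Rightarrow> ('u \<Rightarrow> 'u) \<Rightarrow> ('u \<Rightarrow> 'u) \<Rightarrow> 'u \<Rightarrow> 'u" where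
  "prod_map pr f g = pr \<circ> map_prod f g \<circ> inv pr"

text \<open>A class of spaces closed under finite products, including the empty one.\<close>

definition product_closed :: "('u \<times> 'u \<Rightarrow> 'u) \<Rightarrow> 'u topology set \<Rightarrow> bool" where
  "product_closed pr C \<longleftrightarrow>
     (\<forall>X a. topspace X = {a} \<longrightarrow> X \<in> C) \<and> (\<forall>X\<in>C. \<forall>Y\<in>C. space_prod pr X Y \<in> C)"

text \<open>The isomorphisms \<open>\<theta> X Y\<close> from \<open>h\<^sup>*(X) \<otimes> h\<^sup>*(Y)\<close> to \<open>h\<^sup>*(X \<times> Y)\<close> are natural in both variables.
  The spaces range over a class \<open>C\<close> because, already for infinite discrete spaces, no theory with
  \<open>h\<^sup>*(pt) \<noteq> 0\<close> has such isomorphisms on all spaces. Binary tensor products are indexed by \<open>bool\<close>.\<close>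

definition strong_kunneth ::
    "('k::field \<Rightarrow> 'm::ab_group_add \<Rightarrow> 'm) \<Rightarrow> (int \<Rightarrow> 'u topology \<Rightarrow> 'u set \<Rightarrow> 'm set) \<Rightarrow>
     (int \<Rightarrow> 'u topology \<Rightarrow> 'u set \<Rightarrow> 'u topology \<Rightarrow> 'u set \<Rightarrow> ('u \<Rightarrow> 'u) \<Rightarrow> 'm \<Rightarrow> 'm) \<Rightarrow>
     ('u \<times> 'u \<Rightarrow> 'u) \<Rightarrow> 'u topology set \<Rightarrow>
     ('u topology \<Rightarrow> 'u topology \<Rightarrow> (bool, int \<Rightarrow> 'm, 'k) tensor \<Rightarrow> int \<Rightarrow> 'm) \<Rightarrow> bool" where
  "strong_kunneth sc H ind pr C \<theta> \<longleftrightarrow>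
     (\<forall>X\<in>C. \<forall>Y\<in>C.
        lin_iso (fun_scale (*)) (fun_scale sc)
          (tensor (fun_scale sc) UNIV (case_bool (hstar H X) (hstar H Y)))
          (hstar H (space_prod pr X Y)) (\<theta> X Y)) \<and>
     (\<forall>X\<in>C. \<forall>Y\<in>C. \<forall>X'\<in>C. \<forall>Y'\<in>C. \<forall>f g.
        continuous_map X X' f \<and> continuous_map Y Y' g \<longrightarrow>
        (\<forall>z\<in>tensor (fun_scale sc) UNIV (case_bool (hstar H X') (hstar H Y')).
           hstar_map ind (space_prod pr X Y) (space_prod pr X' Y') (prod_map pr f g) (\<theta> X' Y' z) =
           \<theta> X Y (tensor_map (fun_scale sc) UNIV (case_bool (hstar H X) (hstar H Y))
                    (case_bool (hstar_map ind X X' f) (hstar_map ind Y Y' g)) z)))"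

definition kunneth_degree_preserving ::
    "('k::field \<Rightarrow> 'm::ab_group_add \<Rightarrow> 'm) \<Rightarrow> (int \<Rightarrow> 'u topology \<Rightarrow> 'u set \<Rightarrow> 'm set) \<Rightarrow>
     'u topology set \<Rightarrow>
     ('u topology \<Rightarrow> 'u topology \<Rightarrow> (bool, int \<Rightarrow> 'm, 'k) tensor \<Rightarrow> int \<Rightarrow> 'm) \<Rightarrow> bool" where
  "kunneth_degree_preserving sc H C \<theta> \<longleftrightarrow>
     (\<forall>X\<in>C. \<forall>Y\<in>C. \<forall>n. \<forall>z\<in>tensor_degree (fun_scale sc) UNIV (case_bool (hstar H X) (hstar H Y)) n.
        homogeneous n (\<theta> X Y z))"

end

theory Submission
  imports Defs
begin

text \<open>
  The theorem says that \<open>h\<^sup>*\<close> turns the homotopy colimit of the diagram of products into the limit of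
  the diagram of tensor products. For a homotopy colimit over a finite poset the obstruction lies in
  the higher derived limits of \<open>h\<^sup>*\<close> of the diagram. The proof avoids spectral sequences by an ordered
  open cover and one extension property, which replaces the vanishing of those derived limits.

  \<^emph>\<open>Algebra.\<close> Let \<open>T p\<close> be the tensor product at \<open>p\<close>. The sections provide maps \<open>T p \<rightarrow> T q\<close> for all
  \<open>p\<close> and \<open>q\<close>, not only for \<open>q \<le> p\<close>: on the factor of a vertex use the identity, the given map or
  its section, as the domain and codomain require. The composite \<open>T p \<rightarrow> T w \<rightarrow> T q\<close> is the direct map
  as soon as \<open>V(p) \<inter> V(q) \<subseteq> V(w)\<close> (\<open>mixed_tensor_map_compose\<close>), because the composite that is not the
  identity, a map followed by its section, arises only at vertices of \<open>p\<close> and \<open>q\<close> outside \<open>w\<close>.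
  Lower saturation supplies, for \<open>p, q < m\<close>, a common lower bound \<open>w\<close> with \<open>V(w) = V(p) \<inter> V(q)\<close>.
  Hence a compatible family on the elements below \<open>m\<close> extends to \<open>T m\<close>: given an element with the right
  values on some of them, correct it at a further \<open>p\<close> by the section applied to the error at \<open>p\<close>; the
  earlier values do not change, since the error vanishes after restriction to every such \<open>w\<close>
  (\<open>polyhedral_tensor_extension\<close>).

  \<^emph>\<open>Cohomology.\<close> Let a space be covered by open sets \<open>G p\<close>, for \<open>p\<close> in a finite poset, that are
  monotone in \<open>p\<close> and such that \<open>G p \<inter> G q\<close> is the union of the \<open>G r\<close> with \<open>r \<le> p, q\<close>. The sets
  \<open>\<Union>p\<in>Q. G p\<close> for down-closed \<open>Q\<close> are then closed under intersection, and adding one maximal element \<open>m\<close>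
  to \<open>Q\<close> glues \<open>G m\<close> along the union of the \<open>G p\<close> with \<open>p < m\<close>. If compatible families below each \<open>m\<close>
  extend to \<open>G m\<close>, the Mayer--Vietoris sequences break into short exact ones, and by induction on the
  size of \<open>Q\<close> the cohomology of the union is the limit of the cohomology of the \<open>G p\<close>
  (\<open>ordered_cover_limit\<close>).

  \<^emph>\<open>Topology.\<close> A point of the homotopy colimit of a diagram of inclusions is a pair of a point \<open>y\<close> and
  a point \<open>t\<close> of the nerve. The sets \<open>star p\<close> where the least vertex of the support of \<open>t\<close> is \<open>\<le> p\<close> form
  such a cover, and \<open>star p\<close> retracts onto the space at \<open>p\<close>: first restrict \<open>t\<close> to the elements \<open>\<le> p\<close>
  and normalise, then move it straight to the vertex \<open>p\<close> (\<open>incl_proj_homotopic\<close>).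

  \<^emph>\<open>Kuenneth formula.\<close> Iterating the two-fold formula over a list of the vertices identifies \<open>T p\<close> with
  \<open>h\<^sup>*\<close> of the product at \<open>p\<close>, naturally in \<open>p\<close> (\<open>polyhedral_kunneth\<close>), so the extension property
  passes from \<open>T\<close> to the cover.
\<close>

section \<open>Linear maps and spans\<close>

lemma Ex1_unique: "\<exists>!y. R y \<Longrightarrow> R a \<Longrightarrow> R b \<Longrightarrow> a = b"
  by blast

text \<open>Sums of functions stay folded, so that linearity acts as a rewrite rule.\<close>

declare plus_fun_apply [simp del] zero_fun_apply [simp del]

lemma vector_space_mult: "vector_space ((*) :: 'k::field \<Rightarrow> 'k \<Rightarrow> 'k)"
  by unfold_locales (auto simp: algebra_simps)

lemma lin_on_mem: "lin_on s t V W f \<Longrightarrow> x \<in> V \<Longrightarrow> f x \<in> W"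
  and lin_on_add: "lin_on s t V W f \<Longrightarrow> x \<in> V \<Longrightarrow> y \<in> V \<Longrightarrow> f (x + y) = f x + f y"
  and lin_on_scale: "lin_on s t V W f \<Longrightarrow> x \<in> V \<Longrightarrow> f (s c x) = t c (f x)"
  by (auto simp: lin_on_def)

lemma lin_on_zero:
  assumes "lin_on s t V W f" "0 \<in> V"
  shows "f 0 = 0"
  using lin_on_add[OF assms(1) assms(2) assms(2)] by simp

lemma lin_on_minus:
  assumes "vector_space s" "vector_space t" "module.subspace s V" "lin_on s t V W f" "x \<in> V" "y \<in> V"
  shows "f (x - y) = f x - f y"
proof -
  interpret S: vector_space s by fact
  interpret T: vector_space t by fact
  have "x - y \<in> V"
    using assms by (simp add: S.subspace_diff)
  from lin_on_add[OF assms(4) this assms(6)] show ?thesis by simp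
qed

lemma lin_on_compose:
  "lin_on s t V W f \<Longrightarrow> lin_on t u W U g \<Longrightarrow> lin_on s u V U (g \<circ> f)"
  by (auto simp: lin_on_def image_subset_iff)

lemma lin_on_cong:
  assumes "vector_space s" "module.subspace s V" "lin_on s t V W f" "\<And>x. x \<in> V \<Longrightarrow> g x = f x"
  shows "lin_on s t V W g"
proof -
  interpret S: vector_space s by fact
  have "x + y \<in> V" "s c x \<in> V" if "x \<in> V" "y \<in> V" for x y c
    using that S.subspace_add[OF assms(2)] S.subspace_scale[OF assms(2)] by auto
  then show ?thesis
    using assms(3,4) unfolding lin_on_def image_subset_iff by simp
qed

lemma subspace_lin_image:
  assumes "vector_space s" "vector_space t" "module.subspace s V" "lin_on s t V W f"
  shows "module.subspace t (f ` V)"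
proof -
  interpret S: vector_space s by fact
  interpret T: vector_space t by fact
  have V: "0 \<in> V" "\<And>x y. x \<in> V \<Longrightarrow> y \<in> V \<Longrightarrow> x + y \<in> V" "\<And>c x. x \<in> V \<Longrightarrow> s c x \<in> V"
    using assms(3) by (auto simp: S.subspace_def)
  show ?thesis
    unfolding T.subspace_def
  proof (intro conjI ballI allI)
    show "0 \<in> f ` V"
      using lin_on_zero[OF assms(4) V(1)] V(1) by (rule image_eqI[OF sym])
  next
    fix x y assume "x \<in> f ` V" "y \<in> f ` V"
    then obtain u v where uv: "x = f u" "u \<in> V" "y = f v" "v \<in> V" by blast
    then have "x + y = f (u + v)" by (simp add: lin_on_add[OF assms(4)])
    then show "x + y \<in> f ` V" using V(2) uv by blast
  next
    fix c x assume "x \<in> f ` V"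
    then obtain u where u: "x = f u" "u \<in> V" by blast
    then have "t c x = f (s c u)" by (simp add: lin_on_scale[OF assms(4)])
    then show "t c x \<in> f ` V" using V(3) u by blast
  qed
qed

lemma lin_iso_inverse:
  assumes "lin_iso s t V W f" "vector_space s" "module.subspace s V"
  shows "lin_iso t s W V (inv_into V f)"
proof -
  interpret S: vector_space s by fact
  have lin: "lin_on s t V W f" and bij: "bij_betw f V W"
    using assms by (auto simp: lin_iso_def)
  have inv: "inv_into V f w \<in> V" "f (inv_into V f w) = w" if "w \<in> W" for w
    using bij that by (auto simp: bij_betw_inv_into_right bij_betw_def inv_into_into)
  have inj: "inv_into V f (f v) = v" if "v \<in> V" for v
    using bij that by (simp add: bij_betw_inv_into_left)
  have "lin_on t s W V (inv_into V f)"
    unfolding lin_on_def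
  proof (intro conjI ballI allI)
    show "inv_into V f ` W \<subseteq> V" using inv by auto
    show "inv_into V f (x + y) = inv_into V f x + inv_into V f y" if "x \<in> W" "y \<in> W" for x y
    proof -
      let ?u = "inv_into V f x" and ?v = "inv_into V f y"
      have "f (?u + ?v) = x + y" "?u + ?v \<in> V"
        using that inv lin_on_add[OF lin] S.subspace_add[OF assms(3)] by auto
      then show ?thesis using inj by metis
    qed
    show "inv_into V f (t c x) = s c (inv_into V f x)" if "x \<in> W" for c x
    proof -
      let ?u = "inv_into V f x"
      have "f (s c ?u) = t c x" "s c ?u \<in> V"
        using that inv lin_on_scale[OF lin] S.subspace_scale[OF assms(3)] by auto
      then show ?thesis using inj by metis
    qed
  qed
  then show ?thesis
    using bij by (simp add: lin_iso_def bij_betw_inv_into)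
qed

lemma lin_iso_compose:
  "lin_iso s t V W f \<Longrightarrow> lin_iso t u W U g \<Longrightarrow> lin_iso s u V U (g \<circ> f)"
  unfolding lin_iso_def using lin_on_compose bij_betw_trans by blast

section \<open>Tensor products\<close>

lemma vector_space_tensor:
  "vector_space (fun_scale (*) :: 'k::field \<Rightarrow> ('i, 'b, 'k) tensor \<Rightarrow> ('i, 'b, 'k) tensor)"
  by (intro vector_space_fun_scale vector_space_mult)

lemma subspace_tensor:
  fixes s :: "'k::field \<Rightarrow> 'b::ab_group_add \<Rightarrow> 'b" and I :: "'i set"
  shows "module.subspace (fun_scale (*)) (tensor s I V)"
proof -
  interpret vector_space "fun_scale (*) :: 'k \<Rightarrow> ('i, 'b, 'k) tensor \<Rightarrow> ('i, 'b, 'k) tensor"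
    by (rule vector_space_tensor)
  show ?thesis by (simp add: tensor_def)
qed

lemma pure_tensor_mem:
  fixes s :: "'k::field \<Rightarrow> 'b::ab_group_add \<Rightarrow> 'b" and I :: "'i set"
  shows "x \<in> Pi\<^sub>E I V \<Longrightarrow> pure_tensor s I V x \<in> tensor s I V"
proof -
  interpret vector_space "fun_scale (*) :: 'k \<Rightarrow> ('i, 'b, 'k) tensor \<Rightarrow> ('i, 'b, 'k) tensor"
    by (rule vector_space_tensor)
  show "x \<in> Pi\<^sub>E I V \<Longrightarrow> ?thesis" by (auto simp: tensor_def intro: span_base)
qed

lemma
  fixes s :: "'k::field \<Rightarrow> 'b::ab_group_add \<Rightarrow> 'b" and I :: "'i set"
  shows tensor_zero: "0 \<in> tensor s I V"
  and tensor_add: "z \<in> tensor s I V \<Longrightarrow> w \<in> tensor s I V \<Longrightarrow> z + w \<in> tensor s I V"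
  and tensor_scale: "z \<in> tensor s I V \<Longrightarrow> fun_scale (*) c z \<in> tensor s I V"
  and tensor_diff: "z \<in> tensor s I V \<Longrightarrow> w \<in> tensor s I V \<Longrightarrow> z - w \<in> tensor s I V"
proof -
  interpret vector_space "fun_scale (*) :: 'k \<Rightarrow> ('i, 'b, 'k) tensor \<Rightarrow> ('i, 'b, 'k) tensor"
    by (rule vector_space_tensor)
  show "0 \<in> tensor s I V"
    using subspace_tensor subspace_0 by blast
  show "z \<in> tensor s I V \<Longrightarrow> w \<in> tensor s I V \<Longrightarrow> z + w \<in> tensor s I V"
    using subspace_tensor subspace_add by blast
  show "z \<in> tensor s I V \<Longrightarrow> fun_scale (*) c z \<in> tensor s I V"
    using subspace_tensor subspace_scale by blast
  show "z \<in> tensor s I V \<Longrightarrow> w \<in> tensor s I V \<Longrightarrow> z - w \<in> tensor s I V"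
    using subspace_tensor subspace_diff by blast
qed

lemma tensor_induct [consumes 1, case_names pure zero add scale]:
  fixes s :: "'k::field \<Rightarrow> 'b::ab_group_add \<Rightarrow> 'b"
  assumes z: "z \<in> tensor s I V"
    and pure: "\<And>x. x \<in> Pi\<^sub>E I V \<Longrightarrow> Q (pure_tensor s I V x)"
    and zero: "Q 0"
    and add: "\<And>z w. z \<in> tensor s I V \<Longrightarrow> w \<in> tensor s I V \<Longrightarrow> Q z \<Longrightarrow> Q w \<Longrightarrow> Q (z + w)"
    and scale: "\<And>c z. z \<in> tensor s I V \<Longrightarrow> Q z \<Longrightarrow> Q (fun_scale (*) c z)"
  shows "Q z"
proof -
  interpret vector_space "fun_scale (*) :: 'k \<Rightarrow> ('i, 'b, 'k) tensor \<Rightarrow> ('i, 'b, 'k) tensor"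
    by (rule vector_space_tensor)
  have "z \<in> tensor s I V \<and> Q z"
    using z[unfolded tensor_def]
  proof (induct rule: span_induct)
    case base
    show ?case
      unfolding subspace_def
      using zero add scale by (auto intro: tensor_zero tensor_add tensor_scale)
  next
    case (step x)
    then show ?case using pure pure_tensor_mem by blast
  qed
  then show ?thesis ..
qed

lemma lin_on_tensor_eqI:
  assumes f: "lin_on (fun_scale (*)) t (tensor s I V) W f"
    and g: "lin_on (fun_scale (*)) t (tensor s I V) W' g"
    and eq: "\<And>x. x \<in> Pi\<^sub>E I V \<Longrightarrow> f (pure_tensor s I V x) = g (pure_tensor s I V x)"
    and z: "z \<in> tensor s I V"
  shows "f z = g z"
  using z
proof (induct rule: tensor_induct)
  case zero
  then show ?case
    using lin_on_zero[OF f] lin_on_zero[OF g] tensor_zero by metis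
next
  case (pure x)
  then show ?case by (rule eq)
next
  case (add z w)
  show ?case
    unfolding lin_on_add[OF f add(1,2)] lin_on_add[OF g add(1,2)] add(3,4) ..
next
  case (scale c z)
  show ?case
    unfolding lin_on_scale[OF f scale(1)] lin_on_scale[OF g scale(1)] scale(2) ..
qed

lemma tensor_map_add: "tensor_map s I W f (z + w) = tensor_map s I W f z + tensor_map s I W f w"
  and tensor_map_scale: "tensor_map s I W f (fun_scale (*) c z) = fun_scale (*) c (tensor_map s I W f z)"
  by (rule ext, simp add: tensor_map_def fun_scale_def plus_fun_apply)+

lemma lin_on_tensor_map:
  assumes f: "\<And>i. i \<in> I \<Longrightarrow> lin_on s s (V i) (W i) (f i)"
  shows "lin_on (fun_scale (*)) (fun_scale (*)) (tensor s I V) (tensor s I W) (tensor_map s I W f)"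
proof -
  have "tensor_map s I W f z \<in> tensor s I W" if "z \<in> tensor s I V" for z
    using that
  proof (induct rule: tensor_induct)
    case (pure x)
    then have "(\<lambda>i\<in>I. f i (x i)) \<in> Pi\<^sub>E I W"
      using lin_on_mem[OF f] by (auto simp: PiE_iff)
    moreover have "tensor_map s I W f (pure_tensor s I V x) = pure_tensor s I W (\<lambda>i\<in>I. f i (x i))"
      by (rule tensor_map_pure) (use f pure in auto)
    ultimately show ?case
      by (simp only: pure_tensor_mem)
  next
    case zero
    have "tensor_map s I W f 0 = 0" by (simp add: tensor_map_def fun_eq_iff zero_fun_apply)
    then show ?case by (simp only: tensor_zero)
  next
    case (add z w)
    show ?case unfolding tensor_map_add by (rule tensor_add[OF add(3,4)])
  next
    case (scale c z)
    show ?case unfolding tensor_map_scale by (rule tensor_scale[OF scale(2)])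
  qed
  then show ?thesis
    unfolding lin_on_def image_subset_iff by (simp add: tensor_map_add tensor_map_scale)
qed

lemma multilinear_pure_tensor:
  shows "multilinear_on s (fun_scale (*)) I V (pure_tensor s I V)"
  unfolding multilinear_on_def
proof (intro ballI conjI allI)
  fix x i y z assume x: "x \<in> Pi\<^sub>E I V" "i \<in> I" "y \<in> V i" "z \<in> V i"
  have "B (x(i := y + z)) = B (x(i := y)) + B (x(i := z))" if "multilinear_on s (*) I V B" for B
    using that x unfolding multilinear_on_def by blast
  then show "pure_tensor s I V (x(i := y + z)) = pure_tensor s I V (x(i := y)) + pure_tensor s I V (x(i := z))"
    by (intro ext) (simp add: pure_tensor_def plus_fun_apply)
next
  fix x i y c assume x: "x \<in> Pi\<^sub>E I V" "i \<in> I" "y \<in> V i"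
  have "B (x(i := s c y)) = c * B (x(i := y))" if "multilinear_on s (*) I V B" for B
    using that x unfolding multilinear_on_def by blast
  then show "pure_tensor s I V (x(i := s c y)) = fun_scale (*) c (pure_tensor s I V (x(i := y)))"
    by (intro ext) (simp add: pure_tensor_def fun_scale_def)
qed

section \<open>Universal multilinear maps\<close>

text \<open>The target \<open>W\<close> of \<open>\<beta>\<close> is a tensor product of the \<open>V i\<close> in disguise. Only forms with values in the
  field are required to factor: linear functionals separate the points of \<open>W\<close>, so this already makes the
  map from the tensor product injective (\<open>universal_multilinear_iso\<close>), and the condition is inherited by
  iterated two-fold tensor products (\<open>universal_multilinear_insert\<close>).\<close>

definition universal_multilinear ::
    "('k::field \<Rightarrow> 'b::ab_group_add \<Rightarrow> 'b) \<Rightarrow> ('k \<Rightarrow> 'c::ab_group_add \<Rightarrow> 'c) \<Rightarrow>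
       'i set \<Rightarrow> ('i \<Rightarrow> 'b set) \<Rightarrow> 'c set \<Rightarrow> (('i \<Rightarrow> 'b) \<Rightarrow> 'c) \<Rightarrow> bool" where
  "universal_multilinear s t I V W \<beta> \<longleftrightarrow>
     multilinear_on s t I V \<beta> \<and> W = module.span t (\<beta> ` Pi\<^sub>E I V) \<and>
     (\<forall>B. multilinear_on s (*) I V B \<longrightarrow>
        (\<exists>g. lin_on t (*) W UNIV g \<and> (\<forall>x\<in>Pi\<^sub>E I V. g (\<beta> x) = B x)))"

lemma universal_multilinear_mem:
  assumes "universal_multilinear s t I V W \<beta>" "vector_space t" "x \<in> Pi\<^sub>E I V"
  shows "\<beta> x \<in> W"
proof -
  interpret vector_space t by fact
  show ?thesis using assms by (auto simp: universal_multilinear_def intro: span_base)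
qed

text \<open>The tensor product is spanned by evaluations of multilinear forms at points. Two elements with
  the same image in \<open>W\<close> agree on each form \<open>B\<close>, since \<open>B\<close> factors through \<open>W\<close>.\<close>

lemma universal_multilinear_iso:
  fixes s :: "'k::field \<Rightarrow> 'b::ab_group_add \<Rightarrow> 'b" and I :: "'i set"
  assumes t: "vector_space t" and \<beta>: "universal_multilinear s t I V W \<beta>"
  shows "\<exists>\<kappa>. lin_iso (fun_scale (*)) t (tensor s I V) W \<kappa> \<and>
             (\<forall>x\<in>Pi\<^sub>E I V. \<kappa> (pure_tensor s I V x) = \<beta> x)"
proof -
  interpret T: vector_space t by fact
  interpret S: vector_space "fun_scale (*) :: 'k \<Rightarrow> ('i, 'b, 'k) tensor \<Rightarrow> ('i, 'b, 'k) tensor"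
    by (rule vector_space_tensor)
  obtain g where g: "lin_on (fun_scale (*)) t (tensor s I V) UNIV g"
    and gp: "\<And>x. x \<in> Pi\<^sub>E I V \<Longrightarrow> g (pure_tensor s I V x) = \<beta> x"
    using tensor_universal[OF t, of s I V \<beta>] \<beta> by (auto simp: universal_multilinear_def)
  have W: "W = T.span (\<beta> ` Pi\<^sub>E I V)"
    using \<beta> by (simp add: universal_multilinear_def)
  have im: "g z \<in> W" if "z \<in> tensor s I V" for z
    using that
  proof (induct rule: tensor_induct)
    case (pure x)
    then show ?case using gp universal_multilinear_mem[OF \<beta> t] by metis
  next
    case zero
    then show ?case using lin_on_zero[OF g tensor_zero] by (simp add: W T.span_zero)
  qed (auto simp: lin_on_add[OF g] lin_on_scale[OF g] W T.span_add T.span_scale)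
  have "W \<subseteq> g ` tensor s I V"
    unfolding W
  proof (rule T.span_minimal)
    show "\<beta> ` Pi\<^sub>E I V \<subseteq> g ` tensor s I V"
      using gp pure_tensor_mem by (metis image_eqI image_subsetI)
    show "T.subspace (g ` tensor s I V)"
      by (rule subspace_lin_image[OF vector_space_tensor t subspace_tensor g])
  qed
  then have sur: "g ` tensor s I V = W"
    using im by auto
  have "z = w" if z: "z \<in> tensor s I V" and w: "w \<in> tensor s I V" and eq: "g z = g w" for z w
  proof
    fix B
    show "z B = w B"
    proof (cases "multilinear_on s (*) I V B")
      case True
      then obtain h where h: "lin_on t (*) W UNIV h" and hB: "\<And>x. x \<in> Pi\<^sub>E I V \<Longrightarrow> h (\<beta> x) = B x"
        using \<beta> by (auto simp: universal_multilinear_def)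
      have gW: "lin_on (fun_scale (*)) t (tensor s I V) W g"
        using g im by (auto simp: lin_on_def)
      have ev: "lin_on (fun_scale (*)) (*) (tensor s I V) UNIV (\<lambda>z. z B)"
        by (auto simp: lin_on_def fun_scale_def plus_fun_apply)
      have "(h \<circ> g) u = u B" if "u \<in> tensor s I V" for u
        using lin_on_tensor_eqI[OF lin_on_compose[OF gW h] ev _ that] gp hB True
        by (simp add: pure_tensor_def)
      then show ?thesis using z w eq by (metis comp_apply)
    next
      case False
      have "u B = 0" if "u \<in> tensor s I V" for u
        using that by (induct rule: tensor_induct) (auto simp: pure_tensor_def False fun_scale_def plus_fun_apply zero_fun_apply)
      from this[OF z] this[OF w] show ?thesis by simp
    qed
  qed
  then have "bij_betw g (tensor s I V) W"
    using sur by (auto simp: bij_betw_def inj_on_def)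
  moreover have "lin_on (fun_scale (*)) t (tensor s I V) W g"
    using g im by (auto simp: lin_on_def)
  ultimately show ?thesis
    using gp by (auto simp: lin_iso_def)
qed

text \<open>This is the associativity of tensor products that adds one factor to a list. A form \<open>B\<close> on all
  factors gives, for each \<open>a \<in> V v\<close>, a functional \<open>g a\<close> on \<open>W\<close>; it is linear in \<open>a\<close> because functionals
  on \<open>W\<close> are determined by their values on the image of \<open>\<beta>\<close>, and so \<open>g\<close> is a bilinear form.\<close>

lemma universal_multilinear_insert:
  fixes s :: "'k::field \<Rightarrow> 'b::ab_group_add \<Rightarrow> 'b"
  assumes s: "vector_space s"
    and v: "v \<notin> I" and Vv: "module.subspace s (V v)"
    and \<beta>: "universal_multilinear s s I V W \<beta>"
    and \<theta>: "lin_iso (fun_scale (*)) s (tensor s UNIV (case_bool (V v) W)) U \<theta>"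
    and subV: "\<And>i. i \<in> I \<Longrightarrow> module.subspace s (V i)"
    and \<gamma>: "\<And>x. x \<in> Pi\<^sub>E (insert v I) V \<Longrightarrow>
             \<gamma> x = \<theta> (pure_tensor s UNIV (case_bool (V v) W) (case_bool (x v) (\<beta> (restrict x I))))"
  shows "universal_multilinear s s (insert v I) V U \<gamma>"
proof -
  interpret S: vector_space s by fact
  let ?F = "case_bool (V v) W"
  let ?p = "\<lambda>a w. \<theta> (pure_tensor s UNIV ?F (case_bool a w))"
  have W: "W = S.span (\<beta> ` Pi\<^sub>E I V)" and \<beta>m: "multilinear_on s s I V \<beta>"
    using \<beta> by (auto simp: universal_multilinear_def)
  have \<beta>W: "\<beta> x \<in> W" if "x \<in> Pi\<^sub>E I V" for x
    using universal_multilinear_mem[OF \<beta> s that] .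
  have subW: "S.subspace W" by (simp add: W)
  have \<theta>l: "lin_on (fun_scale (*)) s (tensor s UNIV ?F) U \<theta>" and \<theta>b: "bij_betw \<theta> (tensor s UNIV ?F) U"
    using \<theta> by (auto simp: lin_iso_def)
  have cb: "case_bool a w \<in> Pi\<^sub>E UNIV ?F" if "a \<in> V v" "w \<in> W" for a w
    using that by (auto simp: PiE_iff split: bool.splits)
  have pt: "pure_tensor s UNIV ?F (case_bool a w) \<in> tensor s UNIV ?F" if "a \<in> V v" "w \<in> W" for a w
    by (rule pure_tensor_mem[OF cb[OF that]])
  have mp: "multilinear_on s (fun_scale (*)) UNIV ?F (pure_tensor s UNIV ?F)"
    by (rule multilinear_pure_tensor)
  have upd: "(case_bool a w)(True := a') = case_bool a' w" "(case_bool a w)(False := w') = case_bool a w'"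
    for a a' :: 'b and w w'
    by (auto simp: fun_eq_iff split: bool.splits)
  have ptadd1: "?p (a + a') w = ?p a w + ?p a' w" if "a \<in> V v" "a' \<in> V v" "w \<in> W" for a a' w
    using mp[unfolded multilinear_on_def, rule_format, OF cb[OF that(1,3)], of True a] that
    by (simp add: upd lin_on_add[OF \<theta>l] pt)
  have ptsc1: "?p (s c a) w = s c (?p a w)" if "a \<in> V v" "w \<in> W" for a c w
    using mp[unfolded multilinear_on_def, rule_format, OF cb[OF that(1,2)], of True a] that
    by (simp add: upd lin_on_scale[OF \<theta>l] pt)
  have ptadd2: "?p a (w + w') = ?p a w + ?p a w'" if "a \<in> V v" "w \<in> W" "w' \<in> W" for a w w'
    using mp[unfolded multilinear_on_def, rule_format, OF cb[OF that(1,2)], of False w] that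
    by (simp add: upd lin_on_add[OF \<theta>l] pt)
  have ptsc2: "?p a (s c w) = s c (?p a w)" if "a \<in> V v" "w \<in> W" for a c w
    using mp[unfolded multilinear_on_def, rule_format, OF cb[OF that(1,2)], of False w] that
    by (simp add: upd lin_on_scale[OF \<theta>l] pt)
  have pU: "?p a w \<in> U" if "a \<in> V v" "w \<in> W" for a w
    using pt[OF that] \<theta>l by (simp add: lin_on_mem)
  have res: "restrict x I \<in> Pi\<^sub>E I V" "x v \<in> V v" if "x \<in> Pi\<^sub>E (insert v I) V" for x
    using that by (auto simp: PiE_iff)
  have ext: "y(v := a) \<in> Pi\<^sub>E (insert v I) V" "restrict (y(v := a)) I = y"
    if "y \<in> Pi\<^sub>E I V" "a \<in> V v" for y a
    using that v by (auto simp: PiE_iff extensional_def fun_eq_iff restrict_def)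
  have \<gamma>_ext: "\<gamma> (y(v := a)) = ?p a (\<beta> y)" if "y \<in> Pi\<^sub>E I V" "a \<in> V v" for y a
    using \<gamma>[OF ext(1)[OF that]] ext(2)[OF that] by simp
  have updE: "x(i := y) \<in> Pi\<^sub>E (insert v I) V" if "x \<in> Pi\<^sub>E (insert v I) V" "i \<in> insert v I" "y \<in> V i" for x i y
    using that by (auto simp: PiE_iff extensional_def)
  have "multilinear_on s s (insert v I) V \<gamma>"
    unfolding multilinear_on_def
  proof (intro ballI)
    fix x i y assume x: "x \<in> Pi\<^sub>E (insert v I) V" and i: "i \<in> insert v I" and y: "y \<in> V i"
    let ?x = "restrict x I"
    show "(\<forall>z\<in>V i. \<gamma> (x(i := y + z)) = \<gamma> (x(i := y)) + \<gamma> (x(i := z))) \<and>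
          (\<forall>c. \<gamma> (x(i := s c y)) = s c (\<gamma> (x(i := y))))"
    proof (cases "i = v")
      case True
      have "\<gamma> (x(i := u)) = ?p u (\<beta> ?x)" if "u \<in> V v" for u
      proof -
        have "restrict (x(v := u)) I = ?x" using v by (auto simp: fun_eq_iff)
        then show ?thesis using \<gamma>[OF updE[OF x i]] that True by simp
      qed
      then show ?thesis
        using y True \<beta>W[OF res(1)[OF x]] S.subspace_add[OF Vv] S.subspace_scale[OF Vv]
        by (simp add: ptadd1 ptsc1)
    next
      case False
      then have iI: "i \<in> I" using i by simp
      have \<gamma>u: "\<gamma> (x(i := u)) = ?p (x v) (\<beta> (?x(i := u)))" if "u \<in> V i" for u
      proof -
        have "restrict (x(i := u)) I = ?x(i := u)" using iI by (auto simp: fun_eq_iff)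
        then show ?thesis using \<gamma>[OF updE[OF x i that]] False by simp
      qed
      have xu: "?x(i := u) \<in> Pi\<^sub>E I V" if "u \<in> V i" for u
        using res(1)[OF x] that iI by (auto simp: PiE_iff extensional_def)
      have "(\<forall>z\<in>V i. \<beta> (?x(i := y + z)) = \<beta> (?x(i := y)) + \<beta> (?x(i := z))) \<and>
            (\<forall>c. \<beta> (?x(i := s c y)) = s c (\<beta> (?x(i := y))))"
        using \<beta>m[unfolded multilinear_on_def] res(1)[OF x] iI y by blast
      then show ?thesis
        using y iI \<beta>W[OF xu] S.subspace_add[OF subV] S.subspace_scale[OF subV] res(2)[OF x]
        by (simp add: \<gamma>u ptadd2 ptsc2)
    qed
  qed
  moreover have "U = S.span (\<gamma> ` Pi\<^sub>E (insert v I) V)"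
  proof
    have subU: "S.subspace U"
    proof -
      have "S.subspace (\<theta> ` tensor s UNIV ?F)"
        by (rule subspace_lin_image[OF vector_space_tensor s subspace_tensor \<theta>l])
      then show ?thesis using \<theta>b by (simp add: bij_betw_def)
    qed
    have "\<gamma> ` Pi\<^sub>E (insert v I) V \<subseteq> U"
      using \<gamma> pU res \<beta>W by auto
    then show "S.span (\<gamma> ` Pi\<^sub>E (insert v I) V) \<subseteq> U"
      using subU S.span_minimal by blast
    let ?G = "S.span (\<gamma> ` Pi\<^sub>E (insert v I) V)"
    have pG: "w \<in> W \<and> ?p a w \<in> ?G" if a: "a \<in> V v" and w: "w \<in> W" for a w
      using w[unfolded W]
    proof (induct rule: S.span_induct)
      case base
      have "?p a 0 = 0"
        using ptsc2[OF a, of 0 0] S.subspace_0[OF subW] by simp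
      then show ?case
        unfolding S.subspace_def mem_Collect_eq
        using S.subspace_0[OF subW] S.subspace_add[OF subW] S.subspace_scale[OF subW]
        by (auto simp: ptadd2[OF a] ptsc2[OF a] S.span_zero intro: S.span_add S.span_scale)
    next
      case (step w)
      then obtain y where y: "y \<in> Pi\<^sub>E I V" "w = \<beta> y" by auto
      then have "?p a w = \<gamma> (y(v := a))" using \<gamma>_ext a by simp
      then show ?case
        using y ext(1)[OF y(1) a] \<beta>W by (auto intro: S.span_base)
    qed
    have "\<theta> z \<in> ?G" if "z \<in> tensor s UNIV ?F" for z
      using that
    proof (induct rule: tensor_induct)
      case (pure x)
      have "x = case_bool (x True) (x False)" by (auto simp: fun_eq_iff split: bool.splits)
      moreover have "x True \<in> V v" "x False \<in> W" using pure by (auto simp: PiE_iff split: bool.splits)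
      ultimately show ?case using pG by metis
    next
      case zero
      then show ?case using lin_on_zero[OF \<theta>l tensor_zero] by (simp add: S.span_zero)
    qed (auto simp: lin_on_add[OF \<theta>l] lin_on_scale[OF \<theta>l] intro: S.span_add S.span_scale)
    then show "U \<subseteq> ?G" using \<theta>b by (auto simp: bij_betw_def)
  qed
  moreover have "\<exists>g. lin_on s (*) U UNIV g \<and> (\<forall>x\<in>Pi\<^sub>E (insert v I) V. g (\<gamma> x) = B x)"
    if B: "multilinear_on s (*) (insert v I) V B" for B
  proof -
    have Bm: "multilinear_on s (*) I V (\<lambda>y. B (y(v := a)))" if "a \<in> V v" for a
      unfolding multilinear_on_def
    proof (intro ballI)
      fix x i y assume H: "x \<in> Pi\<^sub>E I V" "i \<in> I" "y \<in> V i"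
      have "x(i := u, v := a) = x(v := a, i := u)" for u
        using H v by (auto simp: fun_upd_twist)
      then show "(\<forall>z\<in>V i. B (x(i := y + z, v := a)) = B (x(i := y, v := a)) + B (x(i := z, v := a))) \<and>
            (\<forall>c. B (x(i := s c y, v := a)) = c * B (x(i := y, v := a)))"
        using B[unfolded multilinear_on_def, rule_format, OF ext(1)[OF H(1) that], of i y] H by simp
    qed
    \<comment> \<open>currying: one functional on \<open>W\<close> for each value at \<open>v\<close>\<close>
    then have "\<forall>a\<in>V v. \<exists>g. lin_on s (*) W UNIV g \<and> (\<forall>y\<in>Pi\<^sub>E I V. g (\<beta> y) = B (y(v := a)))"
      using \<beta> by (auto simp: universal_multilinear_def)
    then obtain g where g: "\<And>a. a \<in> V v \<Longrightarrow> lin_on s (*) W UNIV (g a)"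
      and gB: "\<And>a y. a \<in> V v \<Longrightarrow> y \<in> Pi\<^sub>E I V \<Longrightarrow> g a (\<beta> y) = B (y(v := a))"
      by metis
    have Bv: "B (y(v := a + a')) = B (y(v := a)) + B (y(v := a'))" "B (y(v := s c a)) = c * B (y(v := a))"
      if "y \<in> Pi\<^sub>E I V" "a \<in> V v" "a' \<in> V v" for y a a' c
      using B[unfolded multilinear_on_def, rule_format, OF ext(1)[OF that(1,2)], of v a] that by auto
    have gadd: "w \<in> W \<and> g (a + a') w = g a w + g a' w" if a: "a \<in> V v" "a' \<in> V v" and w: "w \<in> W" for a a' w
      using w[unfolded W]
    proof (induct rule: S.span_induct)
      case base
      have aa: "a + a' \<in> V v" using a S.subspace_add[OF Vv] by blast
      have "g b 0 = 0" if "b \<in> V v" for b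
        using lin_on_zero[OF g[OF that] S.subspace_0[OF subW]] .
      then show ?case
        unfolding S.subspace_def mem_Collect_eq
        using a aa S.subspace_0[OF subW] S.subspace_add[OF subW] S.subspace_scale[OF subW]
        by (auto simp: lin_on_add[OF g] lin_on_scale[OF g] algebra_simps)
    next
      case (step w)
      then show ?case using a Bv(1) S.subspace_add[OF Vv a] \<beta>W by (auto simp: gB)
    qed
    have gsc: "w \<in> W \<and> g (s c a) w = c * g a w" if a: "a \<in> V v" and w: "w \<in> W" for a c w
      using w[unfolded W]
    proof (induct rule: S.span_induct)
      case base
      have aa: "s c a \<in> V v" using a S.subspace_scale[OF Vv] by blast
      have "g b 0 = 0" if "b \<in> V v" for b
        using lin_on_zero[OF g[OF that] S.subspace_0[OF subW]] .
      then show ?case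
        unfolding S.subspace_def mem_Collect_eq
        using a aa S.subspace_0[OF subW] S.subspace_add[OF subW] S.subspace_scale[OF subW]
        by (auto simp: lin_on_add[OF g] lin_on_scale[OF g] algebra_simps)
    next
      case (step w)
      then show ?case using a Bv(2)[OF _ a a] S.subspace_scale[OF Vv a] \<beta>W by (auto simp: gB)
    qed
    have "multilinear_on s (*) UNIV ?F (\<lambda>x. g (x True) (x False))"
      unfolding multilinear_on_def
    proof (intro ballI)
      fix x i y assume x: "x \<in> Pi\<^sub>E UNIV ?F" and y: "y \<in> ?F i"
      have xx: "x True \<in> V v" "x False \<in> W" using x by (auto simp: PiE_iff split: bool.splits)
      show "(\<forall>z\<in>?F i. g ((x(i := y + z)) True) ((x(i := y + z)) False) =
              g ((x(i := y)) True) ((x(i := y)) False) + g ((x(i := z)) True) ((x(i := z)) False)) \<and>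
            (\<forall>c. g ((x(i := s c y)) True) ((x(i := s c y)) False) =
              c * g ((x(i := y)) True) ((x(i := y)) False))"
        using xx y by (cases i) (auto simp: gadd[THEN conjunct2] gsc[THEN conjunct2] lin_on_add[OF g] lin_on_scale[OF g])
    qed
    from tensor_universal[OF vector_space_mult this] obtain h
      where h: "lin_on (fun_scale (*)) (*) (tensor s UNIV ?F) UNIV h"
      and hp: "\<And>x. x \<in> Pi\<^sub>E UNIV ?F \<Longrightarrow> h (pure_tensor s UNIV ?F x) = g (x True) (x False)"
      by blast
    have inv: "lin_iso s (fun_scale (*)) U (tensor s UNIV ?F) (inv_into (tensor s UNIV ?F) \<theta>)"
      by (rule lin_iso_inverse[OF \<theta> vector_space_tensor subspace_tensor])
    have "lin_on s (*) U UNIV (h \<circ> inv_into (tensor s UNIV ?F) \<theta>)"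
      using inv h lin_on_compose by (auto simp: lin_iso_def)
    moreover have "(h \<circ> inv_into (tensor s UNIV ?F) \<theta>) (\<gamma> x) = B x" if x: "x \<in> Pi\<^sub>E (insert v I) V" for x
    proof -
      have m: "x v \<in> V v" "\<beta> (restrict x I) \<in> W" using res[OF x] \<beta>W by auto
      have "(h \<circ> inv_into (tensor s UNIV ?F) \<theta>) (\<gamma> x) = g (x v) (\<beta> (restrict x I))"
        using \<gamma>[OF x] pt[OF m] bij_betw_inv_into_left[OF \<theta>b] hp[OF cb[OF m]] by simp
      also have "\<dots> = B ((restrict x I)(v := x v))"
        using gB res[OF x] by blast
      also have "(restrict x I)(v := x v) = x"
        using x by (auto simp: fun_eq_iff PiE_iff extensional_def)
      finally show ?thesis .
    qed
    ultimately show ?thesis by blast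
  qed
  ultimately show ?thesis
    by (auto simp: universal_multilinear_def)
qed

section \<open>Extension of compatible families in a polyhedral tensor diagram\<close>

definition mixed_family :: "('p \<Rightarrow> 'b set) \<Rightarrow> ('p \<Rightarrow> 'b set) \<Rightarrow> 'p set \<Rightarrow> 'p \<Rightarrow> 'b set" where
  "mixed_family M N U v = (if v \<in> U then M v else N v)"

text \<open>The transition map from the tensor factors at \<open>U\<close> to those at \<open>U'\<close>, where no inclusion between the two
  sets of vertices is assumed: \<open>a\<close> is applied where a vertex is lost and \<open>\<sigma>\<close> where one is gained.\<close>

definition mixed_map :: "('p \<Rightarrow> 'b \<Rightarrow> 'b) \<Rightarrow> ('p \<Rightarrow> 'b \<Rightarrow> 'b) \<Rightarrow> 'p set \<Rightarrow> 'p set \<Rightarrow> 'p \<Rightarrow> 'b \<Rightarrow> 'b" where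
  "mixed_map a \<sigma> U' U v =
     (if v \<in> U then if v \<in> U' then id else a v else if v \<in> U' then \<sigma> v else id)"

abbreviation mixed_tensor_map where
  "mixed_tensor_map s I M N a \<sigma> U' U \<equiv> tensor_map s I (mixed_family M N U') (mixed_map a \<sigma> U' U)"

lemma lin_on_mixed_map:
  assumes "lin_on s s (M v) (N v) (a v)" "lin_on s s (N v) (M v) (\<sigma> v)"
  shows "lin_on s s (mixed_family M N U v) (mixed_family M N U' v) (mixed_map a \<sigma> U' U v)"
proof -
  have "lin_on s s V V id" for V by (simp add: lin_on_def)
  then show ?thesis using assms by (simp add: mixed_family_def mixed_map_def)
qed

lemma lin_on_mixed_tensor_map:
  assumes "\<And>v. v \<in> I \<Longrightarrow> lin_on s s (M v) (N v) (a v)"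
    and "\<And>v. v \<in> I \<Longrightarrow> lin_on s s (N v) (M v) (\<sigma> v)"
  shows "lin_on (fun_scale (*)) (fun_scale (*)) (tensor s I (mixed_family M N U))
           (tensor s I (mixed_family M N U')) (mixed_tensor_map s I M N a \<sigma> U' U)"
  by (intro lin_on_tensor_map lin_on_mixed_map assms)

lemma mixed_tensor_map_pure:
  assumes "\<And>v. v \<in> I \<Longrightarrow> lin_on s s (M v) (N v) (a v)"
    and "\<And>v. v \<in> I \<Longrightarrow> lin_on s s (N v) (M v) (\<sigma> v)"
    and "x \<in> Pi\<^sub>E I (mixed_family M N U)"
  shows "mixed_tensor_map s I M N a \<sigma> U' U (pure_tensor s I (mixed_family M N U) x) =
           pure_tensor s I (mixed_family M N U') (\<lambda>v\<in>I. mixed_map a \<sigma> U' U v (x v))"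
  by (intro tensor_map_pure lin_on_mixed_map assms)

text \<open>On a single factor the composite differs from the direct map only by \<open>\<sigma> v \<circ> a v\<close> in place of the identity,
  at vertices in \<open>U\<close> and \<open>U''\<close> but not in \<open>U'\<close>; the inclusion rules these out. Everywhere else
  functoriality is trivial or is the equation \<open>a v \<circ> \<sigma> v = id\<close>.\<close>

lemma mixed_tensor_map_compose:
  assumes a: "\<And>v. v \<in> I \<Longrightarrow> lin_on s s (M v) (N v) (a v)"
    and \<sigma>: "\<And>v. v \<in> I \<Longrightarrow> lin_on s s (N v) (M v) (\<sigma> v)"
    and sec: "\<And>v y. v \<in> I \<Longrightarrow> y \<in> N v \<Longrightarrow> a v (\<sigma> v y) = y"
    and U: "U \<inter> U'' \<subseteq> U'"
    and z: "z \<in> tensor s I (mixed_family M N U)"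
  shows "mixed_tensor_map s I M N a \<sigma> U'' U' (mixed_tensor_map s I M N a \<sigma> U' U z) =
         mixed_tensor_map s I M N a \<sigma> U'' U z"
proof -
  note lin = lin_on_mixed_tensor_map[of I s M N a \<sigma>, OF a \<sigma>]
  have "(mixed_tensor_map s I M N a \<sigma> U'' U' \<circ> mixed_tensor_map s I M N a \<sigma> U' U) z =
         mixed_tensor_map s I M N a \<sigma> U'' U z"
  proof (rule lin_on_tensor_eqI[OF lin_on_compose[OF lin lin] lin _ z])
    fix x assume x: "x \<in> Pi\<^sub>E I (mixed_family M N U)"
    let ?y = "\<lambda>v\<in>I. mixed_map a \<sigma> U' U v (x v)"
    have y: "?y \<in> Pi\<^sub>E I (mixed_family M N U')"
      using x lin_on_mem[OF lin_on_mixed_map[of s M _ N a \<sigma> U U']] a \<sigma>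
      by (auto simp: PiE_iff)
    have eq: "(\<lambda>v\<in>I. mixed_map a \<sigma> U'' U' v (?y v)) = (\<lambda>v\<in>I. mixed_map a \<sigma> U'' U v (x v))"
    proof
      fix v
      have "x v \<in> mixed_family M N U v" if "v \<in> I" using x that by (auto simp: PiE_iff)
      then show "(\<lambda>v\<in>I. mixed_map a \<sigma> U'' U' v (?y v)) v = (\<lambda>v\<in>I. mixed_map a \<sigma> U'' U v (x v)) v"
        using U sec by (auto simp: mixed_map_def mixed_family_def)
    qed
    have 1: "mixed_tensor_map s I M N a \<sigma> U' U (pure_tensor s I (mixed_family M N U) x) =
           pure_tensor s I (mixed_family M N U') ?y"
      by (rule mixed_tensor_map_pure) (use a \<sigma> x in auto)
    have 2: "mixed_tensor_map s I M N a \<sigma> U'' U' (pure_tensor s I (mixed_family M N U') ?y) =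
           pure_tensor s I (mixed_family M N U'') (\<lambda>v\<in>I. mixed_map a \<sigma> U'' U' v (?y v))"
      by (rule mixed_tensor_map_pure) (use a \<sigma> y in auto)
    have 3: "mixed_tensor_map s I M N a \<sigma> U'' U (pure_tensor s I (mixed_family M N U) x) =
           pure_tensor s I (mixed_family M N U'') (\<lambda>v\<in>I. mixed_map a \<sigma> U'' U v (x v))"
      by (rule mixed_tensor_map_pure) (use a \<sigma> x in auto)
    show "(mixed_tensor_map s I M N a \<sigma> U'' U' \<circ> mixed_tensor_map s I M N a \<sigma> U' U)
            (pure_tensor s I (mixed_family M N U) x) =
          mixed_tensor_map s I M N a \<sigma> U'' U (pure_tensor s I (mixed_family M N U) x)"
      unfolding comp_def 1 2 3 eq ..
  qed
  then show ?thesis by simp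
qed

lemma polyhedral_tensor_family_eq:
  "polyhedral_tensor_family P M N p = mixed_family M N (vertices_below P p)"
  by (simp add: fun_eq_iff polyhedral_tensor_family_def mixed_family_def)

lemma vertices_below_mono: "p \<le> q \<Longrightarrow> vertices_below P p \<subseteq> vertices_below P q"
  by (auto simp: vertices_below_def)

lemma lin_on_polyhedral_tensor_map:
  assumes "p \<le> q" "\<And>v. v \<in> vertices P \<Longrightarrow> lin_on s s (M v) (N v) (a v)"
  shows "lin_on (fun_scale (*)) (fun_scale (*)) (polyhedral_tensor_diagram s P M N q)
           (polyhedral_tensor_diagram s P M N p) (polyhedral_tensor_map s P M N a p q)"
  unfolding polyhedral_tensor_diagram_def polyhedral_tensor_map_def
proof (rule lin_on_tensor_map)
  fix v assume v: "v \<in> vertices P"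
  have "lin_on s s V V id" for V by (simp add: lin_on_def)
  then show "lin_on s s (polyhedral_tensor_family P M N q v) (polyhedral_tensor_family P M N p v)
      (if v \<in> vertices_below P p then id else if v \<in> vertices_below P q then a v else id)"
    using assms(2)[OF v] vertices_below_mono[OF assms(1), of P] by (auto simp: polyhedral_tensor_family_def)
qed

lemma polyhedral_tensor_map_eq:
  assumes "p \<le> q"
  shows "polyhedral_tensor_map s P M N a p q =
    mixed_tensor_map s (vertices P) M N a \<sigma> (vertices_below P p) (vertices_below P q)"
proof -
  have "(\<lambda>v. if v \<in> vertices_below P p then id else if v \<in> vertices_below P q then a v else id) =
        mixed_map a \<sigma> (vertices_below P p) (vertices_below P q)"
    using vertices_below_mono[OF assms] by (auto simp: fun_eq_iff mixed_map_def)
  then show ?thesis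
    by (simp add: polyhedral_tensor_map_def polyhedral_tensor_family_eq)
qed

text \<open>An upper bound \<open>m\<close> in a finite poset lies above a minimal one, so \<open>joins P p q\<close> is nonempty and lower
  saturation applies to \<open>p\<close> and \<open>q\<close>.\<close>

lemma lower_saturated_meet:
  assumes P: "finite P" "lower_saturated P" and m: "m \<in> P" "p \<in> P" "q \<in> P" "p \<le> m" "q \<le> m"
  obtains w where "w \<in> P" "w \<le> p" "w \<le> q"
    "vertices_below P w = vertices_below P p \<inter> vertices_below P q"
proof -
  let ?B = "{z \<in> P. p \<le> z \<and> q \<le> z}"
  obtain z where "z \<in> ?B" "\<forall>y\<in>?B. \<not> y < z"
    using finite_has_minimal[of ?B] P m by fastforce
  then have "z \<in> joins P p q" by (auto simp: joins_def)
  then obtain w where "w \<in> meets P p q" "vertices_below P w = vertices_below P p \<inter> vertices_below P q"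
    using P(2) m unfolding lower_saturated_def by blast
  then show thesis by (intro that) (auto simp: meets_def)
qed

text \<open>Surjectivity of the map from \<open>T m\<close> to the limit of \<open>T\<close> over the elements below \<open>m\<close>, which is the only
  place where lower saturation and the sections enter.\<close>

lemma polyhedral_tensor_extension:
  fixes s :: "'k::field \<Rightarrow> 'b::ab_group_add \<Rightarrow> 'b" and P :: "'p::order set"
  assumes P: "finite P" "lower_saturated P" and m: "m \<in> P"
    and a: "\<And>v. v \<in> vertices P \<Longrightarrow> lin_on s s (M v) (N v) (a v)"
    and sec: "\<And>v. v \<in> vertices P \<Longrightarrow> \<exists>\<sigma>. lin_on s s (N v) (M v) \<sigma> \<and> (\<forall>y\<in>N v. a v (\<sigma> y) = y)"
    and \<tau>: "\<And>p. p \<in> P \<Longrightarrow> p < m \<Longrightarrow> \<tau> p \<in> polyhedral_tensor_diagram s P M N p"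
    and compat: "\<And>p q. p \<in> P \<Longrightarrow> q \<in> P \<Longrightarrow> p \<le> q \<Longrightarrow> q < m \<Longrightarrow>
                   polyhedral_tensor_map s P M N a p q (\<tau> q) = \<tau> p"
  shows "\<exists>x\<in>polyhedral_tensor_diagram s P M N m.
           \<forall>p\<in>P. p < m \<longrightarrow> polyhedral_tensor_map s P M N a p m x = \<tau> p"
proof -
  obtain \<sigma> where \<sigma>: "\<And>v. v \<in> vertices P \<Longrightarrow> lin_on s s (N v) (M v) (\<sigma> v)"
    and a\<sigma>: "\<And>v y. v \<in> vertices P \<Longrightarrow> y \<in> N v \<Longrightarrow> a v (\<sigma> v y) = y"
    using sec by metis
  define V where "V = vertices_below P"
  define D where "D p = tensor s (vertices P) (mixed_family M N (V p))" for p
  define t where "t p q = mixed_tensor_map s (vertices P) M N a \<sigma> (V p) (V q)" for p q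
  have D: "polyhedral_tensor_diagram s P M N p = D p" for p
    by (simp add: polyhedral_tensor_diagram_def polyhedral_tensor_family_eq D_def V_def)
  have tle: "polyhedral_tensor_map s P M N a p q = t p q" if "p \<le> q" for p q
    by (simp add: polyhedral_tensor_map_eq[OF that] t_def V_def)
  have t_lin: "lin_on (fun_scale (*)) (fun_scale (*)) (D q) (D p) (t p q)" for p q
    unfolding D_def t_def by (rule lin_on_mixed_tensor_map[OF a \<sigma>])
  have tt: "t p q (t q r z) = t p r z" if "V r \<inter> V p \<subseteq> V q" "z \<in> D r" for p q r z
    unfolding t_def
    by (rule mixed_tensor_map_compose[OF a \<sigma> a\<sigma>]) (use that in \<open>auto simp: D_def\<close>)
  have vb: "V p \<subseteq> V q" if "p \<le> q" for p q
    using vertices_below_mono[OF that] by (simp add: V_def)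
  have tid: "t p p z = z" if "z \<in> D p" for p z
  proof -
    have id: "lin_on (fun_scale (*)) (fun_scale (*)) (D p) (D p) id" by (simp add: lin_on_def)
    have pure: "t p p (pure_tensor s (vertices P) (mixed_family M N (V p)) x) =
        id (pure_tensor s (vertices P) (mixed_family M N (V p)) x)"
      if x: "x \<in> Pi\<^sub>E (vertices P) (mixed_family M N (V p))" for x
    proof -
      have e: "(\<lambda>v\<in>vertices P. mixed_map a \<sigma> (V p) (V p) v (x v)) = x"
        using x by (auto simp: fun_eq_iff mixed_map_def PiE_iff extensional_def)
      show ?thesis
        using mixed_tensor_map_pure[OF a \<sigma> x, of "V p"] by (simp add: t_def e)
    qed
    show ?thesis
      using lin_on_tensor_eqI[OF t_lin[of p p, unfolded D_def] id[unfolded D_def] pure] that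
      by (simp add: D_def)
  qed
  \<comment> \<open>prescribe the values one element of \<open>R\<close> at a time\<close>
  have "\<exists>x\<in>D m. \<forall>p\<in>R. t p m x = \<tau> p" if "finite R" "R \<subseteq> {p \<in> P. p < m}" for R
    using that
  proof (induct R)
    case empty
    then show ?case using tensor_zero by (auto simp: D_def)
  next
    case (insert p R)
    then obtain x where x: "x \<in> D m" and xR: "\<And>q. q \<in> R \<Longrightarrow> t q m x = \<tau> q" by auto
    have p: "p \<in> P" "p < m" using insert by auto
    \<comment> \<open>the error at \<open>p\<close>, which the section \<open>t m p\<close> lifts to \<open>D m\<close>\<close>
    let ?e = "\<tau> p - t p m x"
    have \<tau>p: "\<tau> p \<in> D p" using \<tau> p by (simp add: D)
    have tx: "t q m x \<in> D q" for q using x t_lin lin_on_mem by blast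
    have e: "?e \<in> D p"
      unfolding D_def by (rule tensor_diff) (use \<tau>p tx in \<open>simp_all add: D_def\<close>)
    define y where "y = x + t m p ?e"
    have te: "t m p ?e \<in> D m" using e t_lin lin_on_mem by blast
    have y: "y \<in> D m"
      unfolding y_def D_def by (rule tensor_add) (use x te in \<open>simp_all add: D_def\<close>)
    have ty: "t q m y = t q m x + t q p ?e" if "q \<in> P" "q \<le> m" for q
    proof -
      have "t q m (t m p ?e) = t q p ?e"
        by (rule tt[OF _ e]) (use vb[OF that(2)] in auto)
      then show ?thesis
        by (simp add: y_def lin_on_add[OF t_lin x te])
    qed
    have "t p m y = \<tau> p"
      using ty[OF p(1)] p tid[OF e] by simp
    moreover have "t q m y = \<tau> q" if q: "q \<in> R" for q
    proof -
      have qP: "q \<in> P" "q < m" using insert q by auto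
      \<comment> \<open>the correction changes the value at \<open>q\<close> by \<open>t q p ?e\<close>, which factors through \<open>w\<close>\<close>
      obtain w where w: "w \<in> P" "w \<le> q" "w \<le> p" "V w = V q \<inter> V p"
        using lower_saturated_meet[OF P m qP(1) p(1)] qP(2) p(2) unfolding V_def by (metis less_imp_le)
      have "t w p ?e = t w p (\<tau> p) - t w p (t p m x)"
        by (rule lin_on_minus[OF vector_space_tensor vector_space_tensor subspace_tensor
              t_lin[unfolded D_def, where p=w and q=p]]) (use \<tau>p tx in \<open>simp_all add: D_def\<close>)
      also have "t w p (\<tau> p) = \<tau> w"
        using compat[OF w(1) p(1) w(3) p(2)] tle[OF w(3)] by simp
      also have "t w p (t p m x) = t w m x"
        by (rule tt[OF _ x]) (use w in auto)
      also have "t w m x = t w q (t q m x)"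
        by (rule tt[OF _ x, symmetric]) (use w in auto)
      also have "\<dots> = \<tau> w"
        using compat[OF w(1) qP(1) w(2) qP(2)] tle[OF w(2)] xR[OF q] by simp
      finally have w0: "t w p ?e = 0" unfolding diff_self .
      have "t q p ?e = t q w (t w p ?e)"
        by (rule tt[OF _ e, symmetric]) (use w in auto)
      also have "\<dots> = 0"
        unfolding w0 by (rule lin_on_zero[OF t_lin]) (simp add: D_def tensor_zero)
      finally show ?thesis
        using ty[OF qP(1)] qP(2) xR[OF q] by simp
    qed
    ultimately show ?case using y by auto
  qed
  from this[of "{p \<in> P. p < m}"] P show ?thesis
    by (auto simp: D tle)
qed

section \<open>Homotopy colimits of diagrams of inclusions\<close>

lemma topspace_nerve_above:
  "t \<in> topspace (nerve_above P p) \<longleftrightarrow>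
     (\<forall>q. 0 \<le> t q) \<and> (\<forall>q. t q \<noteq> 0 \<longrightarrow> q \<in> P \<and> p \<le> q) \<and> (\<Sum>q\<in>P. t q) = 1 \<and>
     (\<forall>q r. t q \<noteq> 0 \<and> t r \<noteq> 0 \<longrightarrow> q \<le> r \<or> r \<le> q)"
  by (simp add: nerve_above_def)

lemma nerve_above_eq:
  "nerve_above P p = subtopology (powertop_real UNIV) (topspace (nerve_above P p))"
  unfolding nerve_above_def by simp

lemma nerve_above_least_support:
  assumes "finite P" "t \<in> topspace (nerve_above P p)"
  obtains m where "m \<in> P" "p \<le> m" "t m \<noteq> 0" "\<And>q. t q \<noteq> 0 \<Longrightarrow> m \<le> q"
proof -
  have t: "(\<Sum>q\<in>P. t q) = 1" "\<And>q. t q \<noteq> 0 \<Longrightarrow> q \<in> P \<and> p \<le> q"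
    "\<And>q r. t q \<noteq> 0 \<Longrightarrow> t r \<noteq> 0 \<Longrightarrow> q \<le> r \<or> r \<le> q"
    using assms(2) by (auto simp: topspace_nerve_above)
  let ?T = "{q \<in> P. t q \<noteq> 0}"
  have "?T \<noteq> {}"
  proof
    assume "?T = {}"
    then have "(\<Sum>q\<in>P. t q) = 0" by (intro sum.neutral) auto
    then show False using t(1) by simp
  qed
  then obtain m where m: "m \<in> ?T" "\<forall>q\<in>?T. q \<le> m \<longrightarrow> m = q"
    using finite_has_minimal[of ?T] assms(1) by auto
  show thesis
  proof
    show "m \<in> P" "p \<le> m" "t m \<noteq> 0" using m t(2) by auto
    show "m \<le> q" if "t q \<noteq> 0" for q
      using t(2)[OF that] t(3)[OF that, of m] m that by auto
  qed
qed

text \<open>For subspaces of one ambient space the coproduct is a subspace of a product, so continuity of maps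
  into it can be checked on coordinates.\<close>

lemma sum_topology_subtopologies:
  "sum_topology (\<lambda>p. subtopology T (C p)) P =
   subtopology (prod_topology (discrete_topology P) T) (Sigma P C)"
  unfolding topology_eq
proof (intro allI iffI)
  fix U assume "openin (sum_topology (\<lambda>p. subtopology T (C p)) P) U"
  then have U: "U \<subseteq> Sigma P (\<lambda>p. topspace T \<inter> C p)"
    and "\<forall>p\<in>P. \<exists>V. openin T V \<and> {x. (p, x) \<in> U} = V \<inter> C p"
    by (auto simp: openin_sum_topology openin_subtopology)
  then obtain V where V: "\<And>p. p \<in> P \<Longrightarrow> openin T (V p)" "\<And>p. p \<in> P \<Longrightarrow> {x. (p, x) \<in> U} = V p \<inter> C p"
    by metis
  have "openin (prod_topology (discrete_topology P) T) (\<Union>p\<in>P. {p} \<times> V p)"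
    using V(1) by (intro openin_Union) (auto simp: openin_prod_Times_iff)
  moreover have "U = (\<Union>p\<in>P. {p} \<times> V p) \<inter> Sigma P C"
    using U V(2) by blast
  ultimately show "openin (subtopology (prod_topology (discrete_topology P) T) (Sigma P C)) U"
    by (auto simp: openin_subtopology)
next
  fix U assume "openin (subtopology (prod_topology (discrete_topology P) T) (Sigma P C)) U"
  then obtain V where V: "openin (prod_topology (discrete_topology P) T) V" "U = V \<inter> Sigma P C"
    by (auto simp: openin_subtopology)
  have slice: "openin T {x. (p, x) \<in> V}" if "p \<in> P" for p
  proof -
    have "continuous_map T (prod_topology (discrete_topology P) T) (Pair p)"
      using that by (auto simp: continuous_map_pairwise o_def)
    from openin_continuous_map_preimage[OF this V(1)]
    have "openin T {x \<in> topspace T. (p, x) \<in> V}" .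
    moreover have "{x \<in> topspace T. (p, x) \<in> V} = {x. (p, x) \<in> V}"
      using openin_subset[OF V(1)] by auto
    ultimately show ?thesis by simp
  qed
  have "V \<subseteq> P \<times> topspace T" using openin_subset[OF V(1)] by simp
  moreover have "openin (subtopology T (C p)) {x. (p, x) \<in> U}" if "p \<in> P" for p
  proof -
    have "{x. (p, x) \<in> U} = {x. (p, x) \<in> V} \<inter> C p" using V(2) that by auto
    then show ?thesis using slice[OF that] by (auto simp: openin_subtopology)
  qed
  ultimately show "openin (sum_topology (\<lambda>p. subtopology T (C p)) P) U"
    using V(2) by (auto simp: openin_sum_topology)
qed

lemma hocolim_sum_subtopologies:
  "hocolim_sum P (\<lambda>p. subtopology W (B p)) =
   subtopology (prod_topology (discrete_topology P) (prod_topology W (powertop_real UNIV)))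
     (SIGMA p:P. B p \<times> topspace (nerve_above P p))"
proof -
  have "prod_topology (subtopology W (B p)) (nerve_above P p) =
        subtopology (prod_topology W (powertop_real UNIV)) (B p \<times> topspace (nerve_above P p))" for p
    by (subst nerve_above_eq) (simp add: subtopology_Times)
  then show ?thesis
    by (simp add: hocolim_sum_def sum_topology_subtopologies)
qed

lemma quotient_map_quotient_topology:
  "quotient_map X (quotient_topology X E) (\<lambda>x. E `` {x})"
proof -
  have "openin (quotient_topology X E) (topspace X // E)"
    by (auto simp: openin_quotient_topology quotientI intro: back_subst[of "openin X"])
  then have "topspace (quotient_topology X E) = topspace X // E"
    by (metis openin_quotient_topology openin_subset openin_topspace subset_antisym)
  then show ?thesis
    by (auto simp: quotient_map_def openin_quotient_topology quotient_def)
qed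

text \<open>Gluing along inclusions never changes the coordinates \<open>y\<close> and \<open>t\<close>. Conversely, two points with the same
  coordinates are both glued to their copy over the least element of the support of \<open>t\<close>.\<close>

lemma hocolim_inclusions_quotient_map:
  fixes P :: "'p::order set" and F :: "'p \<Rightarrow> 'b topology"
  assumes P: "finite P"
    and Z: "Z homeomorphic_space hocolim P F (\<lambda>p q. id)"
  obtains k where "quotient_map (hocolim_sum P F) Z k"
    "\<And>a b. a \<in> topspace (hocolim_sum P F) \<Longrightarrow> b \<in> topspace (hocolim_sum P F) \<Longrightarrow>
       k a = k b \<longleftrightarrow> snd a = snd b"
proof -
  let ?S = "hocolim_sum P F" and ?G = "hocolim_glue P F (\<lambda>p q. id)"
  define E where "E = (?G \<union> ?G\<inverse>)\<^sup>*"
  have top: "topspace ?S = {(p, y, t). p \<in> P \<and> y \<in> topspace (F p) \<and> t \<in> topspace (nerve_above P p)}"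
    by (auto simp: hocolim_sum_def)
  have symE: "sym E"
    unfolding E_def by (intro sym_rtrancl) (auto simp: sym_def)
  have E_snd: "snd a = snd b" if "(a, b) \<in> E" for a b
    using that unfolding E_def
    by (induct rule: rtrancl_induct) (auto simp: hocolim_glue_def)
  have E_I: "(a, b) \<in> E" if mem: "a \<in> topspace ?S" "b \<in> topspace ?S" and eq: "snd a = snd b" for a b
  proof -
    obtain p q y t where ab: "a = (p, y, t)" "b = (q, y, t)"
      using eq by (cases a, cases b) auto
    then have p: "p \<in> P" "y \<in> topspace (F p)" "t \<in> topspace (nerve_above P p)"
      and q: "q \<in> P" "y \<in> topspace (F q)" "t \<in> topspace (nerve_above P q)"
      using mem by (auto simp: top)
    obtain m where m: "m \<in> P" "p \<le> m" "t m \<noteq> 0" "\<And>q. t q \<noteq> 0 \<Longrightarrow> m \<le> q"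
      using nerve_above_least_support[OF P p(3)] by blast
    have "q \<le> m" using q(3) m(3) by (auto simp: topspace_nerve_above)
    moreover have "t \<in> topspace (nerve_above P m)"
      using p(3) m by (auto simp: topspace_nerve_above)
    ultimately have "((p, y, t), (m, y, t)) \<in> ?G" "((q, y, t), (m, y, t)) \<in> ?G"
      using p q m by (auto simp: hocolim_glue_def)
    then have "(a, (m, y, t)) \<in> E" "(b, (m, y, t)) \<in> E" by (auto simp: E_def ab)
    then show ?thesis
      using symE unfolding E_def by (meson rtrancl_trans symD)
  qed
  have fib: "E `` {a} = E `` {b} \<longleftrightarrow> snd a = snd b" if "a \<in> topspace ?S" "b \<in> topspace ?S" for a b
  proof
    assume "E `` {a} = E `` {b}"
    moreover have "b \<in> E `` {b}" by (simp add: E_def)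
    ultimately show "snd a = snd b" using E_snd by blast
  next
    assume "snd a = snd b"
    then have "(a, b) \<in> E" "(b, a) \<in> E" using E_I that by auto
    then show "E `` {a} = E `` {b}"
      unfolding E_def by (auto intro: rtrancl_trans)
  qed
  have "hocolim P F (\<lambda>p q. id) = quotient_topology ?S E"
    by (simp add: hocolim_def E_def)
  then obtain h where h: "homeomorphic_map (quotient_topology ?S E) Z h"
    using homeomorphic_space_sym[THEN iffD1, OF Z] unfolding homeomorphic_space by auto
  let ?\<pi> = "\<lambda>a. E `` {a}"
  have \<pi>: "quotient_map ?S (quotient_topology ?S E) ?\<pi>"
    by (rule quotient_map_quotient_topology)
  show thesis
  proof
    show "quotient_map ?S Z (h \<circ> ?\<pi>)"
      using quotient_map_compose[OF \<pi>] h unfolding homeomorphic_map_def by blast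
    show "(h \<circ> ?\<pi>) a = (h \<circ> ?\<pi>) b \<longleftrightarrow> snd a = snd b"
      if "a \<in> topspace ?S" "b \<in> topspace ?S" for a b
    proof -
      have "?\<pi> a \<in> topspace (quotient_topology ?S E)" "?\<pi> b \<in> topspace (quotient_topology ?S E)"
        using \<pi> that quotient_imp_surjective_map by blast+
      then have "(h \<circ> ?\<pi>) a = (h \<circ> ?\<pi>) b \<longleftrightarrow> ?\<pi> a = ?\<pi> b"
        using homeomorphic_imp_injective_map[OF h] by (auto simp: inj_on_def)
      then show ?thesis using fib[OF that] by simp
    qed
  qed
qed

text \<open>The homotopy colimit \<open>Z\<close> of the subspaces \<open>B p\<close> of \<open>W\<close> is used only through a quotient map \<open>k\<close> from the
  coproduct, whose fibres are the points with equal coordinates. The topology of \<open>Z\<close> is in general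
  finer than that of a subspace of the product of \<open>W\<close> with the nerve.\<close>

locale inclusion_hocolim =
  fixes P :: "'p::order set" and W :: "'b topology" and B :: "'p \<Rightarrow> 'b set"
    and Z :: "'u topology" and k :: "'p \<times> 'b \<times> ('p \<Rightarrow> real) \<Rightarrow> 'u"
  assumes finite_P: "finite P"
    and B_subset: "p \<in> P \<Longrightarrow> B p \<subseteq> topspace W"
    and B_mono: "p \<in> P \<Longrightarrow> q \<in> P \<Longrightarrow> p \<le> q \<Longrightarrow> B p \<subseteq> B q"
    and quot: "quotient_map (hocolim_sum P (\<lambda>p. subtopology W (B p))) Z k"
    and fibres: "a \<in> topspace (hocolim_sum P (\<lambda>p. subtopology W (B p))) \<Longrightarrow>
        b \<in> topspace (hocolim_sum P (\<lambda>p. subtopology W (B p))) \<Longrightarrow> k a = k b \<longleftrightarrow> snd a = snd b"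
begin

abbreviation "nerve p \<equiv> topspace (nerve_above P p)"
abbreviation "S \<equiv> hocolim_sum P (\<lambda>p. subtopology W (B p))"
abbreviation "ambient \<equiv> prod_topology (discrete_topology P) (prod_topology W (powertop_real UNIV))"

lemma S_eq: "S = subtopology ambient (SIGMA p:P. B p \<times> nerve p)"
  by (rule hocolim_sum_subtopologies)

lemma topspace_S: "(p, y, t) \<in> topspace S \<longleftrightarrow> p \<in> P \<and> y \<in> B p \<and> t \<in> nerve p"
  using B_subset by (auto simp: S_eq)

lemma fibresD: "k a = k b \<Longrightarrow> a \<in> topspace S \<Longrightarrow> b \<in> topspace S \<Longrightarrow> snd a = snd b"
  by (simp add: fibres)

lemma k_eq: "(p, y, t) \<in> topspace S \<Longrightarrow> (q, y, t) \<in> topspace S \<Longrightarrow> k (p, y, t) = k (q, y, t)"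
  by (simp add: fibres)

lemma k_mem: "a \<in> topspace S \<Longrightarrow> k a \<in> topspace Z"
  using quotient_imp_surjective_map[OF quot] by blast

text \<open>The cover: \<open>star p\<close> is the open set of the points whose nerve coordinate meets the down-set of \<open>p\<close>,
  equivalently has its least vertex below \<open>p\<close>.\<close>

definition touches :: "'p \<Rightarrow> ('p \<Rightarrow> real) \<Rightarrow> bool" where
  "touches p t \<longleftrightarrow> (\<exists>r\<in>P. r \<le> p \<and> t r \<noteq> 0)"

definition star_pre :: "'p \<Rightarrow> ('p \<times> 'b \<times> ('p \<Rightarrow> real)) set" where
  "star_pre p = {a \<in> topspace S. touches p (snd (snd a))}"

definition star :: "'p \<Rightarrow> 'u set" where
  "star p = k ` star_pre p"

lemma star_preimage: "{a \<in> topspace S. k a \<in> star p} = star_pre p"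
proof
  show "{a \<in> topspace S. k a \<in> star p} \<subseteq> star_pre p"
  proof
    fix a assume a: "a \<in> {a \<in> topspace S. k a \<in> star p}"
    then obtain b where b: "b \<in> star_pre p" "k a = k b" by (auto simp: star_def)
    then have "snd a = snd b" using a by (intro fibresD) (auto simp: star_pre_def)
    then show "a \<in> star_pre p" using a b by (simp add: star_pre_def)
  qed
qed (auto simp: star_def star_pre_def)

lemma continuous_coordinate: "continuous_map S euclideanreal (\<lambda>a. snd (snd a) r)"
proof -
  have "continuous_map S (powertop_real UNIV) (snd \<circ> snd)"
    unfolding S_eq
    by (intro continuous_map_from_subtopology continuous_map_compose[OF continuous_map_snd continuous_map_snd])
  then show ?thesis by (simp add: continuous_map_componentwise_UNIV)
qed

lemma openin_star: "openin Z (star p)"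
proof -
  have "openin S {a \<in> topspace S. snd (snd a) r \<in> - {0}}" for r
    by (rule openin_continuous_map_preimage[OF continuous_coordinate]) auto
  then have "openin S (\<Union>r\<in>{r\<in>P. r \<le> p}. {a \<in> topspace S. snd (snd a) r \<in> - {0}})"
    by (intro openin_Union) auto
  moreover have "(\<Union>r\<in>{r\<in>P. r \<le> p}. {a \<in> topspace S. snd (snd a) r \<in> - {0}}) = star_pre p"
    by (auto simp: star_pre_def touches_def)
  ultimately have "openin S {a \<in> topspace S. k a \<in> star p}"
    by (simp add: star_preimage)
  moreover have "star p \<subseteq> topspace Z"
    using k_mem by (auto simp: star_def star_pre_def)
  ultimately show ?thesis
    using quot by (simp add: quotient_map_def)
qed

lemma star_subset: "star p \<subseteq> topspace Z"
  using openin_star openin_subset by blast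

lemma star_mono: "p \<le> q \<Longrightarrow> star p \<subseteq> star q"
  by (auto simp: star_def star_pre_def touches_def intro!: image_mono) (meson order_trans)

lemma star_Int: "star p \<inter> star q \<subseteq> (\<Union>r\<in>{r\<in>P. r \<le> p \<and> r \<le> q}. star r)"
proof
  fix z assume "z \<in> star p \<inter> star q"
  then obtain a b where a: "a \<in> star_pre p" "k a = z" and b: "b \<in> star_pre q" "k b = z"
    by (auto simp: star_def)
  then have "snd a = snd b" by (intro fibresD) (simp_all add: star_pre_def)
  then obtain r1 r2 where r: "r1 \<in> P" "r1 \<le> p" "snd (snd a) r1 \<noteq> 0"
      "r2 \<in> P" "r2 \<le> q" "snd (snd a) r2 \<noteq> 0"
    using a b by (auto simp: star_pre_def touches_def)
  obtain c y t where "a = (c, y, t)" by (cases a)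
  with a(1) have "r1 \<le> r2 \<or> r2 \<le> r1"
    using r by (auto simp: star_pre_def topspace_S topspace_nerve_above)
  then obtain r where "r \<in> P" "r \<le> p" "r \<le> q" "snd (snd a) r \<noteq> 0"
    using r by (meson order_trans)
  then show "z \<in> (\<Union>r\<in>{r\<in>P. r \<le> p \<and> r \<le> q}. star r)"
    using a by (auto simp: star_def star_pre_def touches_def)
qed

lemma star_cover: "(\<Union>p\<in>P. star p) = topspace Z"
proof
  show "topspace Z \<subseteq> (\<Union>p\<in>P. star p)"
  proof
    fix z assume "z \<in> topspace Z"
    then have "z \<in> k ` topspace S" using quotient_imp_surjective_map[OF quot] by simp
    then obtain p y t where a: "(p, y, t) \<in> topspace S" "k (p, y, t) = z"
      by auto
    then have t: "t \<in> nerve p" by (simp add: topspace_S)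
    obtain m where m: "m \<in> P" "t m \<noteq> 0"
      using nerve_above_least_support[OF finite_P t] by blast
    then have "(p, y, t) \<in> star_pre m"
      using a by (auto simp: star_pre_def touches_def)
    then show "z \<in> (\<Union>p\<in>P. star p)"
      using a(2) m(1) by (auto simp: star_def)
  qed
qed (use star_subset in auto)

lemma quot_star: "quotient_map (subtopology S (star_pre p)) (subtopology Z (star p)) k"
  by (rule quotient_map_restriction[OF quot star_preimage]) (simp add: openin_star)

lemma topspace_star_pre: "topspace (subtopology S (star_pre p)) = star_pre p"
  by (auto simp: star_pre_def)

text \<open>The action on \<open>Z\<close> of a map of the nerve coordinate. The chosen preimage does not matter when \<open>g\<close>
  preserves each \<open>nerve q\<close> that contains the coordinate (\<open>act_k\<close>).\<close>

definition act :: "(('p \<Rightarrow> real) \<Rightarrow> 'p \<Rightarrow> real) \<Rightarrow> 'u \<Rightarrow> 'u" where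
  "act g z = k (map_prod id (map_prod id g) (inv_into (topspace S) k z))"

lemma act_k:
  assumes a: "(q, y, t) \<in> topspace S" and g: "\<And>q. q \<in> P \<Longrightarrow> t \<in> nerve q \<Longrightarrow> g t \<in> nerve q"
  shows "act g (k (q, y, t)) = k (q, y, g t)"
proof -
  let ?b = "inv_into (topspace S) k (k (q, y, t))"
  have b: "?b \<in> topspace S" "k ?b = k (q, y, t)"
    using a by (auto intro: inv_into_into f_inv_into_f)
  then have "snd ?b = (y, t)" using fibres[OF b(1) a] by simp
  then obtain q' where q': "?b = (q', y, t)" by (metis prod.collapse)
  then have "(q', y, t) \<in> topspace S" using b by simp
  then show ?thesis
    unfolding act_def q' using a g by (auto simp: topspace_S intro: k_eq)
qed

definition touching :: "'p \<Rightarrow> ('p \<Rightarrow> real) set" where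
  "touching p = {t. touches p t \<and> (\<exists>q\<in>P. t \<in> nerve q)}"

text \<open>A straight-line homotopy in the nerve coordinate descends to the quotient, because the product of a
  quotient map with the identity of the locally compact unit interval is a quotient map.\<close>

lemma homotopic_act:
  assumes cont: "\<And>r. continuous_map (subtopology (powertop_real UNIV) (touching p)) euclideanreal (\<lambda>t. g t r)"
      "\<And>r. continuous_map (subtopology (powertop_real UNIV) (touching p)) euclideanreal (\<lambda>t. g' t r)"
    and mix: "\<And>q t s. q \<in> P \<Longrightarrow> t \<in> nerve q \<Longrightarrow> touches p t \<Longrightarrow> 0 \<le> s \<Longrightarrow> s \<le> 1 \<Longrightarrow>
      (\<lambda>r. (1 - s) * g t r + s * g' t r) \<in> nerve q \<and> touches p (\<lambda>r. (1 - s) * g t r + s * g' t r)"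
    and f: "\<And>q y t. (q, y, t) \<in> topspace S \<Longrightarrow> touches p t \<Longrightarrow> f0 (k (q, y, t)) = k (q, y, g t)"
      "\<And>q y t. (q, y, t) \<in> topspace S \<Longrightarrow> touches p t \<Longrightarrow> f1 (k (q, y, t)) = k (q, y, g' t)"
  shows "homotopic_with (\<lambda>_. True) (subtopology Z (star p)) (subtopology Z (star p)) f0 f1"
proof -
  let ?I = "top_of_set {0..1::real}" and ?Sp = "subtopology S (star_pre p)" and ?Zp = "subtopology Z (star p)"
  define G where "G = (\<lambda>(s::real, q::'p, y::'b, t). (q, y, \<lambda>r. (1 - s) * g t r + s * g' t r))"
  have Gmem: "G (s, a) \<in> star_pre p" if "s \<in> {0..1}" "a \<in> star_pre p" for s a
    using that mix by (cases a) (auto simp: G_def star_pre_def topspace_S)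
  have snd_touching: "continuous_map ?Sp (subtopology (powertop_real UNIV) (touching p)) (snd \<circ> snd)"
  proof (rule continuous_map_into_subtopology)
    show "continuous_map ?Sp (powertop_real UNIV) (snd \<circ> snd)"
      unfolding S_eq
      by (intro continuous_map_from_subtopology continuous_map_compose[OF continuous_map_snd continuous_map_snd])
    show "snd \<circ> snd \<in> topspace ?Sp \<rightarrow> touching p"
      unfolding topspace_star_pre by (auto simp: star_pre_def touching_def topspace_S)
  qed
  have coord: "continuous_map (prod_topology ?I ?Sp) euclideanreal (\<lambda>x. f (snd (snd (snd x))) r)"
    if "\<And>r. continuous_map (subtopology (powertop_real UNIV) (touching p)) euclideanreal (\<lambda>t. f t r)" for f r
  proof -
    have "continuous_map (prod_topology ?I ?Sp) euclideanreal ((\<lambda>t. f t r) \<circ> ((snd \<circ> snd) \<circ> snd))"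
      by (intro continuous_map_compose[OF continuous_map_compose[OF continuous_map_snd snd_touching] that])
    then show ?thesis by (simp add: o_def)
  qed
  have par: "continuous_map (prod_topology ?I ?Sp) euclideanreal fst"
    using continuous_map_fst continuous_map_into_fulltopology by blast
  have amb: "continuous_map (prod_topology ?I ?Sp) ambient snd"
    unfolding S_eq subtopology_subtopology
    using continuous_map_into_fulltopology[OF continuous_map_snd] by blast
  have "continuous_map (prod_topology ?I ?Sp) ambient G"
  proof -
    have G: "G = (\<lambda>x. (fst (snd x), fst (snd (snd x)),
              \<lambda>r. (1 - fst x) * g (snd (snd (snd x))) r + fst x * g' (snd (snd (snd x))) r))"
      by (auto simp: G_def fun_eq_iff split_beta)
    have 1: "continuous_map (prod_topology ?I ?Sp) (discrete_topology P) (\<lambda>x. fst (snd x))"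
      using continuous_map_compose[OF amb continuous_map_fst] by (simp add: o_def)
    have 2: "continuous_map (prod_topology ?I ?Sp) W (\<lambda>x. fst (snd (snd x)))"
      using continuous_map_compose[OF amb continuous_map_compose[OF continuous_map_snd continuous_map_fst]]
      by (simp add: o_def)
    have 3: "continuous_map (prod_topology ?I ?Sp) (powertop_real UNIV)
        (\<lambda>x r. (1 - fst x) * g (snd (snd (snd x))) r + fst x * g' (snd (snd (snd x))) r)"
      unfolding continuous_map_componentwise_UNIV
      by (intro allI continuous_map_add continuous_map_real_mult continuous_map_diff par coord cont) simp_all
    show ?thesis
      unfolding G by (intro continuous_map_pairedI 1 2 3)
  qed
  then have contG: "continuous_map (prod_topology ?I ?Sp) ?Sp G"
  proof -
    assume *: "continuous_map (prod_topology ?I ?Sp) ambient G"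
    have "G \<in> topspace (prod_topology ?I ?Sp) \<rightarrow> star_pre p"
      using Gmem by (auto simp: topspace_star_pre)
    moreover have "star_pre p \<subseteq> (SIGMA p:P. B p \<times> nerve p)"
      by (auto simp: star_pre_def topspace_S)
    ultimately have "continuous_map (prod_topology ?I ?Sp)
        (subtopology ambient ((SIGMA p:P. B p \<times> nerve p) \<inter> star_pre p)) G"
      by (intro continuous_map_into_subtopology[OF *]) auto
    then show ?thesis by (simp only: S_eq subtopology_subtopology)
  qed
  have kS: "continuous_map ?Sp ?Zp k"
    using quot_star quotient_imp_continuous_map by blast
  let ?q = "\<lambda>(s::real, a). (s, k a)"
  have q: "quotient_map (prod_topology ?I ?Sp) (prod_topology ?I ?Zp) ?q"
  proof (rule quotient_map_prod_right[OF _ _ quot_star])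
    show "locally_compact_space ?I"
      by (intro compact_imp_locally_compact_space) (simp add: compact_space_subtopology)
    show "Hausdorff_space ?I \<or> regular_space ?I"
      by (simp add: Hausdorff_space_subtopology)
  qed
  obtain h where h: "continuous_map (prod_topology ?I ?Zp) ?Zp h"
    "\<And>x. x \<in> topspace (prod_topology ?I ?Sp) \<Longrightarrow> h (?q x) = (k \<circ> G) x"
  proof (rule quotient_map_lift_exists[OF q continuous_map_compose[OF contG kS]])
    fix x x' assume x: "x \<in> topspace (prod_topology ?I ?Sp)" "x' \<in> topspace (prod_topology ?I ?Sp)" "?q x = ?q x'"
    obtain s a s' a' where s: "x = (s, a)" "x' = (s', a')" by (metis prod.collapse)
    then have a: "a \<in> star_pre p" "a' \<in> star_pre p" "s \<in> {0..1}" "s' = s" "k a = k a'"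
      using x unfolding topspace_prod_topology topspace_star_pre by auto
    then have "snd a = snd a'" by (intro fibresD) (simp_all add: star_pre_def)
    then have "snd (G x) = snd (G x')" using s a by (auto simp: G_def split_beta)
    moreover have "G x \<in> topspace S" "G x' \<in> topspace S"
      using Gmem a s by (auto simp: star_pre_def)
    ultimately show "(k \<circ> G) x = (k \<circ> G) x'"
      using fibres by simp
  qed auto
  have hk: "h (s, k a) = k (G (s, a))" if "s \<in> {0..1}" "a \<in> star_pre p" for s a
    using h(2)[of "(s, a)"] that by (simp add: star_pre_def)
  show ?thesis
  proof (subst homotopic_with, simp, intro exI[of _ h] conjI ballI)
    show "continuous_map (prod_topology ?I ?Zp) ?Zp h" by (fact h)
  next
    fix z assume "z \<in> topspace ?Zp"
    then obtain q y t where a: "(q, y, t) \<in> star_pre p" "z = k (q, y, t)"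
      by (auto simp: star_def)
    then have "(q, y, t) \<in> topspace S" "touches p t" by (auto simp: star_pre_def)
    then show "h (0, z) = f0 z" "h (1, z) = f1 z"
      using hk[OF _ a(1)] f a(2) by (simp_all add: G_def)
  qed auto
qed

definition vertex :: "'p \<Rightarrow> 'p \<Rightarrow> real" where
  "vertex p r = (if r = p then 1 else 0)"

definition truncate :: "'p \<Rightarrow> ('p \<Rightarrow> real) \<Rightarrow> 'p \<Rightarrow> real" where
  "truncate p t r = (if r \<in> P \<and> r \<le> p then t r / (\<Sum>r\<in>{r \<in> P. r \<le> p}. t r) else 0)"

lemma vertex_nerve: "p \<in> P \<Longrightarrow> q \<le> p \<Longrightarrow> vertex p \<in> nerve q"
  using finite_P by (auto simp: topspace_nerve_above vertex_def)

lemma truncation_mass: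
  assumes "t \<in> nerve q" "touches p t"
  shows "(\<Sum>r\<in>{r \<in> P. r \<le> p}. t r) > 0"
proof -
  obtain r where r: "r \<in> P" "r \<le> p" "t r \<noteq> 0" using assms(2) by (auto simp: touches_def)
  have nn: "0 \<le> t r" for r using assms(1) by (simp add: topspace_nerve_above)
  then have "t r > 0" using r(3) by (simp add: order_less_le)
  then show ?thesis
    using r finite_P nn by (intro sum_pos2[of _ r]) auto
qed

lemma sum_truncate:
  assumes "t \<in> nerve q" "touches p t"
  shows "(\<Sum>r\<in>P. truncate p t r) = 1"
proof -
  have "(\<Sum>r\<in>P. truncate p t r) = (\<Sum>r\<in>{r \<in> P. r \<le> p}. t r / (\<Sum>r\<in>{r \<in> P. r \<le> p}. t r))"
    using finite_P by (subst sum.inter_filter) (auto simp: truncate_def intro: sum.cong)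
  also have "\<dots> = 1"
    using truncation_mass[OF assms] by (simp flip: sum_divide_distrib)
  finally show ?thesis .
qed

lemma truncate_nonneg: "t \<in> nerve q \<Longrightarrow> 0 \<le> truncate p t r"
  by (auto simp: truncate_def topspace_nerve_above intro!: divide_nonneg_nonneg sum_nonneg)

lemma mix_truncate:
  assumes t: "q \<in> P" "t \<in> nerve q" "touches p t" and s: "0 \<le> s" "s \<le> 1"
  shows "(\<lambda>r. (1 - s) * t r + s * truncate p t r) \<in> nerve q \<and>
         touches p (\<lambda>r. (1 - s) * t r + s * truncate p t r)"
proof -
  let ?u = "\<lambda>r. (1 - s) * t r + s * truncate p t r"
  have nn: "0 \<le> t r" "0 \<le> truncate p t r" for r
    using t(2) truncate_nonneg by (auto simp: topspace_nerve_above)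
  have supp: "t r \<noteq> 0" if "?u r \<noteq> 0" for r
    using that by (auto simp: truncate_def split: if_splits)
  have "(\<Sum>r\<in>P. ?u r) = 1"
    using sum_truncate[OF t(2,3)] t(2)
    by (simp add: sum.distrib topspace_nerve_above flip: sum_distrib_left)
  moreover have "0 \<le> ?u r" for r using nn s by simp
  ultimately have nerve: "?u \<in> nerve q"
    using t(2) supp unfolding topspace_nerve_above by blast
  obtain r where r: "r \<in> P" "r \<le> p" "t r \<noteq> 0" using t(3) by (auto simp: touches_def)
  have "truncate p t r > 0"
    using r truncation_mass[OF t(2,3)] nn(1)[of r] by (simp add: truncate_def order_less_le)
  moreover have "t r > 0" using nn(1)[of r] r(3) by simp
  ultimately have "?u r \<noteq> 0"
    using s by (smt (verit) mult_nonneg_nonneg mult_pos_pos)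
  then have "touches p ?u" using r by (auto simp: touches_def)
  with nerve show ?thesis by blast
qed

lemma mix_truncate_vertex:
  assumes t: "q \<in> P" "t \<in> nerve q" "touches p t" and s: "0 \<le> s" "s \<le> 1" and p: "p \<in> P"
  shows "(\<lambda>r. (1 - s) * truncate p t r + s * vertex p r) \<in> nerve q \<and>
         touches p (\<lambda>r. (1 - s) * truncate p t r + s * vertex p r)"
proof -
  let ?u = "\<lambda>r. (1 - s) * truncate p t r + s * vertex p r"
  have nn: "0 \<le> truncate p t r" "0 \<le> vertex p r" for r
    using truncate_nonneg[OF t(2)] by (auto simp: vertex_def)
  have qp: "q \<le> p"
    using t(2,3) by (auto simp: topspace_nerve_above touches_def intro: order_trans)
  have supp: "r = p \<or> t r \<noteq> 0 \<and> r \<in> P \<and> r \<le> p" if "?u r \<noteq> 0" for r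
    using that by (auto simp: truncate_def vertex_def split: if_splits)
  have "(\<Sum>r\<in>P. vertex p r) = 1" using finite_P p by (simp add: vertex_def)
  then have sum: "(\<Sum>r\<in>P. ?u r) = 1"
    using sum_truncate[OF t(2,3)] by (simp add: sum.distrib flip: sum_distrib_left)
  have "?u \<in> nerve q"
    unfolding topspace_nerve_above
  proof (intro conjI allI impI)
    show "0 \<le> ?u r" for r using nn s by simp
    show "(\<Sum>r\<in>P. ?u r) = 1" by (rule sum)
    show "r \<in> P" "q \<le> r" if "?u r \<noteq> 0" for r
      using supp[OF that] p qp t(2) by (auto simp: topspace_nerve_above)
    show "r \<le> r' \<or> r' \<le> r" if "?u r \<noteq> 0 \<and> ?u r' \<noteq> 0" for r r'
      using supp[of r] supp[of r'] that t(2) by (auto simp: topspace_nerve_above)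
  qed
  moreover have "\<exists>r\<in>P. ?u r \<noteq> 0"
    using sum by (metis (no_types, lifting) sum.neutral zero_neq_one)
  then have "touches p ?u"
    using supp by (auto simp: touches_def)
  ultimately show ?thesis by blast
qed

lemma truncate_nerve: "q \<in> P \<Longrightarrow> t \<in> nerve q \<Longrightarrow> touches p t \<Longrightarrow> truncate p t \<in> nerve q"
  using mix_truncate[of q t p 1] by simp

definition incl :: "'p \<Rightarrow> 'b \<Rightarrow> 'u" where
  "incl p y = k (p, y, vertex p)"

definition proj :: "'u \<Rightarrow> 'b" where
  "proj z = fst (snd (inv_into (topspace S) k z))"

lemma proj_k: "(q, y, t) \<in> topspace S \<Longrightarrow> proj (k (q, y, t)) = y"
proof -
  assume a: "(q, y, t) \<in> topspace S"
  let ?b = "inv_into (topspace S) k (k (q, y, t))"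
  have b: "?b \<in> topspace S" "k ?b = k (q, y, t)"
    using a by (auto intro: inv_into_into f_inv_into_f)
  then show ?thesis using fibres[OF b(1) a] by (simp add: proj_def)
qed

lemma star_pre_B: "(q, y, t) \<in> star_pre p \<Longrightarrow> p \<in> P \<Longrightarrow> y \<in> B p \<and> q \<le> p"
proof -
  assume a: "(q, y, t) \<in> star_pre p" and p: "p \<in> P"
  then have "q \<in> P" "y \<in> B q" "q \<le> p"
    by (auto simp: star_pre_def topspace_S touches_def topspace_nerve_above intro: order_trans)
  then show "y \<in> B p \<and> q \<le> p" using B_mono[of q p] p by auto
qed

lemma vertex_star_pre: "p \<in> P \<Longrightarrow> y \<in> B p \<Longrightarrow> (p, y, vertex p) \<in> star_pre p"
  by (auto simp: star_pre_def topspace_S vertex_nerve touches_def) (auto simp: vertex_def)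

lemma continuous_k_Pair:
  assumes "p \<in> P" "continuous_map T W f" "continuous_map T (powertop_real UNIV) g"
    "\<And>x. x \<in> topspace T \<Longrightarrow> (p, f x, g x) \<in> star_pre q"
  shows "continuous_map T (subtopology Z (star q)) (\<lambda>x. k (p, f x, g x))"
proof -
  have "continuous_map T ambient (\<lambda>x. (p, f x, g x))"
    using assms by (intro continuous_map_pairedI) auto
  then have "continuous_map T (subtopology S (star_pre q)) (\<lambda>x. (p, f x, g x))"
    unfolding S_eq subtopology_subtopology
    using assms(4) by (intro continuous_map_into_subtopology) (auto simp: star_pre_def topspace_S)
  from continuous_map_compose[OF this quotient_imp_continuous_map[OF quot_star]]
  show ?thesis by (simp add: o_def)
qed

lemma continuous_incl:
  assumes "p \<in> P"
  shows "continuous_map (subtopology W (B p)) (subtopology Z (star p)) (incl p)"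
  unfolding incl_def
  by (rule continuous_k_Pair[OF assms])
    (use vertex_star_pre[OF assms] in \<open>auto intro: continuous_map_from_subtopology\<close>)

lemma continuous_proj:
  assumes "p \<in> P"
  shows "continuous_map (subtopology Z (star p)) (subtopology W (B p)) proj"
proof (rule continuous_compose_quotient_map[OF quot_star])
  have "continuous_map ambient W (fst \<circ> snd)"
    by (rule continuous_map_compose[OF continuous_map_snd continuous_map_fst])
  then have "continuous_map (subtopology S (star_pre p)) W (fst \<circ> snd)"
    unfolding S_eq by (intro continuous_map_from_subtopology)
  then have "continuous_map (subtopology S (star_pre p)) (subtopology W (B p)) (fst \<circ> snd)"
    by (rule continuous_map_into_subtopology)
      (use star_pre_B[OF _ assms] in \<open>auto simp: topspace_star_pre simp del: topspace_subtopology\<close>)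
  then show "continuous_map (subtopology S (star_pre p)) (subtopology W (B p)) (proj \<circ> k)"
    by (rule continuous_map_eq) (auto simp: proj_k)
qed

lemma proj_incl: "p \<in> P \<Longrightarrow> y \<in> B p \<Longrightarrow> proj (incl p y) = y"
  unfolding incl_def by (rule proj_k) (simp add: topspace_S vertex_nerve)

text \<open>The segment from \<open>t\<close> to the vertex \<open>p\<close> may leave the nerve, since the support of \<open>t\<close> can contain elements
  not comparable with \<open>p\<close>. Truncation to the elements \<open>\<le> p\<close> removes them first; both segments
  stay in the nerve of a chain and over the same \<open>q\<close>.\<close>

lemma incl_proj_homotopic:
  assumes p: "p \<in> P"
  shows "homotopic_with (\<lambda>_. True) (subtopology Z (star p)) (subtopology Z (star p)) id (incl p \<circ> proj)"
proof (rule homotopic_with_trans)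
  let ?T = "subtopology (powertop_real UNIV) (touching p)"
  have coord: "continuous_map ?T euclideanreal (\<lambda>t. t r)" for r
    by (intro continuous_map_from_subtopology continuous_map_product_projection) simp
  have trunc: "continuous_map ?T euclideanreal (\<lambda>t. truncate p t r)" for r
  proof (cases "r \<in> P \<and> r \<le> p")
    case True
    have "(\<Sum>r\<in>{r \<in> P. r \<le> p}. t r) \<noteq> 0" if "t \<in> touching p" for t
      using truncation_mass that by (fastforce simp: touching_def)
    then show ?thesis
      using True finite_P
      by (simp add: truncate_def) (intro continuous_map_real_divide continuous_map_sum coord, auto)
  next
    case False
    then have "(\<lambda>t. truncate p t r) = (\<lambda>t. 0)" by (auto simp: truncate_def)
    then show ?thesis by simp
  qed
  have act_truncate: "act (truncate p) (k (q, y, t)) = k (q, y, truncate p t)"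
    if "(q, y, t) \<in> topspace S" "touches p t" for q y t
    by (rule act_k[OF that(1)]) (simp add: truncate_nerve that(2))
  show "homotopic_with (\<lambda>_. True) (subtopology Z (star p)) (subtopology Z (star p)) id (act (truncate p))"
    by (rule homotopic_act[where g = "\<lambda>t. t" and g' = "truncate p"])
      (use coord trunc mix_truncate act_truncate in auto)
  show "homotopic_with (\<lambda>_. True) (subtopology Z (star p)) (subtopology Z (star p))
          (act (truncate p)) (incl p \<circ> proj)"
  proof (rule homotopic_act[where g = "truncate p" and g' = "\<lambda>t. vertex p"])
    fix q y t assume a: "(q, y, t) \<in> topspace S" "touches p t"
    then have "(q, y, t) \<in> star_pre p" by (simp add: star_pre_def)
    then have "y \<in> B p" "q \<le> p" "q \<in> P" "y \<in> B q"
      using star_pre_B[OF _ p] a by (auto simp: topspace_S)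
    then have "k (p, y, vertex p) = k (q, y, vertex p)"
      by (intro k_eq) (auto simp: topspace_S p vertex_nerve)
    then show "(incl p \<circ> proj) (k (q, y, t)) = k (q, y, vertex p)"
      using proj_k[OF a(1)] by (simp add: incl_def)
  qed (use trunc act_truncate mix_truncate_vertex p in auto)
qed

text \<open>The inclusions into \<open>Z\<close> do not commute with those of the diagram on the nose, only up to the homotopy
  along the edge from \<open>p\<close> to \<open>q\<close>.\<close>

lemma incl_homotopic:
  assumes p: "p \<in> P" and q: "q \<in> P" and pq: "p \<le> q"
  shows "homotopic_with (\<lambda>_. True) (subtopology W (B p)) (subtopology Z (star q)) (incl p) (incl q)"
proof (subst homotopic_with, simp, intro exI conjI ballI)
  let ?I = "top_of_set {0..1::real}" and ?W = "subtopology W (B p)"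
  let ?g = "\<lambda>x r. (1 - fst x) * vertex p r + fst x * vertex q r"
  let ?h = "\<lambda>x. k (p, snd x, ?g x)"
  show "continuous_map (prod_topology ?I ?W) (subtopology Z (star q)) ?h"
  proof (rule continuous_k_Pair[OF p])
    show "continuous_map (prod_topology ?I ?W) W snd"
      using continuous_map_into_fulltopology[OF continuous_map_snd] by blast
    have "continuous_map (prod_topology ?I ?W) euclideanreal fst"
      using continuous_map_into_fulltopology[OF continuous_map_fst] by blast
    then show "continuous_map (prod_topology ?I ?W) (powertop_real UNIV) ?g"
      unfolding continuous_map_componentwise_UNIV
      by (intro allI continuous_map_add continuous_map_real_mult continuous_map_diff) simp_all
  next
    fix x assume x: "x \<in> topspace (prod_topology ?I ?W)"
    then have s: "0 \<le> fst x" "fst x \<le> 1" and y: "snd x \<in> B p" by (auto simp: mem_Times_iff)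
    have supp: "r = p \<or> r = q" if "?g x r \<noteq> 0" for r
      using that by (auto simp: vertex_def split: if_splits)
    have "(\<Sum>r\<in>P. vertex p r) = 1" "(\<Sum>r\<in>P. vertex q r) = 1"
      using finite_P p q by (simp_all add: vertex_def)
    then have sum: "(\<Sum>r\<in>P. ?g x r) = 1"
      by (simp add: sum.distrib flip: sum_distrib_left)
    have nn: "0 \<le> ?g x r" for r using s by (simp add: vertex_def)
    have "?g x \<in> nerve p"
      unfolding topspace_nerve_above using supp sum p q pq nn by blast
    moreover have "\<exists>r\<in>P. ?g x r \<noteq> 0"
      using sum by (metis (no_types, lifting) sum.neutral zero_neq_one)
    then have "touches q (?g x)" using supp p q pq unfolding touches_def by blast
    ultimately show "(p, snd x, ?g x) \<in> star_pre q"
      using p y by (simp add: star_pre_def topspace_S)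
  qed
next
  let ?g = "\<lambda>x r. (1 - fst x) * vertex p r + fst x * vertex q r"
  fix y assume "y \<in> topspace (subtopology W (B p))"
  then have y: "y \<in> B p" "y \<in> B q" using B_mono[OF p q pq] by auto
  show "k (p, snd (0, y), ?g (0, y)) = incl p y" by (simp add: incl_def)
  have "k (p, y, vertex q) = k (q, y, vertex q)"
    by (rule k_eq) (simp_all add: topspace_S p q y vertex_nerve pq)
  then show "k (p, snd (1, y), ?g (1, y)) = incl q y" by (simp add: incl_def)
qed auto

end

section \<open>Mayer--Vietoris and ordered open covers\<close>

context cohomology_theory
begin

abbreviation "restr n X A B \<equiv> ind n (subtopology X A) {} (subtopology X B) {} id"

lemma zero_mem: "A \<subseteq> topspace X \<Longrightarrow> 0 \<in> H n X A"
  using subspace_H subspace_0 by blast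

lemma ind_mem: "pair_map X A Y B f \<Longrightarrow> z \<in> H n Y B \<Longrightarrow> ind n X A Y B f z \<in> H n X A"
  using lin_ind unfolding lin_on_def by blast

lemma ind_add: "pair_map X A Y B f \<Longrightarrow> z \<in> H n Y B \<Longrightarrow> w \<in> H n Y B \<Longrightarrow>
    ind n X A Y B f (z + w) = ind n X A Y B f z + ind n X A Y B f w"
  using lin_ind unfolding lin_on_def by blast

lemma ind_zero: "pair_map X A Y B f \<Longrightarrow> ind n X A Y B f 0 = 0"
  using ind_add[of X A Y B f 0 n 0] zero_mem by (simp add: pair_map_def)

lemma ind_diff:
  assumes "pair_map X A Y B f" "z \<in> H n Y B" "w \<in> H n Y B"
  shows "ind n X A Y B f (z - w) = ind n X A Y B f z - ind n X A Y B f w"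
proof -
  have "z - w \<in> H n Y B"
    using assms subspace_H by (simp add: pair_map_def subspace_diff)
  from ind_add[OF assms(1) this assms(3)] show ?thesis by simp
qed

lemma pair_map_absolute: "pair_map X {} Y {} f \<longleftrightarrow> continuous_map X Y f"
  by (simp add: pair_map_def)

lemma pair_map_restr: "A \<subseteq> B \<Longrightarrow> pair_map (subtopology X A) {} (subtopology X B) {} id"
  by (auto simp: pair_map_absolute continuous_map_in_subtopology continuous_map_from_subtopology)

lemma restr_mem: "A \<subseteq> B \<Longrightarrow> x \<in> H n (subtopology X B) {} \<Longrightarrow> restr n X A B x \<in> H n (subtopology X A) {}"
  using ind_mem pair_map_restr by blast

lemma restr_comp:
  assumes "A \<subseteq> B" "B \<subseteq> C" "x \<in> H n (subtopology X C) {}"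
  shows "restr n X A B (restr n X B C x) = restr n X A C x"
  using ind_comp[OF pair_map_restr[OF assms(1)] pair_map_restr[OF assms(2)] assms(3)] by simp

lemma H_empty_space: "topspace X = {} \<Longrightarrow> H n X {} = {0}"
proof -
  assume "topspace X = {}"
  then have "subtopology X {} = X" by (metis subtopology_topspace)
  then have "{z \<in> H n X {}. z = 0} = H n X {}"
    using exact_space[of "{}" X n] ind_id[of "{}" X _ n] by (force simp: image_iff)
  then show ?thesis using zero_mem[of "{}" X n] by auto
qed

text \<open>Excision identifies the relative groups of \<open>(X, V)\<close> and \<open>(U, U \<inter> V)\<close>. When restriction from \<open>U\<close> to
  \<open>U \<inter> V\<close> is onto, the long exact sequence of \<open>(U, U \<inter> V)\<close> splits into short exact ones, and a diagram
  chase shows that \<open>h(X)\<close> is the pullback of \<open>h(U)\<close> and \<open>h(V)\<close>.\<close>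

lemma mayer_vietoris_pullback:
  assumes U: "openin X U" and V: "openin X V" and UV: "U \<union> V = topspace X"
    and surj: "\<And>n w. w \<in> H n (subtopology X (U \<inter> V)) {} \<Longrightarrow>
                 \<exists>u\<in>H n (subtopology X U) {}. restr n X (U \<inter> V) U u = w"
    and u: "u \<in> H n (subtopology X U) {}" and v: "v \<in> H n (subtopology X V) {}"
    and uv: "restr n X (U \<inter> V) U u = restr n X (U \<inter> V) V v"
  shows "\<exists>!x. x \<in> H n X {} \<and> ind n (subtopology X U) {} X {} id x = u \<and>
                ind n (subtopology X V) {} X {} id x = v"
proof -
  let ?W = "U \<inter> V" and ?XU = "subtopology X U"
  have sub: "U \<subseteq> topspace X" "V \<subseteq> topspace X" "?W \<subseteq> topspace ?XU"
    using openin_subset U V by auto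
  have XW: "subtopology ?XU ?W = subtopology X ?W"
    by (simp add: subtopology_subtopology inf.absorb2)
  have pm: "pair_map ?XU ?W X V id" "pair_map ?XU {} X {} id" "pair_map ?XU {} ?XU ?W id"
      "pair_map X {} X V id" "pair_map (subtopology X V) {} X {} id"
    using sub by (auto simp: pair_map_def continuous_map_from_subtopology)
  let ?e = "\<lambda>n. ind n ?XU ?W X V id" and ?j = "\<lambda>n. ind n X {} X V id" and ?j' = "\<lambda>n. ind n ?XU {} ?XU ?W id"
  have exc: "bij_betw (?e n) (H n X V) (H n ?XU ?W)" for n
  proof -
    have "X closure_of (topspace X - U) = topspace X - U"
      using U by (simp add: closure_of_eq closedin_diff)
    moreover have "X interior_of V = V" using V by (simp add: interior_of_openin)
    moreover have "topspace X - U \<subseteq> V" using UV by blast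
    ultimately have "bij_betw (ind n (subtopology X (topspace X - (topspace X - U))) (V - (topspace X - U)) X V id)
      (H n X V) (H n (subtopology X (topspace X - (topspace X - U))) (V - (topspace X - U)))"
      using excision[OF sub(2), of "topspace X - U" n] by simp
    moreover have "topspace X - (topspace X - U) = U" "V - (topspace X - U) = ?W"
      using sub by auto
    ultimately show ?thesis by simp
  qed
  have jj: "ind n ?XU {} X {} id (?j n z) = ?j' n (?e n z)" if "z \<in> H n X V" for n z
    using ind_comp[OF pm(2,4) that] ind_comp[OF pm(3,1) that] by simp
  \<comment> \<open>surjectivity of the restriction to \<open>U \<inter> V\<close> makes the connecting map of the pair vanish\<close>
  have bd0: "bd n ?XU ?W w = 0" if w: "w \<in> H n (subtopology X ?W) {}" for n w
  proof -
    obtain u where "u \<in> H n ?XU {}" "restr n X ?W U u = w" using surj[OF w] by blast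
    then have "w \<in> ind n (subtopology ?XU ?W) {} ?XU {} id ` H n ?XU {}" by (auto simp: XW)
    then show ?thesis using exact_subspace[OF sub(3), of n] by auto
  qed
  have j'0: "z = 0" if z: "z \<in> H n ?XU ?W" "?j' n z = 0" for n z
  proof -
    have "z \<in> bd (n - 1) ?XU ?W ` H (n - 1) (subtopology ?XU ?W) {}"
      using exact_pair[OF sub(3), of "n - 1"] z by simp
    then show ?thesis using bd0 by (auto simp: XW)
  qed
  have e0: "?e n 0 = 0" for n by (rule ind_zero[OF pm(1)])
  have e_inj: "z = 0" if z: "z \<in> H n X V" "?e n z = 0" for n z
    using exc[of n] z e0[of n] zero_mem[OF sub(2), of n] unfolding bij_betw_def inj_on_def by metis
  have unique: "d = 0" if d: "d \<in> H n X {}" "ind n ?XU {} X {} id d = 0"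
      "ind n (subtopology X V) {} X {} id d = 0" for d
  proof -
    have "d \<in> ?j n ` H n X V"
      unfolding exact_space[OF sub(2)] using d by blast
    then obtain z where z: "z \<in> H n X V" "?j n z = d" by auto
    have "?j' n (?e n z) = 0" using jj[OF z(1)] unfolding z(2) d(2) by (rule sym)
    then have "?e n z = 0" using j'0 ind_mem[OF pm(1) z(1)] by blast
    then have "z = 0" using e_inj z by blast
    then show ?thesis using z ind_zero[OF pm(4)] by simp
  qed
  have "bd n X V v \<in> H (n + 1) X V"
    using lin_bd[OF sub(2)] v unfolding lin_on_def by blast
  moreover have "?e (n + 1) (bd n X V v) = 0"
  proof -
    have "?e (n + 1) (bd n X V v) = bd n ?XU ?W (restr n X ?W V v)"
      using bd_natural[OF pm(1) v] by (simp add: XW)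
    also have "\<dots> = 0"
      by (rule bd0) (use v in \<open>auto intro: restr_mem\<close>)
    finally show ?thesis .
  qed
  ultimately have "bd n X V v = 0" using e_inj by blast
  then have "v \<in> ind n (subtopology X V) {} X {} id ` H n X {}"
    unfolding exact_subspace[OF sub(2)] using v by blast
  then obtain x where x: "x \<in> H n X {}" "ind n (subtopology X V) {} X {} id x = v" by auto
  let ?xU = "ind n ?XU {} X {} id x"
  have xU: "?xU \<in> H n ?XU {}" using ind_mem[OF pm(2) x(1)] .
  have dU: "u - ?xU \<in> H n ?XU {}"
    using u xU subspace_H[of "{}" ?XU n] by (simp add: subspace_diff)
  have pW: "pair_map (subtopology X ?W) {} ?XU {} id" "pair_map (subtopology X ?W) {} (subtopology X V) {} id"
    by (simp_all add: pair_map_restr)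
  have "restr n X ?W U ?xU = restr n X ?W V v"
    using ind_comp[OF pW(1) pm(2) x(1)] ind_comp[OF pW(2) pm(5) x(1)] x(2) by simp
  then have "restr n X ?W U (u - ?xU) = 0"
    using ind_diff[OF pW(1) u xU] uv by simp
  then have "u - ?xU \<in> ?j' n ` H n ?XU ?W"
    unfolding exact_space[OF sub(3)] XW using dU by blast
  then obtain z' where z': "z' \<in> H n ?XU ?W" "?j' n z' = u - ?xU" by auto
  then have "z' \<in> ?e n ` H n X V" using exc[of n] by (simp add: bij_betw_def)
  then obtain z where z: "z \<in> H n X V" "?e n z = z'" by auto
  have jz: "?j n z \<in> H n X {}" "ind n (subtopology X V) {} X {} id (?j n z) = 0"
    using exact_space[OF sub(2), of n] z(1) by blast+
  show ?thesis
  proof (rule ex1I[of _ "x + ?j n z"], intro conjI)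
    show "x + ?j n z \<in> H n X {}"
      using x jz subspace_H[of "{}" X n] by (simp add: subspace_add)
    show "ind n ?XU {} X {} id (x + ?j n z) = u"
      using ind_add[OF pm(2) x(1) jz(1)] unfolding jj[OF z(1)] z(2) z'(2) by simp
    show "ind n (subtopology X V) {} X {} id (x + ?j n z) = v"
      using ind_add[OF pm(5) x(1) jz(1)] jz x by simp
    then show "y = x + ?j n z"
      if "y \<in> H n X {} \<and> ind n ?XU {} X {} id y = u \<and> ind n (subtopology X V) {} X {} id y = v" for y
      using that unique[of "y - (x + ?j n z)"] \<open>x + ?j n z \<in> H n X {}\<close>
        \<open>ind n ?XU {} X {} id (x + ?j n z) = u\<close> subspace_H[of "{}" X n]
        ind_diff[OF pm(2), of y n "x + ?j n z"] ind_diff[OF pm(5), of y n "x + ?j n z"]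
      by (simp add: subspace_diff)
  qed
qed

definition compatible :: "int \<Rightarrow> 'u topology \<Rightarrow> ('p::order \<Rightarrow> 'u set) \<Rightarrow> 'p set \<Rightarrow> ('p \<Rightarrow> 'm) \<Rightarrow> bool" where
  "compatible n X G Q x \<longleftrightarrow>
     (\<forall>p\<in>Q. x p \<in> H n (subtopology X (G p)) {}) \<and>
     (\<forall>p\<in>Q. \<forall>q\<in>Q. p \<le> q \<longrightarrow> restr n X (G p) (G q) (x q) = x p)"

text \<open>Induction on the size of \<open>Q\<close>: remove a maximal element \<open>m\<close>. The intersection of \<open>G m\<close> with the union over
  \<open>Q - {m}\<close> is the union over the elements below \<open>m\<close>, a smaller down-closed set; there the cohomology is
  known to be the limit, so that \<open>ext\<close> is the surjectivity needed for \<open>mayer_vietoris_pullback\<close>.\<close>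

lemma ordered_cover_limit:
  fixes G :: "'p::order \<Rightarrow> 'u set"
  assumes P: "finite P"
    and G: "\<And>p. p \<in> P \<Longrightarrow> openin X (G p)"
    and mono: "\<And>p q. p \<in> P \<Longrightarrow> q \<in> P \<Longrightarrow> p \<le> q \<Longrightarrow> G p \<subseteq> G q"
    and Int: "\<And>p q. p \<in> P \<Longrightarrow> q \<in> P \<Longrightarrow> G p \<inter> G q \<subseteq> (\<Union>r\<in>{r\<in>P. r \<le> p \<and> r \<le> q}. G r)"
    and ext: "\<And>n m x. m \<in> P \<Longrightarrow> compatible n X G {p\<in>P. p < m} x \<Longrightarrow>
       \<exists>y\<in>H n (subtopology X (G m)) {}. \<forall>p\<in>P. p < m \<longrightarrow> restr n X (G p) (G m) y = x p"
    and Q: "Q \<subseteq> P" "\<And>p q. p \<in> P \<Longrightarrow> q \<in> Q \<Longrightarrow> p \<le> q \<Longrightarrow> p \<in> Q"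
    and x: "compatible n X G Q x"
  shows "\<exists>!y. y \<in> H n (subtopology X (\<Union>p\<in>Q. G p)) {} \<and> (\<forall>p\<in>Q. restr n X (G p) (\<Union>p\<in>Q. G p) y = x p)"
  using Q x
proof (induction "card Q" arbitrary: Q n x rule: less_induct)
  case less
  have finQ: "finite Q" by (rule finite_subset[OF less.prems(1) P])
  show ?case
  proof (cases "Q = {}")
    case True
    then show ?thesis by (auto simp: H_empty_space)
  next
    case False
    obtain m where m: "m \<in> Q" "\<And>q. q \<in> Q \<Longrightarrow> m \<le> q \<Longrightarrow> m = q"
      using finite_has_maximal[OF finQ False] by auto
    let ?G = "\<lambda>Q. \<Union>p\<in>Q. G p"
    let ?Q' = "Q - {m}" and ?L = "{p\<in>P. p < m}"
    have mP: "m \<in> P" using m(1) less.prems(1) by auto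
    have LQ: "?L \<subseteq> ?Q'" using less.prems(2) m(1) by auto
    have OQ: "?G Q = G m \<union> ?G ?Q'" using m(1) by auto
    have W: "G m \<inter> ?G ?Q' = ?G ?L"
    proof
      show "G m \<inter> ?G ?Q' \<subseteq> ?G ?L"
      proof
        fix z assume "z \<in> G m \<inter> ?G ?Q'"
        then obtain q where q: "q \<in> Q" "q \<noteq> m" "z \<in> G m \<inter> G q" by auto
        then obtain r where r: "r \<in> P" "r \<le> m" "r \<le> q" "z \<in> G r"
          using Int[of m q] mP less.prems(1) by blast
        moreover have "r \<noteq> m" using m(2) q r by auto
        ultimately show "z \<in> ?G ?L" by auto
      qed
      show "?G ?L \<subseteq> G m \<inter> ?G ?Q'"
      proof (rule Int_greatest)
        show "?G ?L \<subseteq> G m" by (rule UN_least) (simp add: mono mP less_imp_le)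
        show "?G ?L \<subseteq> ?G ?Q'" using LQ by blast
      qed
    qed
    have cardQ': "card ?Q' < card Q" using m finQ by (meson card_Diff1_less)
    have cardL: "card ?L < card Q"
      using card_mono[OF _ LQ] finQ cardQ' by simp
    have IHQ: "\<exists>!y. y \<in> H n (subtopology X (?G ?Q')) {} \<and> (\<forall>p\<in>?Q'. restr n X (G p) (?G ?Q') y = x p)"
      if "compatible n X G ?Q' x" for n x
      by (rule less.hyps[OF cardQ' _ _ that]) (use less.prems(1,2) m in auto)
    have IHL: "\<exists>!y. y \<in> H n (subtopology X (?G ?L)) {} \<and> (\<forall>p\<in>?L. restr n X (G p) (?G ?L) y = x p)"
      if "compatible n X G ?L x" for n x
      by (rule less.hyps[OF cardL _ _ that]) auto
    have Lcompat: "compatible n X G ?L (\<lambda>p. restr n X (G p) A w)"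
      if w: "w \<in> H n (subtopology X A) {}" and A: "?G ?L \<subseteq> A" for w n A
    proof -
      have "G p \<subseteq> A" if "p \<in> ?L" for p using A that by blast
      then show ?thesis
        using w mono by (auto simp: compatible_def restr_comp intro: restr_mem)
    qed
    have Luniq: "w = w'" if "w \<in> H n (subtopology X (?G ?L)) {}" "w' \<in> H n (subtopology X (?G ?L)) {}"
      "\<And>p. p \<in> ?L \<Longrightarrow> restr n X (G p) (?G ?L) w = restr n X (G p) (?G ?L) w'" for w w' n
    proof -
      let ?R = "\<lambda>y. y \<in> H n (subtopology X (?G ?L)) {} \<and>
        (\<forall>p\<in>?L. restr n X (G p) (?G ?L) y = restr n X (G p) (?G ?L) w)"
      have "\<exists>!y. ?R y" by (rule IHL[OF Lcompat[OF that(1) order_refl]])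
      moreover have "?R w" using that(1) by simp
      moreover have "?R w'" using that(2,3) by simp
      ultimately show ?thesis by (rule Ex1_unique[where R = ?R])
    qed
    have OmL: "?G ?L \<subseteq> G m" and OQL: "?G ?L \<subseteq> ?G ?Q'" using W by blast+
    have sub: "subtopology (subtopology X (?G Q)) (G m) = subtopology X (G m)"
      "subtopology (subtopology X (?G Q)) (?G ?Q') = subtopology X (?G ?Q')"
      "subtopology (subtopology X (?G Q)) (G m \<inter> ?G ?Q') = subtopology X (?G ?L)"
    proof -
      have "?G Q \<inter> G m = G m" "?G Q \<inter> ?G ?Q' = ?G ?Q'" "?G Q \<inter> (G m \<inter> ?G ?Q') = G m \<inter> ?G ?Q'"
        unfolding OQ by blast+
      then show "subtopology (subtopology X (?G Q)) (G m) = subtopology X (G m)"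
        "subtopology (subtopology X (?G Q)) (?G ?Q') = subtopology X (?G ?Q')"
        "subtopology (subtopology X (?G Q)) (G m \<inter> ?G ?Q') = subtopology X (?G ?L)"
        by (simp_all only: subtopology_subtopology W)
    qed
    have open_m: "openin X (G m)" and open_Q': "openin X (?G ?Q')"
      using G mP less.prems(1) by auto
    have "G m \<inter> ?G Q = G m" "?G ?Q' \<inter> ?G Q = ?G ?Q'" unfolding OQ by blast+
    then have opn: "openin (subtopology X (?G Q)) (G m)" "openin (subtopology X (?G Q)) (?G ?Q')"
      using openin_subtopology_Int[OF open_m, of "?G Q"] openin_subtopology_Int[OF open_Q', of "?G Q"]
      by simp_all
    have cov: "G m \<union> ?G ?Q' = topspace (subtopology X (?G Q))"
      using openin_subset[OF open_m] openin_subset[OF open_Q'] by (auto simp: OQ)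
    have surj: "\<exists>u\<in>H n (subtopology X (G m)) {}. restr n X (?G ?L) (G m) u = w"
      if w: "w \<in> H n (subtopology X (?G ?L)) {}" for n w
    proof -
      obtain y where y: "y \<in> H n (subtopology X (G m)) {}"
        "\<And>p. p \<in> ?L \<Longrightarrow> restr n X (G p) (G m) y = restr n X (G p) (?G ?L) w"
        using ext[OF mP Lcompat[OF w order_refl]] by blast
      have "restr n X (?G ?L) (G m) y = w"
      proof (rule Luniq[OF restr_mem[OF OmL y(1)] w])
        fix p assume p: "p \<in> ?L"
        then have "G p \<subseteq> ?G ?L" by blast
        then show "restr n X (G p) (?G ?L) (restr n X (?G ?L) (G m) y) = restr n X (G p) (?G ?L) w"
          using y(2)[OF p] restr_comp[OF _ OmL y(1)] by simp
      qed
      then show ?thesis using y by blast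
    qed
    have mv: "\<exists>!y. y \<in> H n (subtopology X (?G Q)) {} \<and> restr n X (G m) (?G Q) y = u \<and>
                restr n X (?G ?Q') (?G Q) y = v"
      if "u \<in> H n (subtopology X (G m)) {}" "v \<in> H n (subtopology X (?G ?Q')) {}"
        "restr n X (?G ?L) (G m) u = restr n X (?G ?L) (?G ?Q') v" for u v
      using mayer_vietoris_pullback[OF opn cov, of u n v, unfolded sub] surj that by blast
    have xm: "x m \<in> H n (subtopology X (G m)) {}"
      using less.prems(3) m(1) by (auto simp: compatible_def)
    have x': "compatible n X G ?Q' x"
      using less.prems(3) by (auto simp: compatible_def)
    obtain v where v: "v \<in> H n (subtopology X (?G ?Q')) {}"
      "\<And>p. p \<in> ?Q' \<Longrightarrow> restr n X (G p) (?G ?Q') v = x p"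
      using IHQ[OF x'] by blast
    have agree: "restr n X (?G ?L) (G m) (x m) = restr n X (?G ?L) (?G ?Q') v"
    proof (rule Luniq[OF restr_mem[OF OmL xm] restr_mem[OF OQL v(1)]])
      fix p assume p: "p \<in> ?L"
      then have "G p \<subseteq> ?G ?L" "p \<in> ?Q'" "p \<le> m" "p \<in> Q" using LQ by auto
      then show "restr n X (G p) (?G ?L) (restr n X (?G ?L) (G m) (x m)) =
            restr n X (G p) (?G ?L) (restr n X (?G ?L) (?G ?Q') v)"
        using restr_comp[OF _ OmL xm, of "G p"] restr_comp[OF _ OQL v(1), of "G p"] v(2)[of p]
          less.prems(3) m(1) by (auto simp: compatible_def)
    qed
    have Q'Q: "?G ?Q' \<subseteq> ?G Q" by blast
    have iff: "(restr n X (G m) (?G Q) y = x m \<and> restr n X (?G ?Q') (?G Q) y = v) \<longleftrightarrow>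
          (\<forall>p\<in>Q. restr n X (G p) (?G Q) y = x p)"
      if y: "y \<in> H n (subtopology X (?G Q)) {}" for y
    proof -
      have c: "restr n X (G p) (?G ?Q') (restr n X (?G ?Q') (?G Q) y) = restr n X (G p) (?G Q) y"
        if "p \<in> ?Q'" for p
        by (rule restr_comp[OF _ Q'Q y]) (use that in blast)
      have "restr n X (?G ?Q') (?G Q) y = v" if *: "\<And>p. p \<in> ?Q' \<Longrightarrow> restr n X (G p) (?G Q) y = x p"
      proof -
        let ?R = "\<lambda>y. y \<in> H n (subtopology X (?G ?Q')) {} \<and> (\<forall>p\<in>?Q'. restr n X (G p) (?G ?Q') y = x p)"
        have "\<exists>!y. ?R y" by (rule IHQ[OF x'])
        moreover have "?R (restr n X (?G ?Q') (?G Q) y)"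
          using restr_mem[OF Q'Q y] c * by simp
        moreover have "?R v" using v by simp
        ultimately show ?thesis by (rule Ex1_unique[where R = ?R])
      qed
      moreover have "\<forall>p\<in>?Q'. restr n X (G p) (?G Q) y = x p" if "restr n X (?G ?Q') (?G Q) y = v"
        using c v(2) that by metis
      ultimately show ?thesis using m(1) by blast
    qed
    show ?thesis
      using mv[OF xm v(1) agree] iff by blast
  qed
qed

end

section \<open>Total cohomology\<close>

context cohomology_theory
begin

abbreviation "hs \<equiv> fun_scale sc"

lemma vector_space_hs: "vector_space (hs :: 'k \<Rightarrow> (int \<Rightarrow> 'm) \<Rightarrow> int \<Rightarrow> 'm)"
  by (rule vector_space_fun_scale) (rule vector_space_axioms)

lemma hstar_mem: "x \<in> hstar H X \<Longrightarrow> x n \<in> H n X {}"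
  by (simp add: hstar_def)

lemma subspace_hstar: "module.subspace hs (hstar H X)"
proof -
  interpret S: vector_space "hs :: 'k \<Rightarrow> (int \<Rightarrow> 'm) \<Rightarrow> int \<Rightarrow> 'm" by (rule vector_space_hs)
  have sub: "subspace (H n X {})" for n by (rule subspace_H) simp
  show ?thesis
    unfolding S.subspace_def
  proof (intro conjI ballI allI)
    show "0 \<in> hstar H X"
      using subspace_0[OF sub] by (simp add: hstar_def zero_fun_apply)
    fix x assume x: "x \<in> hstar H X"
    show "x + y \<in> hstar H X" if y: "y \<in> hstar H X" for y
    proof -
      have "{n. (x + y) n \<noteq> 0} \<subseteq> {n. x n \<noteq> 0} \<union> {n. y n \<noteq> 0}" by (auto simp: plus_fun_apply)
      then have "finite {n. (x + y) n \<noteq> 0}"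
        using x y by (auto simp: hstar_def intro: finite_subset)
      then show ?thesis
        using x y subspace_add[OF sub] by (simp add: hstar_def plus_fun_apply)
    qed
    show "hs c x \<in> hstar H X" for c
    proof -
      have "{n. hs c x n \<noteq> 0} \<subseteq> {n. x n \<noteq> 0}" by (auto simp: fun_scale_def)
      then have "finite {n. hs c x n \<noteq> 0}"
        using x by (auto simp: hstar_def intro: finite_subset)
      then show ?thesis
        using x subspace_scale[OF sub] by (simp add: hstar_def fun_scale_def)
    qed
  qed
qed

lemma hstar_zero: "0 \<in> hstar H X"
  using zero_mem[of "{}" X] by (simp add: hstar_def zero_fun_apply)

lemma lin_on_hstar_map:
  assumes "continuous_map X Y f"
  shows "lin_on hs hs (hstar H Y) (hstar H X) (hstar_map ind X Y f)"
proof -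
  have pm: "pair_map X {} Y {} f" using assms by (simp add: pair_map_absolute)
  show ?thesis
    unfolding lin_on_def
  proof (intro conjI ballI allI image_subsetI)
    fix x assume x: "x \<in> hstar H Y"
    have "{n. hstar_map ind X Y f x n \<noteq> 0} \<subseteq> {n. x n \<noteq> 0}"
      by (auto simp: hstar_map_def ind_zero[OF pm])
    then have "finite {n. hstar_map ind X Y f x n \<noteq> 0}"
      using x by (auto simp: hstar_def intro: finite_subset)
    then show "hstar_map ind X Y f x \<in> hstar H X"
      using x ind_mem[OF pm] by (simp add: hstar_def hstar_map_def)
    show "hstar_map ind X Y f (x + y) = hstar_map ind X Y f x + hstar_map ind X Y f y"
      if "y \<in> hstar H Y" for y
      using ind_add[OF pm hstar_mem[OF x] hstar_mem[OF that]]
      by (simp add: hstar_map_def fun_eq_iff plus_fun_apply)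
    show "hstar_map ind X Y f (hs c x) = hs c (hstar_map ind X Y f x)" for c
      using lin_on_scale[OF lin_ind[OF pm] hstar_mem[OF x]]
      by (simp add: hstar_map_def fun_scale_def fun_eq_iff)
  qed
qed

lemma hstar_map_mem: "continuous_map X Y f \<Longrightarrow> z \<in> hstar H Y \<Longrightarrow> hstar_map ind X Y f z \<in> hstar H X"
  using lin_on_mem[OF lin_on_hstar_map] .

lemma hstar_map_comp:
  assumes "continuous_map X Y f" "continuous_map Y Z g" "z \<in> hstar H Z"
  shows "hstar_map ind X Z (g \<circ> f) z = hstar_map ind X Y f (hstar_map ind Y Z g z)"
  using ind_comp[of X "{}" Y "{}" f Z "{}" g] assms hstar_mem[OF assms(3)]
  by (simp add: hstar_map_def pair_map_absolute fun_eq_iff)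

lemma hstar_map_id: "z \<in> hstar H X \<Longrightarrow> hstar_map ind X X id z = z"
  by (auto simp: hstar_map_def ind_id hstar_mem)

lemma hstar_map_homotopic:
  assumes "homotopic_with (\<lambda>_. True) X Y f g" "z \<in> hstar H Y"
  shows "hstar_map ind X Y f z = hstar_map ind X Y g z"
  using homotopy[of "{}" X "{}" Y f g] assms hstar_mem[OF assms(2)]
  by (simp add: hstar_map_def fun_eq_iff)

lemma hstar_map_cong:
  assumes "continuous_map X Y f" "\<And>x. x \<in> topspace X \<Longrightarrow> f x = g x" "z \<in> hstar H Y"
  shows "hstar_map ind X Y f z = hstar_map ind X Y g z"
  using assms by (intro hstar_map_homotopic homotopic_with_equal) auto

lemma homogeneous_hstar_map:
  "continuous_map X Y f \<Longrightarrow> homogeneous n x \<Longrightarrow> homogeneous n (hstar_map ind X Y f x)"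
  using ind_zero by (simp add: homogeneous_def hstar_map_def pair_map_absolute)

lemma hstar_map_homotopy_equivalence:
  assumes f: "continuous_map X Y f" and g: "continuous_map Y X g"
    and gf: "homotopic_with (\<lambda>_. True) X X (g \<circ> f) id" and fg: "homotopic_with (\<lambda>_. True) Y Y (f \<circ> g) id"
  shows "lin_iso hs hs (hstar H Y) (hstar H X) (hstar_map ind X Y f)"
proof -
  have "bij_betw (hstar_map ind X Y f) (hstar H Y) (hstar H X)"
  proof (rule bij_betwI[where g = "hstar_map ind Y X g"])
    show "hstar_map ind X Y f \<in> hstar H Y \<rightarrow> hstar H X" "hstar_map ind Y X g \<in> hstar H X \<rightarrow> hstar H Y"
      using hstar_map_mem f g by auto
    show "hstar_map ind Y X g (hstar_map ind X Y f z) = z" if "z \<in> hstar H Y" for z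
      using hstar_map_comp[OF g f that] hstar_map_homotopic[OF fg that] hstar_map_id[OF that] by simp
    show "hstar_map ind X Y f (hstar_map ind Y X g z) = z" if "z \<in> hstar H X" for z
      using hstar_map_comp[OF f g that] hstar_map_homotopic[OF gf that] hstar_map_id[OF that] by simp
  qed
  then show ?thesis using lin_on_hstar_map[OF f] by (simp add: lin_iso_def)
qed

definition single :: "int \<Rightarrow> 'm \<Rightarrow> int \<Rightarrow> 'm" where
  "single n y = (\<lambda>m. if m = n then y else 0)"

lemma single_mem: "y \<in> H n X {} \<Longrightarrow> single n y \<in> hstar H X"
proof -
  assume y: "y \<in> H n X {}"
  have "finite {m. single n y m \<noteq> 0}" by (rule finite_subset[of _ "{n}"]) (auto simp: single_def)
  then show ?thesis using y zero_mem[of "{}" X] by (simp add: hstar_def single_def)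
qed

definition component :: "int \<Rightarrow> (int \<Rightarrow> 'm) \<Rightarrow> int \<Rightarrow> 'm" where
  "component n x = single n (x n)"

lemma component_mem: "x \<in> hstar H X \<Longrightarrow> component n x \<in> hstar H X"
  by (simp add: component_def single_mem hstar_mem)

lemma homogeneous_component: "homogeneous n (component n x)"
  by (simp add: homogeneous_def component_def single_def)

lemma component_eq: "homogeneous n x \<Longrightarrow> component n x = x"
  by (auto simp: homogeneous_def component_def single_def)

lemma component_other: "homogeneous n x \<Longrightarrow> m \<noteq> n \<Longrightarrow> component m x = 0"
  by (auto simp: homogeneous_def component_def single_def fun_eq_iff zero_fun_apply)

lemma component_add: "component n (x + y) = component n x + component n y"
  by (auto simp: component_def single_def fun_eq_iff plus_fun_apply)

lemma component_scale: "component n (hs c x) = hs c (component n x)"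
  by (auto simp: component_def single_def fun_eq_iff fun_scale_def)

lemma component_zero: "component n 0 = 0"
  by (auto simp: component_def single_def fun_eq_iff zero_fun_apply)

text \<open>Elements of \<open>h\<^sup>*\<close> have finitely many nonzero components, so homogeneous elements generate.\<close>

lemma hstar_induct [consumes 1, case_names zero homogeneous add]:
  assumes y: "y \<in> hstar H X" and zero: "Q 0"
    and homogeneous: "\<And>n x. x \<in> hstar H X \<Longrightarrow> homogeneous n x \<Longrightarrow> Q x"
    and add: "\<And>x y. x \<in> hstar H X \<Longrightarrow> y \<in> hstar H X \<Longrightarrow> Q x \<Longrightarrow> Q y \<Longrightarrow> Q (x + y)"
  shows "Q y"
proof -
  have "Q y" if "finite F" "{n. y n \<noteq> 0} \<subseteq> F" "y \<in> hstar H X" for F y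
    using that
  proof (induct F arbitrary: y)
    case empty
    then have "y = 0" by (auto simp: fun_eq_iff zero_fun_apply)
    then show ?case using zero by simp
  next
    case (insert n F)
    let ?r = "\<lambda>m. if m = n then 0 else y m"
    have "finite {m. ?r m \<noteq> 0}"
      using insert.hyps(1) insert.prems(1) by (auto intro: finite_subset[of _ "insert n F"])
    then have r: "?r \<in> hstar H X"
      using insert.prems(2) zero_mem[of "{}" X] by (simp add: hstar_def)
    have "Q ?r" by (rule insert.hyps(3)[OF _ r]) (use insert.prems(1) in auto)
    moreover have "y = component n y + ?r"
      by (auto simp: fun_eq_iff component_def single_def plus_fun_apply)
    ultimately show ?case
      using add[OF component_mem[OF insert.prems(2), of n] r]
        homogeneous[OF component_mem[OF insert.prems(2), of n] homogeneous_component] by simp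
  qed
  then show ?thesis using y by (auto simp: hstar_def)
qed

end

section \<open>Finite products of spaces in a universe\<close>

text \<open>The product of the spaces \<open>Y v\<close> for \<open>v\<close> in a list, as a space with points in \<open>'u\<close>. A one-element list gives
  \<open>Y v\<close> itself, not \<open>Y v\<close> times a point, since the two-fold Kuenneth formula does not make \<open>h\<^sup>*(pt)\<close> the ground field. The empty
  product is a point.\<close>

fun iterated_prod :: "('u \<times> 'u \<Rightarrow> 'u) \<Rightarrow> 'i list \<Rightarrow> ('i \<Rightarrow> 'u topology) \<Rightarrow> 'u topology" where
  "iterated_prod pr [] Y = discrete_topology {undefined}"
| "iterated_prod pr [v] Y = Y v"
| "iterated_prod pr (v # w # vs) Y = space_prod pr (Y v) (iterated_prod pr (w # vs) Y)"

fun encode :: "('u \<times> 'u \<Rightarrow> 'u) \<Rightarrow> 'i list \<Rightarrow> ('i \<Rightarrow> 'u) \<Rightarrow> 'u" where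
  "encode pr [] x = undefined"
| "encode pr [v] x = x v"
| "encode pr (v # w # vs) x = pr (x v, encode pr (w # vs) x)"

fun decode :: "('u \<times> 'u \<Rightarrow> 'u) \<Rightarrow> 'i list \<Rightarrow> 'u \<Rightarrow> 'i \<Rightarrow> 'u" where
  "decode pr [] u = (\<lambda>_. undefined)"
| "decode pr [v] u = (\<lambda>_. undefined)(v := u)"
| "decode pr (v # w # vs) u = (decode pr (w # vs) (snd (inv pr u)))(v := fst (inv pr u))"

lemma topspace_space_prod:
  "inj pr \<Longrightarrow> topspace (space_prod pr X Y) = pr ` (topspace X \<times> topspace Y)"
  unfolding space_prod_def topspace_pullback_topology by (force simp: inv_f_f)

lemma continuous_inv_space_prod: "continuous_map (space_prod pr X Y) (prod_topology X Y) (inv pr)"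
  using continuous_map_pullback[OF continuous_map_id, of "range pr" "inv pr" "prod_topology X Y"]
  by (simp add: space_prod_def)

lemma continuous_into_space_prod:
  assumes "inj pr" "continuous_map T (prod_topology X Y) f"
  shows "continuous_map T (space_prod pr X Y) (pr \<circ> f)"
  unfolding space_prod_def
  by (rule continuous_map_pullback') (use assms in \<open>auto simp: o_def inv_f_f\<close>)

lemma continuous_prod_map:
  assumes "inj pr" "continuous_map X X' f" "continuous_map Y Y' g"
  shows "continuous_map (space_prod pr X Y) (space_prod pr X' Y') (prod_map pr f g)"
proof -
  have "continuous_map (prod_topology X Y) (prod_topology X' Y') (map_prod f g)"
    using continuous_map_compose[OF continuous_map_fst assms(2), of Y]
      continuous_map_compose[OF continuous_map_snd assms(3), of X]
    by (simp add: continuous_map_pairwise o_def)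
  then have "continuous_map (space_prod pr X Y) (prod_topology X' Y') (map_prod f g \<circ> inv pr)"
    using continuous_inv_space_prod continuous_map_compose by blast
  from continuous_into_space_prod[OF assms(1) this] show ?thesis
    by (simp add: prod_map_def o_assoc)
qed

lemma prod_map_id:
  assumes "inj pr" "u \<in> topspace (space_prod pr X Y)"
  shows "prod_map pr id id u = u"
  using assms by (auto simp: topspace_space_prod prod_map_def inv_f_f)

lemma continuous_encode:
  assumes "inj pr" "set vs \<subseteq> I"
  shows "continuous_map (product_topology Y I) (iterated_prod pr vs Y) (encode pr vs)"
  using assms(2)
proof (induct vs rule: induct_list012)
  case 1
  have "encode pr [] = (\<lambda>x. undefined)" by (simp add: fun_eq_iff)
  then show ?case by simp
next
  case (2 v)
  have "encode pr [v] = (\<lambda>x. x v)" by (simp add: fun_eq_iff)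
  then show ?case using 2 by (simp add: continuous_map_product_projection)
next
  case (3 v w vs)
  have "encode pr (v # w # vs) = pr \<circ> (\<lambda>x. (x v, encode pr (w # vs) x))" by (simp add: fun_eq_iff)
  moreover have "continuous_map (product_topology Y I) (space_prod pr (Y v) (iterated_prod pr (w # vs) Y))
      (pr \<circ> (\<lambda>x. (x v, encode pr (w # vs) x)))"
    using 3 by (intro continuous_into_space_prod[OF assms(1)] continuous_map_pairedI
        continuous_map_product_projection) auto
  ultimately show ?case unfolding iterated_prod.simps by metis
qed

lemma decode_outside: "i \<notin> set vs \<Longrightarrow> decode pr vs u i = undefined"
  by (induct vs arbitrary: u rule: induct_list012) auto

lemma continuous_decode_coordinate:
  "i \<in> set vs \<Longrightarrow> continuous_map (iterated_prod pr vs Y) (Y i) (\<lambda>u. decode pr vs u i)"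
proof (induct vs rule: induct_list012)
  case (3 v w vs)
  let ?T = "iterated_prod pr (w # vs) Y"
  show ?case
  proof (cases "i = v")
    case True
    have "continuous_map (space_prod pr (Y v) ?T) (Y v) (fst \<circ> inv pr)"
      by (rule continuous_map_compose[OF continuous_inv_space_prod continuous_map_fst])
    then show ?thesis using True by (simp add: o_def)
  next
    case False
    then have "continuous_map ?T (Y i) (\<lambda>u. decode pr (w # vs) u i)" using 3 by auto
    from continuous_map_compose[OF continuous_map_compose[OF continuous_inv_space_prod continuous_map_snd] this]
    show ?thesis using False by (simp add: o_def)
  qed
qed (simp_all flip: id_def)

lemma continuous_decode:
  "continuous_map (iterated_prod pr vs Y) (product_topology Y (set vs)) (decode pr vs)"
  unfolding continuous_map_componentwise
  by (auto simp: continuous_decode_coordinate extensional_def decode_outside)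

lemma decode_encode:
  assumes "inj pr" "distinct vs" "x \<in> extensional (set vs)"
  shows "decode pr vs (encode pr vs x) = x"
proof -
  have "decode pr vs (encode pr vs x) i = x i" if "i \<in> set vs" for i
    using that assms(2)
    by (induct vs rule: induct_list012) (auto simp: inv_f_f[OF assms(1)])
  then show ?thesis
    using assms(3) decode_outside by (fastforce simp: fun_eq_iff extensional_def)
qed

lemma encode_cong: "(\<And>i. i \<in> set vs \<Longrightarrow> x i = y i) \<Longrightarrow> encode pr vs x = encode pr vs y"
  by (induct vs rule: induct_list012) auto

lemma encode_decode:
  assumes "inj pr"
  shows "distinct vs \<Longrightarrow> u \<in> topspace (iterated_prod pr vs Y) \<Longrightarrow> encode pr vs (decode pr vs u) = u"
proof (induct vs arbitrary: u rule: induct_list012)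
  case (3 v w vs)
  from 3(4) obtain a b where ab: "u = pr (a, b)" "b \<in> topspace (iterated_prod pr (w # vs) Y)"
    by (auto simp: topspace_space_prod[OF assms])
  have "encode pr (w # vs) ((decode pr (w # vs) b)(v := a)) = encode pr (w # vs) (decode pr (w # vs) b)"
    using 3(3) by (intro encode_cong) auto
  also have "\<dots> = b" using 3(2)[OF _ ab(2)] 3(3) by simp
  finally show ?case by (simp add: ab(1) inv_f_f[OF assms] fun_upd_def)
qed auto

section \<open>Iterated cross products\<close>

text \<open>The cross product of cohomology classes along a list. The class \<open>e\<close> is the value for the empty list,
  where the two-fold products give no information.\<close>

fun cross ::
    "('k::field \<Rightarrow> (int \<Rightarrow> 'm) \<Rightarrow> int \<Rightarrow> 'm::ab_group_add) \<Rightarrow> ('u topology \<Rightarrow> (int \<Rightarrow> 'm) set) \<Rightarrow>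
     ('u \<times> 'u \<Rightarrow> 'u) \<Rightarrow> ('u topology \<Rightarrow> 'u topology \<Rightarrow> (bool, int \<Rightarrow> 'm, 'k) tensor \<Rightarrow> int \<Rightarrow> 'm) \<Rightarrow>
     (int \<Rightarrow> 'm) \<Rightarrow> 'i list \<Rightarrow> ('i \<Rightarrow> 'u topology) \<Rightarrow> ('i \<Rightarrow> int \<Rightarrow> 'm) \<Rightarrow> int \<Rightarrow> 'm" where
  "cross s h pr \<theta> e [] Y x = e"
| "cross s h pr \<theta> e [v] Y x = x v"
| "cross s h pr \<theta> e (v # w # vs) Y x =
     \<theta> (Y v) (iterated_prod pr (w # vs) Y)
       (pure_tensor s UNIV (case_bool (h (Y v)) (h (iterated_prod pr (w # vs) Y)))
          (case_bool (x v) (cross s h pr \<theta> e (w # vs) Y x)))"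

lemma cross_cong:
  "(\<And>i. i \<in> set vs \<Longrightarrow> x i = y i) \<Longrightarrow> cross s h pr \<theta> e vs Y x = cross s h pr \<theta> e vs Y y"
  by (induct vs rule: induct_list012) auto

lemma universal_multilinear_empty:
  assumes s: "vector_space s" and \<eta>: "lin_iso (*) s UNIV W \<eta>"
  shows "universal_multilinear s s {} V W (\<lambda>_. \<eta> 1)"
proof -
  interpret S: vector_space s by fact
  have "module ((*) :: 'a \<Rightarrow> 'a \<Rightarrow> 'a)" using vector_space_mult by (simp add: module_iff_vector_space)
  then have sub: "module.subspace ((*) :: 'a \<Rightarrow> 'a \<Rightarrow> 'a) UNIV" by (simp add: module.subspace_def)
  have lin: "lin_on (*) s UNIV W \<eta>" and bij: "bij_betw \<eta> UNIV W" using \<eta> by (auto simp: lin_iso_def)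
  have \<eta>c: "\<eta> c = s c (\<eta> 1)" for c
    using lin_on_scale[OF lin, of 1 c] by simp
  have "W = S.span {\<eta> 1}"
  proof -
    have "W = range \<eta>" using bij by (simp add: bij_betw_def)
    also have "\<dots> = range (\<lambda>c. s c (\<eta> 1))" using \<eta>c by (rule image_cong[OF refl])
    also have "\<dots> = S.span {\<eta> 1}" by (simp add: S.span_singleton)
    finally show ?thesis .
  qed
  moreover have "lin_on s (*) W UNIV (\<lambda>w. inv_into UNIV \<eta> w * c)" for c
    using lin_iso_inverse[OF \<eta> vector_space_mult sub]
    by (simp add: lin_iso_def lin_on_def distrib_right mult.assoc)
  moreover have "inv_into UNIV \<eta> (\<eta> 1) = 1"
    using bij by (simp add: bij_betw_inv_into_left)
  ultimately show ?thesis
    unfolding universal_multilinear_def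
    by (auto simp: multilinear_on_def) (metis mult.left_neutral)
qed

lemma universal_multilinear_singleton:
  assumes s: "vector_space s" and V: "module.subspace s (V v)"
  shows "universal_multilinear s s {v} V (V v) (\<lambda>x. x v)"
proof -
  interpret S: vector_space s by fact
  have mem: "(\<lambda>_. undefined)(v := a) \<in> Pi\<^sub>E {v} V" if "a \<in> V v" for a
    using that by (auto simp: PiE_iff extensional_def)
  have im: "(\<lambda>x. x v) ` Pi\<^sub>E {v} V = V v"
  proof
    show "V v \<subseteq> (\<lambda>x. x v) ` Pi\<^sub>E {v} V"
    proof
      fix a assume "a \<in> V v"
      then show "a \<in> (\<lambda>x. x v) ` Pi\<^sub>E {v} V" by (intro image_eqI[OF _ mem]) simp_all
    qed
  qed auto
  have "V v = S.span ((\<lambda>x. x v) ` Pi\<^sub>E {v} V)"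
    unfolding im by (rule sym) (simp only: S.span_eq_iff V)
  moreover have "\<exists>g. lin_on s (*) (V v) UNIV g \<and> (\<forall>x\<in>Pi\<^sub>E {v} V. g (x v) = B x)"
    if B: "multilinear_on s (*) {v} V B" for B
  proof (intro exI[of _ "\<lambda>a. B ((\<lambda>_. undefined)(v := a))"] conjI ballI)
    show "lin_on s (*) (V v) UNIV (\<lambda>a. B ((\<lambda>_. undefined)(v := a)))"
      unfolding lin_on_def
    proof (intro conjI ballI allI)
      fix a assume a: "a \<in> V v"
      note B' = B[unfolded multilinear_on_def, rule_format, OF mem[OF a], of v a]
      show "B ((\<lambda>_. undefined)(v := a + b)) = B ((\<lambda>_. undefined)(v := a)) + B ((\<lambda>_. undefined)(v := b))"
        if "b \<in> V v" for b
        using B' a that by simp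
      show "B ((\<lambda>_. undefined)(v := s c a)) = c * B ((\<lambda>_. undefined)(v := a))" for c
        using B' a by simp
    qed simp
    show "B ((\<lambda>_. undefined)(v := x v)) = B x" if "x \<in> Pi\<^sub>E {v} V" for x
    proof -
      have "(\<lambda>_. undefined)(v := x v) = x" using that by (auto simp: PiE_iff extensional_def fun_eq_iff)
      then show ?thesis by simp
    qed
  qed
  moreover have "multilinear_on s s {v} V (\<lambda>x. x v)"
    by (simp add: multilinear_on_def)
  ultimately show ?thesis
    unfolding universal_multilinear_def by blast
qed

locale kunneth_theory = cohomology_theory sc H ind bd
  for sc :: "'k::field \<Rightarrow> 'm::ab_group_add \<Rightarrow> 'm"
    and H :: "int \<Rightarrow> 'u topology \<Rightarrow> 'u set \<Rightarrow> 'm set" and ind and bd +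
  fixes pr :: "'u \<times> 'u \<Rightarrow> 'u" and C :: "'u topology set"
    and \<theta> :: "'u topology \<Rightarrow> 'u topology \<Rightarrow> (bool, int \<Rightarrow> 'm, 'k) tensor \<Rightarrow> int \<Rightarrow> 'm"
  assumes inj_pr: "inj pr" and closed_C: "product_closed pr C"
    and kunneth: "strong_kunneth sc H ind pr C \<theta>"
begin

abbreviation "pair_family X Y \<equiv> case_bool (hstar H X) (hstar H Y)"
abbreviation "crossp \<equiv> cross hs (hstar H) pr \<theta>"
abbreviation "iter \<equiv> iterated_prod pr"

lemma kunneth_iso:
  "X \<in> C \<Longrightarrow> Y \<in> C \<Longrightarrow>
     lin_iso (fun_scale (*)) hs (tensor hs UNIV (pair_family X Y)) (hstar H (space_prod pr X Y)) (\<theta> X Y)"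
  using kunneth by (simp add: strong_kunneth_def)

lemma kunneth_natural:
  assumes "X \<in> C" "Y \<in> C" "X' \<in> C" "Y' \<in> C" "continuous_map X X' f" "continuous_map Y Y' g"
    "z \<in> tensor hs UNIV (pair_family X' Y')"
  shows "hstar_map ind (space_prod pr X Y) (space_prod pr X' Y') (prod_map pr f g) (\<theta> X' Y' z) =
         \<theta> X Y (tensor_map hs UNIV (pair_family X Y) (case_bool (hstar_map ind X X' f) (hstar_map ind Y Y' g)) z)"
  using kunneth assms unfolding strong_kunneth_def by blast

lemma iterated_prod_closed: "(\<And>v. v \<in> set vs \<Longrightarrow> Y v \<in> C) \<Longrightarrow> iter vs Y \<in> C"
  using closed_C by (induct vs rule: induct_list012) (auto simp: product_closed_def)

lemma pair_family_mem:
  "a \<in> hstar H X \<Longrightarrow> b \<in> hstar H Y \<Longrightarrow> case_bool a b \<in> Pi\<^sub>E UNIV (pair_family X Y)"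
  by (auto simp: PiE_iff split: bool.splits)

lemma universal_cross:
  assumes "distinct vs" "\<And>v. v \<in> set vs \<Longrightarrow> Y v \<in> C"
    and "vs = [] \<Longrightarrow> \<exists>\<eta>. lin_iso (*) hs UNIV (hstar H (discrete_topology {undefined})) \<eta> \<and> e = \<eta> 1"
  shows "universal_multilinear hs hs (set vs) (\<lambda>v. hstar H (Y v)) (hstar H (iter vs Y)) (crossp e vs Y)"
  using assms
proof (induct vs rule: induct_list012)
  case 1
  then obtain \<eta> where "lin_iso (*) hs UNIV (hstar H (discrete_topology {undefined})) \<eta>" "e = \<eta> 1" by auto
  moreover have "crossp e [] Y = (\<lambda>_. e)" by (simp add: fun_eq_iff)
  ultimately show ?case
    using universal_multilinear_empty[OF vector_space_hs] by simp
next
  case (2 v)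
  have "crossp e [v] Y = (\<lambda>x. x v)" by (simp add: fun_eq_iff)
  then show ?case
    using universal_multilinear_singleton[OF vector_space_hs, of "\<lambda>v. hstar H (Y v)" v] subspace_hstar by simp
next
  case (3 v w vs)
  have IH: "universal_multilinear hs hs (set (w # vs)) (\<lambda>v. hstar H (Y v)) (hstar H (iter (w # vs) Y))
      (crossp e (w # vs) Y)"
    by (rule 3(2)) (use 3(3,4) in auto)
  have "universal_multilinear hs hs (insert v (set (w # vs))) (\<lambda>v. hstar H (Y v))
      (hstar H (iter (v # w # vs) Y)) (crossp e (v # w # vs) Y)"
    unfolding iterated_prod.simps
  proof (rule universal_multilinear_insert[OF vector_space_hs _ subspace_hstar IH])
    show "v \<notin> set (w # vs)" using 3(3) by auto
    show "lin_iso (fun_scale (*)) hs (tensor hs UNIV (pair_family (Y v) (iter (w # vs) Y)))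
        (hstar H (space_prod pr (Y v) (iter (w # vs) Y))) (\<theta> (Y v) (iter (w # vs) Y))"
      by (intro kunneth_iso iterated_prod_closed 3(4)) auto
    show "crossp e (v # w # vs) Y x = \<theta> (Y v) (iter (w # vs) Y)
        (pure_tensor hs UNIV (pair_family (Y v) (iter (w # vs) Y))
          (case_bool (x v) (crossp e (w # vs) Y (restrict x (set (w # vs))))))" for x
      unfolding cross.simps by (subst cross_cong[of "w # vs" x "restrict x (set (w # vs))"]) auto
  qed (rule subspace_hstar)
  then show ?case unfolding list.set(2)[of v] .
qed

text \<open>The continuity of the identity between the two products is part of the induction, as naturality of the
  Kuenneth isomorphism in the last step needs it.\<close>

lemma cross_natural:
  assumes "distinct vs" "\<And>v. v \<in> set vs \<Longrightarrow> Y v \<in> C" "\<And>v. v \<in> set vs \<Longrightarrow> Y' v \<in> C"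
    and "\<And>v. v \<in> set vs \<Longrightarrow> continuous_map (Y v) (Y' v) id"
    and "vs = [] \<Longrightarrow> \<exists>\<eta>. lin_iso (*) hs UNIV (hstar H (discrete_topology {undefined})) \<eta> \<and> e = \<eta> 1"
    and "\<And>v. v \<in> set vs \<Longrightarrow> x v \<in> hstar H (Y' v)"
  shows "continuous_map (iter vs Y) (iter vs Y') id \<and>
    hstar_map ind (iter vs Y) (iter vs Y') id (crossp e vs Y' x) =
      crossp e vs Y (\<lambda>v. hstar_map ind (Y v) (Y' v) id (x v))"
  using assms
proof (induct vs rule: induct_list012)
  case 1
  then obtain \<eta> where "lin_iso (*) hs UNIV (hstar H (discrete_topology {undefined})) \<eta>" "e = \<eta> 1" by auto
  then have "e \<in> hstar H (discrete_topology {undefined})" by (auto simp: lin_iso_def lin_on_def)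
  then show ?case
    unfolding iterated_prod.simps cross.simps
    using hstar_map_id[of e "discrete_topology {undefined}"] continuous_map_id by blast
next
  case (2 v)
  then show ?case by simp
next
  case (3 v w vs)
  let ?T = "iter (w # vs) Y" and ?T' = "iter (w # vs) Y'"
  let ?x' = "\<lambda>v. hstar_map ind (Y v) (Y' v) id (x v)"
  have "continuous_map ?T ?T' id \<and>
    hstar_map ind ?T ?T' id (crossp e (w # vs) Y' x) = crossp e (w # vs) Y ?x'"
    by (rule 3(2)) (use 3(3-) in \<open>auto simp del: id_apply\<close>)
  then have IH: "continuous_map ?T ?T' id"
    "hstar_map ind ?T ?T' id (crossp e (w # vs) Y' x) = crossp e (w # vs) Y ?x'"
    by blast+
  have C: "Y v \<in> C" "Y' v \<in> C" "?T \<in> C" "?T' \<in> C"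
    by (intro iterated_prod_closed 3(4,5); simp)+
  have cv: "continuous_map (Y v) (Y' v) id" by (rule 3(6)) simp
  have xv: "x v \<in> hstar H (Y' v)" by (rule 3(8)) simp
  have univ: "universal_multilinear hs hs (set (w # vs)) (\<lambda>v. hstar H (Y' v)) (hstar H ?T') (crossp e (w # vs) Y')"
    by (rule universal_cross) (use 3(3,5) in auto)
  have "restrict x (set (w # vs)) \<in> Pi\<^sub>E (set (w # vs)) (\<lambda>v. hstar H (Y' v))"
    using 3(8) by auto
  from universal_multilinear_mem[OF univ vector_space_hs this]
  have xT: "crossp e (w # vs) Y' x \<in> hstar H ?T'"
    by (subst cross_cong[of "w # vs" x "restrict x (set (w # vs))"]) auto
  let ?z = "pure_tensor hs UNIV (pair_family (Y' v) ?T') (case_bool (x v) (crossp e (w # vs) Y' x))"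
  have z: "?z \<in> tensor hs UNIV (pair_family (Y' v) ?T')"
    by (rule pure_tensor_mem[OF pair_family_mem[OF xv xT]])
  have cont: "continuous_map (space_prod pr (Y v) ?T) (space_prod pr (Y' v) ?T') (prod_map pr id id)"
    by (rule continuous_prod_map[OF inj_pr cv IH(1)])
  have id_eq: "prod_map pr id id u = id u" if "u \<in> topspace (space_prod pr (Y v) ?T)" for u
    using prod_map_id[OF inj_pr that] by simp
  have cont_id: "continuous_map (space_prod pr (Y v) ?T) (space_prod pr (Y' v) ?T') id"
    by (rule continuous_map_eq[OF cont id_eq])
  have tz: "tensor_map hs UNIV (pair_family (Y v) ?T)
      (case_bool (hstar_map ind (Y v) (Y' v) id) (hstar_map ind ?T ?T' id)) ?z =
      pure_tensor hs UNIV (pair_family (Y v) ?T) (case_bool (?x' v) (crossp e (w # vs) Y ?x'))"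
  proof -
    have "tensor_map hs UNIV (pair_family (Y v) ?T)
      (case_bool (hstar_map ind (Y v) (Y' v) id) (hstar_map ind ?T ?T' id)) ?z =
      pure_tensor hs UNIV (pair_family (Y v) ?T)
        (\<lambda>i\<in>UNIV. case_bool (hstar_map ind (Y v) (Y' v) id) (hstar_map ind ?T ?T' id) i
          (case_bool (x v) (crossp e (w # vs) Y' x) i))"
      by (rule tensor_map_pure[OF _ pair_family_mem[OF xv xT]])
        (use lin_on_hstar_map[OF cv] lin_on_hstar_map[OF IH(1)] in \<open>simp split: bool.split\<close>)
    also have "(\<lambda>i\<in>UNIV. case_bool (hstar_map ind (Y v) (Y' v) id) (hstar_map ind ?T ?T' id) i
          (case_bool (x v) (crossp e (w # vs) Y' x) i)) = case_bool (?x' v) (crossp e (w # vs) Y ?x')"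
      using IH(2) by (auto simp: fun_eq_iff split: bool.split)
    finally show ?thesis .
  qed
  have \<theta>z: "\<theta> (Y' v) ?T' ?z \<in> hstar H (space_prod pr (Y' v) ?T')"
    using lin_on_mem[OF _ z] kunneth_iso[OF C(2,4)] unfolding lin_iso_def by blast
  have "hstar_map ind (space_prod pr (Y v) ?T) (space_prod pr (Y' v) ?T') id (\<theta> (Y' v) ?T' ?z) =
        hstar_map ind (space_prod pr (Y v) ?T) (space_prod pr (Y' v) ?T') (prod_map pr id id) (\<theta> (Y' v) ?T' ?z)"
    by (rule hstar_map_cong[OF cont id_eq \<theta>z, symmetric])
  also have "\<dots> = \<theta> (Y v) ?T (pure_tensor hs UNIV (pair_family (Y v) ?T) (case_bool (?x' v) (crossp e (w # vs) Y ?x')))"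
    unfolding kunneth_natural[OF C(1,3,2,4) cv IH(1) z] tz ..
  finally show ?case
    unfolding iterated_prod.simps cross.simps using cont_id by blast
qed

lemma subspace_tensor_degree: "module.subspace (fun_scale (*)) (tensor_degree hs I V n)"
proof -
  interpret T: vector_space "fun_scale (*) :: 'k \<Rightarrow> ('b, int \<Rightarrow> 'm, 'k) tensor \<Rightarrow> ('b, int \<Rightarrow> 'm, 'k) tensor"
    by (rule vector_space_tensor)
  show "T.subspace (tensor_degree hs I V n)" by (simp add: tensor_degree_def)
qed

lemma tensor_degree_subset: "tensor_degree hs I V n \<subseteq> tensor hs I V"
proof -
  interpret T: vector_space "fun_scale (*) :: 'k \<Rightarrow> ('b, int \<Rightarrow> 'm, 'k) tensor \<Rightarrow> ('b, int \<Rightarrow> 'm, 'k) tensor"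
    by (rule vector_space_tensor)
  show ?thesis unfolding tensor_degree_def tensor_def by (rule T.span_mono) blast
qed

lemma pure_tensor_degree:
  assumes "x \<in> Pi\<^sub>E I V" "\<And>i. i \<in> I \<Longrightarrow> homogeneous (d i) (x i)"
  shows "pure_tensor hs I V x \<in> tensor_degree hs I V (\<Sum>i\<in>I. d i)"
proof -
  interpret T: vector_space "fun_scale (*) :: 'k \<Rightarrow> ('b, int \<Rightarrow> 'm, 'k) tensor \<Rightarrow> ('b, int \<Rightarrow> 'm, 'k) tensor"
    by (rule vector_space_tensor)
  show ?thesis
    unfolding tensor_degree_def using assms by (intro T.span_base imageI) auto
qed

text \<open>Since \<open>\<kappa>\<close> preserves degrees on pure tensors, the degree \<open>n\<close> part of \<open>\<kappa> z\<close> comes from the degree \<open>n\<close>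
  part of \<open>z\<close>. For a pure tensor its factors are split into homogeneous parts one at a time.\<close>

lemma tensor_degree_component:
  fixes I :: "'i set"
  assumes I: "finite I"
    and \<kappa>: "lin_on (fun_scale (*)) hs (tensor hs I (\<lambda>i. hstar H (Y i))) W \<kappa>"
    and hom: "\<And>x d. x \<in> Pi\<^sub>E I (\<lambda>i. hstar H (Y i)) \<Longrightarrow> (\<And>i. i \<in> I \<Longrightarrow> homogeneous (d i) (x i)) \<Longrightarrow>
        homogeneous (\<Sum>i\<in>I. d i) (\<kappa> (pure_tensor hs I (\<lambda>i. hstar H (Y i)) x))"
    and z: "z \<in> tensor hs I (\<lambda>i. hstar H (Y i))"
  shows "\<exists>u\<in>tensor_degree hs I (\<lambda>i. hstar H (Y i)) n. \<kappa> u = component n (\<kappa> z)"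
proof -
  interpret T: vector_space "fun_scale (*) :: 'k \<Rightarrow> ('i, int \<Rightarrow> 'm, 'k) tensor \<Rightarrow> ('i, int \<Rightarrow> 'm, 'k) tensor"
    by (rule vector_space_tensor)
  let ?V = "\<lambda>i. hstar H (Y i)"
  let ?D = "tensor_degree hs I ?V n"
  have D: "0 \<in> ?D" "\<And>u u'. u \<in> ?D \<Longrightarrow> u' \<in> ?D \<Longrightarrow> u + u' \<in> ?D" "\<And>c u. u \<in> ?D \<Longrightarrow> fun_scale (*) c u \<in> ?D"
    using subspace_tensor_degree[of I ?V n] by (auto simp: T.subspace_def)
  have DT: "u \<in> tensor hs I ?V" if "u \<in> ?D" for u using that tensor_degree_subset by blast
  define good where "good w \<longleftrightarrow> (\<exists>u\<in>?D. \<kappa> u = component n w)" for w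
  have good_add: "good (\<kappa> z + \<kappa> z')" if g: "good (\<kappa> z)" "good (\<kappa> z')" for z z'
  proof -
    obtain u u' where u: "u \<in> ?D" "\<kappa> u = component n (\<kappa> z)" "u' \<in> ?D" "\<kappa> u' = component n (\<kappa> z')"
      using g by (auto simp: good_def)
    then have "\<kappa> (u + u') = component n (\<kappa> z + \<kappa> z')"
      by (simp add: lin_on_add[OF \<kappa>] DT component_add)
    then show ?thesis unfolding good_def using D(2) u by blast
  qed
  \<comment> \<open>\<open>J\<close> is the set of factors that may still be inhomogeneous\<close>
  have good_pure: "good (\<kappa> (pure_tensor hs I ?V x))"
    if "finite J" "J \<subseteq> I" "x \<in> Pi\<^sub>E I ?V" "\<And>i. i \<in> I - J \<Longrightarrow> \<exists>d. homogeneous d (x i)" for J x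
    using that
  proof (induct J arbitrary: x)
    case empty
    then have "\<forall>i\<in>I. \<exists>d. homogeneous d (x i)" by auto
    then obtain d where d: "\<And>i. i \<in> I \<Longrightarrow> homogeneous (d i) (x i)" by metis
    have h: "homogeneous (\<Sum>i\<in>I. d i) (\<kappa> (pure_tensor hs I ?V x))"
      by (rule hom[OF empty(2) d])
    show ?case
    proof (cases "(\<Sum>i\<in>I. d i) = n")
      case True
      then show ?thesis
        using pure_tensor_degree[OF empty(2) d] component_eq[OF h] unfolding good_def by metis
    next
      case False
      then have "component n (\<kappa> (pure_tensor hs I ?V x)) = 0" using component_other[OF h] by auto
      moreover have "\<kappa> 0 = 0" by (rule lin_on_zero[OF \<kappa> tensor_zero])
      ultimately show ?thesis unfolding good_def using D(1) by metis
    qed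
  next
    case (insert j J)
    have j: "j \<in> I" using insert.prems by simp
    have upd: "x(j := y) \<in> Pi\<^sub>E I ?V" if "y \<in> ?V j" for y
      using insert.prems(2) that j by (auto simp: PiE_iff extensional_def)
    have homj: "good (\<kappa> (pure_tensor hs I ?V (x(j := y))))" if "y \<in> ?V j" "homogeneous d y" for y d
      by (rule insert.hyps(3)[OF _ upd[OF that(1)]]) (use insert.prems that in auto)
    have "good (\<kappa> (pure_tensor hs I ?V (x(j := y))))" if "y \<in> ?V j" for y
      using that
    proof (induct rule: hstar_induct)
      case zero
      show ?case
        by (rule homj[OF hstar_zero, of 0]) (simp add: homogeneous_def zero_fun_apply)
    next
      case (homogeneous m y)
      then show ?case by (rule homj)
    next
      case (add y y')
      have "pure_tensor hs I ?V (x(j := y + y')) = pure_tensor hs I ?V (x(j := y)) + pure_tensor hs I ?V (x(j := y'))"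
        using multilinear_pure_tensor[of hs I ?V] insert.prems(2) j add(1,2)
        unfolding multilinear_on_def by blast
      then have "\<kappa> (pure_tensor hs I ?V (x(j := y + y'))) =
          \<kappa> (pure_tensor hs I ?V (x(j := y))) + \<kappa> (pure_tensor hs I ?V (x(j := y')))"
        using lin_on_add[OF \<kappa> pure_tensor_mem[OF upd[OF add(1)]] pure_tensor_mem[OF upd[OF add(2)]]] by metis
      then show ?case using good_add[OF add(3,4)] by metis
    qed
    from this[of "x j"] show ?case using insert.prems(2) j by (auto simp: PiE_iff)
  qed
  have "good (\<kappa> z)"
    using z
  proof (induct rule: tensor_induct)
    case (pure x)
    show ?case by (rule good_pure[OF I order_refl pure]) simp
  next
    case zero
    have "\<kappa> 0 = 0" by (rule lin_on_zero[OF \<kappa> tensor_zero])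
    then show ?case unfolding good_def using D(1) component_zero by metis
  next
    case (add z w)
    then show ?case using good_add[OF add(3,4)] lin_on_add[OF \<kappa> add(1,2)] by metis
  next
    case (scale c z)
    then obtain u where u: "u \<in> ?D" "\<kappa> u = component n (\<kappa> z)" by (auto simp: good_def)
    then have "\<kappa> (fun_scale (*) c u) = component n (\<kappa> (fun_scale (*) c z))"
      using lin_on_scale[OF \<kappa> DT[OF u(1)], of c] lin_on_scale[OF \<kappa> scale(1), of c] component_scale by metis
    then show ?case unfolding good_def using D(3) u by blast
  qed
  then show ?thesis by (simp add: good_def)
qed

lemma homogeneous_kunneth:
  assumes deg: "kunneth_degree_preserving sc H C \<theta>" and C: "X \<in> C" "Y \<in> C"
    and a: "a \<in> hstar H X" "homogeneous m a" and b: "b \<in> hstar H Y" "homogeneous n b"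
  shows "homogeneous (m + n) (\<theta> X Y (pure_tensor hs UNIV (pair_family X Y) (case_bool a b)))"
proof -
  have "homogeneous (case_bool m n i) (case_bool a b i)" for i
    using a b by (cases i) auto
  then have "pure_tensor hs UNIV (pair_family X Y) (case_bool a b) \<in>
      tensor_degree hs UNIV (pair_family X Y) (\<Sum>i\<in>UNIV. case_bool m n i)"
    using pair_family_mem[OF a(1) b(1)] by (intro pure_tensor_degree)
  then show ?thesis
    using deg C by (simp add: kunneth_degree_preserving_def UNIV_bool add.commute)
qed

lemma homogeneous_cross:
  assumes deg: "kunneth_degree_preserving sc H C \<theta>"
    and "distinct vs" "\<And>v. v \<in> set vs \<Longrightarrow> Y v \<in> C"
    and "vs = [] \<Longrightarrow> homogeneous 0 e"
    and "\<And>v. v \<in> set vs \<Longrightarrow> x v \<in> hstar H (Y v)" "\<And>v. v \<in> set vs \<Longrightarrow> homogeneous (d v) (x v)"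
  shows "homogeneous (\<Sum>v\<in>set vs. d v) (crossp e vs Y x)"
  using assms(2-)
proof (induct vs rule: induct_list012)
  case (3 v w vs)
  have IH: "homogeneous (\<Sum>v\<in>set (w # vs). d v) (crossp e (w # vs) Y x)"
    by (rule 3(2)) (use 3(3-) in auto)
  have univ: "universal_multilinear hs hs (set (w # vs)) (\<lambda>v. hstar H (Y v)) (hstar H (iter (w # vs) Y))
      (crossp e (w # vs) Y)"
    by (rule universal_cross) (use 3(3,4) in auto)
  have "restrict x (set (w # vs)) \<in> Pi\<^sub>E (set (w # vs)) (\<lambda>v. hstar H (Y v))"
    using 3(6) by auto
  from universal_multilinear_mem[OF univ vector_space_hs this]
  have mem: "crossp e (w # vs) Y x \<in> hstar H (iter (w # vs) Y)"
    by (subst cross_cong[of "w # vs" x "restrict x (set (w # vs))"]) auto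
  have "homogeneous (d v + (\<Sum>v\<in>set (w # vs). d v)) (crossp e (v # w # vs) Y x)"
    unfolding cross.simps
    by (rule homogeneous_kunneth[OF deg _ _ _ _ mem IH])
      (use 3(4,6,7) iterated_prod_closed[of "w # vs" Y] in simp_all)
  moreover have "(\<Sum>v\<in>set (v # w # vs). d v) = d v + (\<Sum>v\<in>set (w # vs). d v)"
    using 3(3) by (subst list.set(2)) (rule sum.insert, auto)
  ultimately show ?case by metis
qed auto

text \<open>A one-dimensional \<open>h\<^sup>*(pt)\<close> is concentrated in one degree \<open>d\<close>, and the Kuenneth isomorphism for
  two points forces \<open>2 d = d\<close>.\<close>

lemma homogeneous_unit:
  assumes deg: "kunneth_degree_preserving sc H C \<theta>" and E: "topspace E = {a}"
    and \<eta>: "lin_iso (*) hs UNIV (hstar H E) \<eta>"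
  shows "homogeneous 0 (\<eta> 1)"
proof -
  let ?e = "\<eta> 1"
  have lin: "lin_on (*) hs UNIV (hstar H E) \<eta>" and bij: "bij_betw \<eta> UNIV (hstar H E)"
    using \<eta> by (auto simp: lin_iso_def)
  have \<eta>c: "\<eta> c = hs c ?e" for c using lin_on_scale[OF lin, of 1 c] by simp
  have e: "?e \<in> hstar H E" using lin by (auto simp: lin_on_def)
  have "\<eta> 0 = 0" by (rule lin_on_zero[OF lin]) simp
  then have "?e \<noteq> 0" using bij by (metis UNIV_I bij_betw_def inj_on_def zero_neq_one)
  then obtain d where d: "?e d \<noteq> 0" by (auto simp: fun_eq_iff zero_fun_apply)
  obtain c where c: "component d ?e = hs c ?e"
    using component_mem[OF e, of d] bij \<eta>c by (metis bij_betw_def imageE)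
  have "c \<noteq> 0"
  proof
    assume "c = 0"
    then have "component d ?e d = 0" using c by (simp add: fun_scale_def)
    then show False using d by (simp add: component_def single_def)
  qed
  have hd: "homogeneous d x" if x: "x \<in> hstar H E" for x
  proof -
    obtain b where "x = hs b ?e" using x bij \<eta>c by (metis bij_betw_def imageE)
    moreover have "?e m = 0" if "m \<noteq> d" for m
      using fun_cong[OF c, of m] that \<open>c \<noteq> 0\<close> by (simp add: component_def single_def fun_scale_def)
    ultimately show ?thesis by (simp add: homogeneous_def fun_scale_def)
  qed
  let ?E2 = "space_prod pr E E"
  have EC: "E \<in> C" using closed_C E by (auto simp: product_closed_def)
  let ?F = "pair_family E E"
  have \<theta>: "lin_iso (fun_scale (*)) hs (tensor hs UNIV ?F) (hstar H ?E2) (\<theta> E E)"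
    by (rule kunneth_iso[OF EC EC])
  then have \<theta>l: "lin_on (fun_scale (*)) hs (tensor hs UNIV ?F) (hstar H ?E2) (\<theta> E E)"
    by (simp add: lin_iso_def)
  have h2: "homogeneous (d + d) (\<theta> E E z)" if "z \<in> tensor hs UNIV ?F" for z
    using that
  proof (induct rule: tensor_induct)
    case (pure x)
    have x: "x = case_bool (x True) (x False)" by (auto simp: fun_eq_iff split: bool.split)
    have "x True \<in> hstar H E" "x False \<in> hstar H E" using pure by (auto simp: PiE_iff split: bool.splits)
    then show ?case
      by (subst x) (intro homogeneous_kunneth[OF deg EC EC] hd)
  next
    case zero
    have "\<theta> E E 0 = 0" by (rule lin_on_zero[OF \<theta>l tensor_zero])
    then show ?case unfolding homogeneous_def by (simp only: zero_fun_apply) simp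
  next
    case (add z w)
    then show ?case by (simp only: lin_on_add[OF \<theta>l add(1,2)]) (simp add: homogeneous_def plus_fun_apply)
  next
    case (scale c z)
    then show ?case by (simp only: lin_on_scale[OF \<theta>l scale(1)]) (simp add: homogeneous_def fun_scale_def)
  qed
  let ?g = "\<lambda>_::'u. a" and ?f = "\<lambda>_::'u. pr (a, a)"
  have top2: "topspace ?E2 = {pr (a, a)}"
    using E by (simp add: topspace_space_prod[OF inj_pr])
  have g: "continuous_map ?E2 E ?g" and f: "continuous_map E ?E2 ?f"
    using E top2 by auto
  let ?y = "hstar_map ind ?E2 E ?g ?e"
  have "hstar_map ind E ?E2 ?f ?y = hstar_map ind E E (?g \<circ> ?f) ?e"
    by (rule hstar_map_comp[OF f g e, symmetric])
  also have "\<dots> = hstar_map ind E E id ?e"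
    by (rule hstar_map_cong[OF _ _ e]) (use E in auto)
  also have "\<dots> = ?e" by (rule hstar_map_id[OF e])
  finally have "?y \<noteq> 0"
    using \<open>?e \<noteq> 0\<close> lin_on_zero[OF lin_on_hstar_map[OF f] hstar_zero] by metis
  moreover have "homogeneous d ?y" by (rule homogeneous_hstar_map[OF g hd[OF e]])
  moreover have "homogeneous (d + d) ?y"
  proof -
    have "?y \<in> \<theta> E E ` tensor hs UNIV ?F"
      using \<theta> hstar_map_mem[OF g e] by (simp add: lin_iso_def bij_betw_def)
    then show ?thesis using h2 by auto
  qed
  ultimately have "d + d = d"
    unfolding homogeneous_def fun_eq_iff zero_fun_apply by metis
  then have "d = 0" by simp
  then show ?thesis using hd[OF e] by simp
qed

end

section \<open>Limits over ordered open covers in total cohomology\<close>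

context cohomology_theory
begin

abbreviation "hrestr X A B \<equiv> hstar_map ind (subtopology X A) (subtopology X B) id"

lemma continuous_restr: "A \<subseteq> B \<Longrightarrow> continuous_map (subtopology X A) (subtopology X B) id"
  using pair_map_restr by (simp add: pair_map_absolute)

lemma hrestr_mem: "A \<subseteq> B \<Longrightarrow> x \<in> hstar H (subtopology X B) \<Longrightarrow> hrestr X A B x \<in> hstar H (subtopology X A)"
  using hstar_map_mem continuous_restr by blast

lemma hrestr_apply: "hrestr X A B x n = restr n X A B (x n)"
  by (simp add: hstar_map_def)

lemma hrestr_single: "A \<subseteq> B \<Longrightarrow> hrestr X A B (single n y) = single n (restr n X A B y)"
  using ind_zero[OF pair_map_restr] by (auto simp: fun_eq_iff hrestr_apply single_def)

text \<open>The passage from single degrees to \<open>h\<^sup>*\<close>. The hypothesis \<open>ext\<close> concerns inhomogeneous families, because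
  the Kuenneth isomorphisms are not assumed to preserve degrees; it is used for families concentrated
  in one degree. Conversely, the solutions in single degrees vanish in almost all degrees because
  they are unique and the poset is finite.\<close>

lemma hstar_ordered_cover_limit:
  fixes G :: "'p::order \<Rightarrow> 'u set"
  assumes P: "finite P"
    and G: "\<And>p. p \<in> P \<Longrightarrow> openin X (G p)"
    and mono: "\<And>p q. p \<in> P \<Longrightarrow> q \<in> P \<Longrightarrow> p \<le> q \<Longrightarrow> G p \<subseteq> G q"
    and Int: "\<And>p q. p \<in> P \<Longrightarrow> q \<in> P \<Longrightarrow> G p \<inter> G q \<subseteq> (\<Union>r\<in>{r\<in>P. r \<le> p \<and> r \<le> q}. G r)"
    and cover: "(\<Union>p\<in>P. G p) = topspace X"
    and ext: "\<And>m \<xi>. m \<in> P \<Longrightarrow> (\<And>p. p \<in> P \<Longrightarrow> p < m \<Longrightarrow> \<xi> p \<in> hstar H (subtopology X (G p))) \<Longrightarrow>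
       (\<And>p q. p \<in> P \<Longrightarrow> q \<in> P \<Longrightarrow> p \<le> q \<Longrightarrow> q < m \<Longrightarrow> hrestr X (G p) (G q) (\<xi> q) = \<xi> p) \<Longrightarrow>
       \<exists>y\<in>hstar H (subtopology X (G m)). \<forall>p\<in>P. p < m \<longrightarrow> hrestr X (G p) (G m) y = \<xi> p"
    and \<xi>: "\<And>p. p \<in> P \<Longrightarrow> \<xi> p \<in> hstar H (subtopology X (G p))"
      "\<And>p q. p \<in> P \<Longrightarrow> q \<in> P \<Longrightarrow> p \<le> q \<Longrightarrow> hrestr X (G p) (G q) (\<xi> q) = \<xi> p"
  shows "\<exists>!y. y \<in> hstar H X \<and> (\<forall>p\<in>P. hstar_map ind (subtopology X (G p)) X id y = \<xi> p)"
proof -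
  have ext_n: "\<exists>y\<in>H n (subtopology X (G m)) {}. \<forall>p\<in>P. p < m \<longrightarrow> restr n X (G p) (G m) y = x p"
    if m: "m \<in> P" and x: "compatible n X G {p\<in>P. p < m} x" for n m x
  proof -
    have "\<exists>y\<in>hstar H (subtopology X (G m)). \<forall>p\<in>P. p < m \<longrightarrow> hrestr X (G p) (G m) y = single n (x p)"
    proof (rule ext[OF m])
      show "single n (x p) \<in> hstar H (subtopology X (G p))" if "p \<in> P" "p < m" for p
        using x that by (auto simp: compatible_def intro: single_mem)
      show "hrestr X (G p) (G q) (single n (x q)) = single n (x p)"
        if "p \<in> P" "q \<in> P" "p \<le> q" "q < m" for p q
        using hrestr_single[OF mono[OF that(1-3)]] x that by (auto simp: compatible_def)
    qed
    then obtain y where y: "y \<in> hstar H (subtopology X (G m))"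
      "\<And>p. p \<in> P \<Longrightarrow> p < m \<Longrightarrow> hrestr X (G p) (G m) y = single n (x p)" by blast
    have "restr n X (G p) (G m) (y n) = x p" if "p \<in> P" "p < m" for p
      using fun_cong[OF y(2)[OF that], of n] by (simp add: hrestr_apply single_def)
    then show ?thesis using hstar_mem[OF y(1)] by blast
  qed
  have degreewise: "\<exists>!y. y \<in> H n X {} \<and> (\<forall>p\<in>P. ind n (subtopology X (G p)) {} X {} id y = x p)"
    if "compatible n X G P x" for n x
  proof -
    have "\<exists>!y. y \<in> H n (subtopology X (\<Union>p\<in>P. G p)) {} \<and>
        (\<forall>p\<in>P. restr n X (G p) (\<Union>p\<in>P. G p) y = x p)"
      by (rule ordered_cover_limit[OF P]) (fact G mono Int ext_n that order_refl | assumption)+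
    then show ?thesis by (simp only: cover subtopology_topspace)
  qed
  have "compatible n X G P (\<lambda>p. \<xi> p n)" for n
    using hstar_mem[OF \<xi>(1)] fun_cong[OF \<xi>(2)] by (simp add: compatible_def hrestr_apply)
  note * = degreewise[OF this]
  then have "\<forall>n. \<exists>y. y \<in> H n X {} \<and> (\<forall>p\<in>P. ind n (subtopology X (G p)) {} X {} id y = \<xi> p n)"
    by blast
  then obtain y where y: "\<And>n. y n \<in> H n X {}"
    "\<And>n p. p \<in> P \<Longrightarrow> ind n (subtopology X (G p)) {} X {} id (y n) = \<xi> p n" by metis
  have "y n = 0" if "\<forall>p\<in>P. \<xi> p n = 0" for n
  proof -
    have "0 \<in> H n X {} \<and> (\<forall>p\<in>P. ind n (subtopology X (G p)) {} X {} id 0 = \<xi> p n)"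
      using zero_mem[of "{}" X n] that
      by (simp add: ind_zero pair_map_absolute continuous_map_from_subtopology)
    with y show ?thesis using Ex1_unique[OF *[of n], of "y n" 0] by blast
  qed
  then have "{n. y n \<noteq> 0} \<subseteq> (\<Union>p\<in>P. {n. \<xi> p n \<noteq> 0})" by auto
  moreover have "finite (\<Union>p\<in>P. {n. \<xi> p n \<noteq> 0})" using P \<xi>(1) by (auto simp: hstar_def)
  ultimately have fin: "finite {n. y n \<noteq> 0}" by (rule finite_subset)
  show ?thesis
  proof (rule ex1I[of _ y])
    show "y \<in> hstar H X \<and> (\<forall>p\<in>P. hstar_map ind (subtopology X (G p)) X id y = \<xi> p)"
      using fin y by (simp add: hstar_def hstar_map_def)
    fix y' assume y': "y' \<in> hstar H X \<and> (\<forall>p\<in>P. hstar_map ind (subtopology X (G p)) X id y' = \<xi> p)"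
    show "y' = y"
    proof
      fix n
      have "ind n (subtopology X (G p)) {} X {} id (y' n) = \<xi> p n" if "p \<in> P" for p
        using y' that by (metis hstar_map_def)
      then show "y' n = y n"
        using Ex1_unique[OF *[of n], of "y' n" "y n"] y hstar_mem y' by blast
    qed
  qed
qed

end

section \<open>The polyhedral product\<close>

definition vertex_space :: "'p::order set \<Rightarrow> ('p \<Rightarrow> 'u topology) \<Rightarrow> ('p \<Rightarrow> 'u set) \<Rightarrow> 'p \<Rightarrow> 'p \<Rightarrow> 'u topology" where
  "vertex_space P X A p v = (if v \<in> vertices_below P p then X v else subtopology (X v) (A v))"

lemma polyhedral_diagram_eq: "polyhedral_diagram P X A p = product_topology (vertex_space P X A p) (vertices P)"
  by (simp add: polyhedral_diagram_def vertex_space_def[abs_def])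

lemma continuous_vertex_space:
  "p \<le> q \<Longrightarrow> continuous_map (vertex_space P X A p v) (vertex_space P X A q v) id"
  using vertices_below_mono[of p q P]
  by (auto simp: vertex_space_def continuous_map_from_subtopology)

text \<open>All values of the diagram are subspaces of the product of the \<open>X v\<close>, so it is a diagram of inclusions.\<close>

lemma polyhedral_diagram_subtopology:
  "polyhedral_diagram P X A p =
   subtopology (product_topology X (vertices P)) (\<Pi>\<^sub>E v\<in>vertices P. topspace (vertex_space P X A p v))"
proof -
  have "subtopology (X v) (topspace (vertex_space P X A p v)) = vertex_space P X A p v" for v
    by (simp add: vertex_space_def subtopology_restrict)
  then show ?thesis
    by (simp add: polyhedral_diagram_eq subtopology_product_topology)
qed

context kunneth_theory
begin

text \<open>The identification of the polyhedral tensor diagram with \<open>h\<^sup>*\<close> of the diagram of products, transported to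
  the universe. A universal multilinear map into \<open>h\<^sup>*\<close> of the product exists at each \<open>p\<close>, and naturality has
  to be checked on cross products only.\<close>

lemma polyhedral_kunneth:
  fixes P :: "'p::order set"
  defines "M \<equiv> \<lambda>X v. hstar H (X v)"
    and "N \<equiv> \<lambda>X A v. hstar H (subtopology (X v) (A v))"
    and "a \<equiv> \<lambda>X A v. hstar_map ind (subtopology (X v) (A v)) (X v) id"
  assumes pairs: "\<And>v. v \<in> vertices P \<Longrightarrow> X v \<in> C \<and> subtopology (X v) (A v) \<in> C"
    and empty: "vertices P = {} \<Longrightarrow> \<exists>\<eta>. lin_iso (*) hs UNIV (hstar H (discrete_topology {undefined})) \<eta>"
    and vs: "set vs = vertices P" "distinct vs"
  obtains \<kappa> where
    "\<And>p. lin_iso (fun_scale (*)) hs (polyhedral_tensor_diagram hs P (M X) (N X A) p)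
            (hstar H (iter vs (vertex_space P X A p))) (\<kappa> p)"
    "\<And>p q. p \<le> q \<Longrightarrow> continuous_map (iter vs (vertex_space P X A p)) (iter vs (vertex_space P X A q)) id"
    "\<And>p q z. p \<le> q \<Longrightarrow> z \<in> polyhedral_tensor_diagram hs P (M X) (N X A) q \<Longrightarrow>
       hstar_map ind (iter vs (vertex_space P X A p)) (iter vs (vertex_space P X A q)) id (\<kappa> q z) =
       \<kappa> p (polyhedral_tensor_map hs P (M X) (N X A) (a X A) p q z)"
    "\<And>p n z. kunneth_degree_preserving sc H C \<theta> \<Longrightarrow> z \<in> polyhedral_tensor_diagram hs P (M X) (N X A) p \<Longrightarrow>
       homogeneous n (\<kappa> p z) \<Longrightarrow>
       z \<in> tensor_degree hs (vertices P) (polyhedral_tensor_family P (M X) (N X A) p) n"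
proof -
  let ?V = "vertices P" and ?Y = "vertex_space P X A"
  let ?M = "M X" and ?N = "N X A" and ?a = "a X A"
  let ?E = "\<lambda>p. iter vs (?Y p)"
  \<comment> \<open>\<open>e\<close> generates \<open>h\<^sup>*(pt)\<close> if there are no vertices\<close>
  obtain e where e: "vs = [] \<Longrightarrow> \<exists>\<eta>. lin_iso (*) hs UNIV (hstar H (discrete_topology {undefined})) \<eta> \<and> e = \<eta> 1"
    using empty vs(1) by (cases "vs = []") auto
  have fam: "polyhedral_tensor_family P ?M ?N p = (\<lambda>v. hstar H (?Y p v))" for p
    by (simp add: fun_eq_iff polyhedral_tensor_family_def vertex_space_def M_def N_def)
  have C: "?Y p v \<in> C" if "v \<in> set vs" for p v
    using pairs that vs(1) by (simp add: vertex_space_def)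
  have univ: "universal_multilinear hs hs ?V (\<lambda>v. hstar H (?Y p v)) (hstar H (?E p)) (crossp e vs (?Y p))" for p
    using universal_cross[OF vs(2) C e] vs(1) by simp
  from universal_multilinear_iso[OF vector_space_hs univ]
  obtain \<kappa> where \<kappa>: "\<And>p. lin_iso (fun_scale (*)) hs (tensor hs ?V (\<lambda>v. hstar H (?Y p v))) (hstar H (?E p)) (\<kappa> p)"
    and \<kappa>_pure: "\<And>p x. x \<in> Pi\<^sub>E ?V (\<lambda>v. hstar H (?Y p v)) \<Longrightarrow>
        \<kappa> p (pure_tensor hs ?V (\<lambda>v. hstar H (?Y p v)) x) = crossp e vs (?Y p) x"
    by metis
  have \<kappa>_lin: "lin_on (fun_scale (*)) hs (tensor hs ?V (\<lambda>v. hstar H (?Y p v))) (hstar H (?E p)) (\<kappa> p)" for p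
    using \<kappa> by (simp add: lin_iso_def)
  have natural: "continuous_map (?E p) (?E q) id \<and> hstar_map ind (?E p) (?E q) id (crossp e vs (?Y q) x) =
      crossp e vs (?Y p) (\<lambda>v. hstar_map ind (?Y p v) (?Y q v) id (x v))"
    if pq: "p \<le> q" and x: "\<And>v. v \<in> set vs \<Longrightarrow> x v \<in> hstar H (?Y q v)" for p q x
    by (rule cross_natural[OF vs(2)]) (erule C | rule continuous_vertex_space[OF pq] | erule e | erule x)+
  have cont: "continuous_map (?E p) (?E q) id" if pq: "p \<le> q" for p q
    using natural[OF pq, of "\<lambda>_. 0"] hstar_zero by blast
  have nat: "hstar_map ind (?E p) (?E q) id (\<kappa> q z) = \<kappa> p (polyhedral_tensor_map hs P ?M ?N ?a p q z)"
    if pq: "p \<le> q" and z: "z \<in> tensor hs ?V (\<lambda>v. hstar H (?Y q v))" for p q z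
  proof -
    let ?f = "\<lambda>v. if v \<in> vertices_below P p then id else if v \<in> vertices_below P q then ?a v else id"
    have f: "?f v y = hstar_map ind (?Y p v) (?Y q v) id y" if "y \<in> hstar H (?Y q v)" for v y
      using that vertices_below_mono[OF pq] hstar_map_id
      by (auto simp: vertex_space_def a_def simp del: id_apply) (auto simp: hstar_map_id)
    have f_lin: "lin_on hs hs (hstar H (?Y q v)) (hstar H (?Y p v)) (?f v)" for v
      by (rule lin_on_cong[OF vector_space_hs subspace_hstar
            lin_on_hstar_map[OF continuous_vertex_space[OF pq, of P X A v]] f])
    have ptm: "polyhedral_tensor_map hs P ?M ?N ?a p q = tensor_map hs ?V (\<lambda>v. hstar H (?Y p v)) ?f"
      by (simp add: polyhedral_tensor_map_def fam)
    have "(hstar_map ind (?E p) (?E q) id \<circ> \<kappa> q) z = (\<kappa> p \<circ> tensor_map hs ?V (\<lambda>v. hstar H (?Y p v)) ?f) z"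
    proof (rule lin_on_tensor_eqI[OF lin_on_compose[OF \<kappa>_lin lin_on_hstar_map[OF cont[OF pq]]]
            lin_on_compose[OF lin_on_tensor_map[OF f_lin] \<kappa>_lin] _ z])
      fix x assume x: "x \<in> Pi\<^sub>E ?V (\<lambda>v. hstar H (?Y q v))"
      have fx: "(\<lambda>v\<in>?V. ?f v (x v)) \<in> Pi\<^sub>E ?V (\<lambda>v. hstar H (?Y p v))"
        using x lin_on_mem[OF f_lin] by (simp add: PiE_iff)
      have tm: "tensor_map hs ?V (\<lambda>v. hstar H (?Y p v)) ?f (pure_tensor hs ?V (\<lambda>v. hstar H (?Y q v)) x) =
          pure_tensor hs ?V (\<lambda>v. hstar H (?Y p v)) (\<lambda>v\<in>?V. ?f v (x v))"
        by (rule tensor_map_pure[OF f_lin x])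
      have "crossp e vs (?Y p) (\<lambda>v. hstar_map ind (?Y p v) (?Y q v) id (x v)) =
            crossp e vs (?Y p) (\<lambda>v\<in>?V. ?f v (x v))"
      proof (rule cross_cong)
        fix v assume "v \<in> set vs"
        then have v: "v \<in> ?V" "x v \<in> hstar H (?Y q v)" using vs(1) x by (auto simp: PiE_iff)
        show "hstar_map ind (?Y p v) (?Y q v) id (x v) = (\<lambda>v\<in>?V. ?f v (x v)) v"
          unfolding restrict_apply'[OF v(1)] f[OF v(2)] ..
      qed
      moreover have "hstar_map ind (?E p) (?E q) id (crossp e vs (?Y q) x) =
          crossp e vs (?Y p) (\<lambda>v. hstar_map ind (?Y p v) (?Y q v) id (x v))"
        using natural[OF pq, of x] x vs(1) by (simp only: PiE_iff)
      ultimately show "(hstar_map ind (?E p) (?E q) id \<circ> \<kappa> q) (pure_tensor hs ?V (\<lambda>v. hstar H (?Y q v)) x) =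
          (\<kappa> p \<circ> tensor_map hs ?V (\<lambda>v. hstar H (?Y p v)) ?f) (pure_tensor hs ?V (\<lambda>v. hstar H (?Y q v)) x)"
        unfolding comp_def tm \<kappa>_pure[OF x] \<kappa>_pure[OF fx] by metis
    qed
    then show ?thesis by (simp add: ptm)
  qed
  have deg: "z \<in> tensor_degree hs ?V (\<lambda>v. hstar H (?Y p v)) n"
    if kd: "kunneth_degree_preserving sc H C \<theta>" and z: "z \<in> tensor hs ?V (\<lambda>v. hstar H (?Y p v))"
      and hom: "homogeneous n (\<kappa> p z)" for p n z
  proof -
    have "homogeneous 0 e" if "vs = []"
      using e[OF that] homogeneous_unit[OF kd, of "discrete_topology {undefined}" undefined] by auto
    then have "homogeneous (\<Sum>v\<in>?V. d v) (\<kappa> p (pure_tensor hs ?V (\<lambda>v. hstar H (?Y p v)) x))"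
      if x: "x \<in> Pi\<^sub>E ?V (\<lambda>v. hstar H (?Y p v))" and d: "\<And>v. v \<in> ?V \<Longrightarrow> homogeneous (d v) (x v)" for x d
      unfolding \<kappa>_pure[OF x] unfolding vs(1)[symmetric]
      by (intro homogeneous_cross[OF kd vs(2) C]) (use x d vs(1) in \<open>auto simp: PiE_iff\<close>)
    then obtain u where u: "u \<in> tensor_degree hs ?V (\<lambda>v. hstar H (?Y p v)) n" "\<kappa> p u = component n (\<kappa> p z)"
      using tensor_degree_component[OF _ \<kappa>_lin _ z, of n] vs(1) by (metis List.finite_set)
    then have "\<kappa> p u = \<kappa> p z" using component_eq[OF hom] by simp
    moreover have "u \<in> tensor hs ?V (\<lambda>v. hstar H (?Y p v))" using u(1) tensor_degree_subset by blast
    ultimately have "u = z"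
      using \<kappa>[of p] z unfolding lin_iso_def bij_betw_def by (blast dest: inj_onD)
    then show ?thesis using u(1) by simp
  qed
  show thesis
    by (rule that[of \<kappa>]) (use \<kappa> cont nat deg in \<open>simp_all add: polyhedral_tensor_diagram_def fam\<close>)
qed

end

theorem theorem3:
  fixes sc :: "'k::field \<Rightarrow> 'm::ab_group_add \<Rightarrow> 'm"
    and H :: "int \<Rightarrow> 'u topology \<Rightarrow> 'u set \<Rightarrow> 'm set"
    and ind :: "int \<Rightarrow> 'u topology \<Rightarrow> 'u set \<Rightarrow> 'u topology \<Rightarrow> 'u set \<Rightarrow> ('u \<Rightarrow> 'u) \<Rightarrow> 'm \<Rightarrow> 'm"
    and bd :: "int \<Rightarrow> 'u topology \<Rightarrow> 'u set \<Rightarrow> 'm \<Rightarrow> 'm"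
    and pr :: "'u \<times> 'u \<Rightarrow> 'u"
    and C :: "'u topology set"
    and \<theta> :: "'u topology \<Rightarrow> 'u topology \<Rightarrow> (bool, int \<Rightarrow> 'm, 'k) tensor \<Rightarrow> int \<Rightarrow> 'm"
    and P :: "'p::order set"
    and X :: "'p \<Rightarrow> 'u topology" and A :: "'p \<Rightarrow> 'u set"
    and Z :: "'u topology"
  defines "M \<equiv> \<lambda>v. hstar H (X v)"
    and "N \<equiv> \<lambda>v. hstar H (subtopology (X v) (A v))"
    and "a \<equiv> \<lambda>v. hstar_map ind (subtopology (X v) (A v)) (X v) id"
  assumes poset: "finite P" "pointed P" "lower_saturated P"
    and theory_h: "cohomology_theory sc H ind bd"
    and kunneth: "inj pr" "product_closed pr C" "strong_kunneth sc H ind pr C \<theta>"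
    \<comment> \<open>the empty case of the Kuenneth formula, relevant only if there are no vertices\<close>
    and kunneth_empty: "\<And>E e. \<lbrakk>vertices P = {}; topspace E = {e}\<rbrakk> \<Longrightarrow>
        \<exists>\<eta>. lin_iso (*) (fun_scale sc) UNIV (hstar H E) \<eta>"
    and pairs: "\<And>v. v \<in> vertices P \<Longrightarrow>
        A v \<subseteq> topspace (X v) \<and> X v \<in> C \<and> subtopology (X v) (A v) \<in> C"
    and sections: "\<And>v. v \<in> vertices P \<Longrightarrow>
        \<exists>\<sigma>. lin_on (fun_scale sc) (fun_scale sc) (N v) (M v) \<sigma> \<and> (\<forall>y\<in>N v. a v (\<sigma> y) = y)"
    and Z: "Z homeomorphic_space polyhedral_product P X A"
  shows "\<exists>\<Phi>. lin_iso (fun_scale sc) (fun_scale (fun_scale (*)))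
            (hstar H Z) (polyhedral_tensor_product (fun_scale sc) P M N a) \<Phi> \<and>
          (kunneth_degree_preserving sc H C \<theta> \<longrightarrow>
            (\<forall>n. \<forall>x\<in>hstar H Z. homogeneous n x \<longrightarrow>
              (\<forall>p\<in>P. \<Phi> x p \<in> tensor_degree (fun_scale sc) (vertices P)
                                (polyhedral_tensor_family P M N p) n)))"
proof -
  interpret kunneth_theory sc H ind bd pr C \<theta>
    using theory_h kunneth by (simp add: kunneth_theory_def kunneth_theory_axioms_def)
  let ?V = "vertices P" and ?W = "product_topology X (vertices P)" and ?Y = "vertex_space P X A"
  define T where "T p = polyhedral_tensor_diagram hs P M N p" for p
  define \<rho> where "\<rho> p q = polyhedral_tensor_map hs P M N a p q" for p q
  obtain vs where vs: "set vs = ?V" "distinct vs"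
    using finite_distinct_list[of ?V] poset(1) by (auto simp: vertices_def)
  define E where "E p = iterated_prod pr vs (?Y p)" for p
  have M': "(\<lambda>v. hstar H (X v)) = M" and N': "(\<lambda>v. hstar H (subtopology (X v) (A v))) = N"
    and a': "(\<lambda>v. hstar_map ind (subtopology (X v) (A v)) (X v) id) = a"
    by (simp_all add: M_def N_def a_def)
  have pt: "\<exists>\<eta>. lin_iso (*) hs UNIV (hstar H (discrete_topology {undefined})) \<eta>" if "?V = {}"
    by (rule kunneth_empty[OF that]) simp
  obtain \<kappa> where \<kappa>: "\<And>p. lin_iso (fun_scale (*)) hs (T p) (hstar H (E p)) (\<kappa> p)"
    and contE: "\<And>p q. p \<le> q \<Longrightarrow> continuous_map (E p) (E q) id"
    and \<kappa>_nat: "\<And>p q z. p \<le> q \<Longrightarrow> z \<in> T q \<Longrightarrow> hstar_map ind (E p) (E q) id (\<kappa> q z) = \<kappa> p (\<rho> p q z)"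
    and \<kappa>_deg: "\<And>p n z. kunneth_degree_preserving sc H C \<theta> \<Longrightarrow> z \<in> T p \<Longrightarrow> homogeneous n (\<kappa> p z) \<Longrightarrow>
       z \<in> tensor_degree hs ?V (polyhedral_tensor_family P M N p) n"
    using polyhedral_kunneth[of P X A vs, OF _ pt vs, unfolded M' N' a', folded T_def \<rho>_def E_def] pairs
    by metis
  define B where "B p = (\<Pi>\<^sub>E v\<in>?V. topspace (?Y p v))" for p
  have F: "polyhedral_diagram P X A = (\<lambda>p. subtopology ?W (B p))"
    by (simp add: fun_eq_iff polyhedral_diagram_subtopology B_def)
  have B_top: "B p \<subseteq> topspace ?W" for p
    by (auto simp: B_def vertex_space_def PiE_iff split: if_splits)
  have B_mono: "B p \<subseteq> B q" if "p \<le> q" for p q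
    unfolding B_def using vertices_below_mono[OF that, of P] by (intro PiE_mono) (auto simp: vertex_space_def)
  have Y: "product_topology (?Y p) ?V = subtopology ?W (B p)" for p
    by (simp add: polyhedral_diagram_subtopology B_def flip: polyhedral_diagram_eq)
  have Zh: "Z homeomorphic_space hocolim P (\<lambda>p. subtopology ?W (B p)) (\<lambda>p q. id)"
    using Z by (simp add: polyhedral_product_def F)
  obtain k where "quotient_map (hocolim_sum P (\<lambda>p. subtopology ?W (B p))) Z k"
    "\<And>c d. c \<in> topspace (hocolim_sum P (\<lambda>p. subtopology ?W (B p))) \<Longrightarrow>
       d \<in> topspace (hocolim_sum P (\<lambda>p. subtopology ?W (B p))) \<Longrightarrow> k c = k d \<longleftrightarrow> snd c = snd d"
    using hocolim_inclusions_quotient_map[OF poset(1) Zh] by blast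
  then interpret inclusion_hocolim P ?W B Z k
    using poset(1) B_top B_mono by unfold_locales auto
  let ?S = "\<lambda>p. subtopology Z (star p)"
  define j where "j p = incl p \<circ> decode pr vs" for p
  have dec: "continuous_map (E p) (subtopology ?W (B p)) (decode pr vs)" for p
    using continuous_decode[of pr vs "?Y p"] by (simp add: E_def vs(1) Y)
  have enc: "continuous_map (subtopology ?W (B p)) (E p) (encode pr vs)" for p
    using continuous_encode[OF inj_pr, of vs ?V "?Y p"] by (simp add: E_def vs(1) Y)
  have dec_B: "decode pr vs u \<in> B p" if "u \<in> topspace (E p)" for u p
    using continuous_map_image_subset_topspace[OF dec] that by fastforce
  have cont_j: "continuous_map (E p) (?S p) (j p)" if "p \<in> P" for p
    unfolding j_def by (rule continuous_map_compose[OF dec continuous_incl[OF that]])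
  have cont_g: "continuous_map (?S p) (E p) (encode pr vs \<circ> proj)" if "p \<in> P" for p
    by (rule continuous_map_compose[OF continuous_proj[OF that] enc])
  have J: "lin_iso hs hs (hstar H (?S p)) (hstar H (E p)) (hstar_map ind (E p) (?S p) (j p))" if p: "p \<in> P" for p
  proof (rule hstar_map_homotopy_equivalence[OF cont_j[OF p] cont_g[OF p]])
    show "homotopic_with (\<lambda>_. True) (E p) (E p) ((encode pr vs \<circ> proj) \<circ> j p) id"
    proof (rule homotopic_with_equal)
      show "continuous_map (E p) (E p) ((encode pr vs \<circ> proj) \<circ> j p)"
        by (rule continuous_map_compose[OF cont_j[OF p] cont_g[OF p]])
      show "((encode pr vs \<circ> proj) \<circ> j p) u = id u" if "u \<in> topspace (E p)" for u
        using proj_incl[OF p dec_B[OF that]] encode_decode[OF inj_pr vs(2)] that by (simp add: j_def E_def)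
    qed auto
    have "homotopic_with (\<lambda>_. True) (?S p) (?S p) (j p \<circ> (encode pr vs \<circ> proj)) (incl p \<circ> proj)"
    proof (rule homotopic_with_equal)
      show "continuous_map (?S p) (?S p) (j p \<circ> (encode pr vs \<circ> proj))"
        by (rule continuous_map_compose[OF cont_g[OF p] cont_j[OF p]])
      fix z assume "z \<in> topspace (?S p)"
      then have "proj z \<in> B p"
        using continuous_map_image_subset_topspace[OF continuous_proj[OF p]] by fastforce
      then have "proj z \<in> extensional (set vs)" by (simp add: B_def vs(1) PiE_iff)
      then show "(j p \<circ> (encode pr vs \<circ> proj)) z = (incl p \<circ> proj) z"
        using decode_encode[OF inj_pr vs(2)] by (simp add: j_def)
    qed auto
    then show "homotopic_with (\<lambda>_. True) (?S p) (?S p) (j p \<circ> (encode pr vs \<circ> proj)) id"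
      using homotopic_with_symD[OF incl_proj_homotopic[OF p]] by (rule homotopic_with_trans)
  qed
  have J_nat: "hstar_map ind (E p) (?S p) (j p) (hrestr Z (star p) (star q) x) =
      hstar_map ind (E p) (E q) id (hstar_map ind (E q) (?S q) (j q) x)"
    if pq: "p \<in> P" "q \<in> P" "p \<le> q" and x: "x \<in> hstar H (?S q)" for p q x
  proof -
    have "homotopic_with (\<lambda>_. True) (E p) (?S q) (j p) (j q)"
      unfolding j_def
      by (rule homotopic_with_compose_continuous_map_right[OF incl_homotopic[OF pq] dec]) simp
    then have "hstar_map ind (E p) (?S q) (j p) x = hstar_map ind (E p) (?S q) (j q) x"
      by (rule hstar_map_homotopic[OF _ x])
    then show ?thesis
      using hstar_map_comp[OF cont_j[OF pq(1)] continuous_restr[OF star_mono[OF pq(3)]] x]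
        hstar_map_comp[OF contE[OF pq(3)] cont_j[OF pq(2)] x] by simp
  qed
  have T_sub: "module.subspace (fun_scale (*)) (T p)" for p
    unfolding T_def polyhedral_tensor_diagram_def by (rule subspace_tensor)
  have a_lin: "lin_on hs hs (M v) (N v) (a v)" for v
    unfolding M_def N_def a_def by (rule lin_on_hstar_map) (simp add: continuous_map_from_subtopology)
  have \<rho>_lin: "lin_on (fun_scale (*)) (fun_scale (*)) (T q) (T p) (\<rho> p q)" if "p \<le> q" for p q
    unfolding T_def \<rho>_def by (rule lin_on_polyhedral_tensor_map[OF that a_lin])
  \<comment> \<open>the natural isomorphism from \<open>h\<^sup>*\<close> of the cover to the tensor diagram\<close>
  define \<Lambda> where "\<Lambda> p = inv_into (T p) (\<kappa> p) \<circ> hstar_map ind (E p) (?S p) (j p)" for p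
  have \<Lambda>: "lin_iso hs (fun_scale (*)) (hstar H (?S p)) (T p) (\<Lambda> p)" if "p \<in> P" for p
    unfolding \<Lambda>_def by (rule lin_iso_compose[OF J[OF that] lin_iso_inverse[OF \<kappa> vector_space_tensor T_sub]])
  then have \<Lambda>_lin: "lin_on hs (fun_scale (*)) (hstar H (?S p)) (T p) (\<Lambda> p)"
    and \<Lambda>_bij: "bij_betw (\<Lambda> p) (hstar H (?S p)) (T p)" if "p \<in> P" for p
    using that by (auto simp: lin_iso_def)
  have \<kappa>_inj: "inj_on (\<kappa> p) (T p)" for p
    using \<kappa>[of p] by (simp add: lin_iso_def bij_betw_def)
  have \<Lambda>_mem: "\<Lambda> p x \<in> T p" if "p \<in> P" "x \<in> hstar H (?S p)" for p x
    using lin_on_mem[OF \<Lambda>_lin[OF that(1)] that(2)] .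
  have \<kappa>\<Lambda>: "\<kappa> p (\<Lambda> p x) = hstar_map ind (E p) (?S p) (j p) x" if "p \<in> P" "x \<in> hstar H (?S p)" for p x
  proof -
    have "bij_betw (\<kappa> p) (T p) (hstar H (E p))" using \<kappa> by (simp add: lin_iso_def)
    then show ?thesis
      using hstar_map_mem[OF cont_j[OF that(1)] that(2)] by (simp add: \<Lambda>_def bij_betw_inv_into_right)
  qed
  have \<Lambda>_nat: "\<Lambda> p (hrestr Z (star p) (star q) x) = \<rho> p q (\<Lambda> q x)"
    if pq: "p \<in> P" "q \<in> P" "p \<le> q" and x: "x \<in> hstar H (?S q)" for p q x
  proof (rule inj_onD[OF \<kappa>_inj])
    have r: "hrestr Z (star p) (star q) x \<in> hstar H (?S p)"
      by (rule hrestr_mem[OF star_mono[OF pq(3)] x])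
    show "\<Lambda> p (hrestr Z (star p) (star q) x) \<in> T p" by (rule \<Lambda>_mem[OF pq(1) r])
    show "\<rho> p q (\<Lambda> q x) \<in> T p" by (rule lin_on_mem[OF \<rho>_lin[OF pq(3)] \<Lambda>_mem[OF pq(2) x]])
    show "\<kappa> p (\<Lambda> p (hrestr Z (star p) (star q) x)) = \<kappa> p (\<rho> p q (\<Lambda> q x))"
      unfolding \<kappa>\<Lambda>[OF pq(1) r] J_nat[OF pq x] \<kappa>\<Lambda>[OF pq(2) x, symmetric]
      by (rule \<kappa>_nat[OF pq(3) \<Lambda>_mem[OF pq(2) x]])
  qed
  have extend: "\<exists>y\<in>hstar H (?S m). \<forall>p\<in>P. p < m \<longrightarrow> hrestr Z (star p) (star m) y = \<xi> p"
    if m: "m \<in> P" and mem: "\<And>p. p \<in> P \<Longrightarrow> p < m \<Longrightarrow> \<xi> p \<in> hstar H (?S p)"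
      and compat: "\<And>p q. p \<in> P \<Longrightarrow> q \<in> P \<Longrightarrow> p \<le> q \<Longrightarrow> q < m \<Longrightarrow> hrestr Z (star p) (star q) (\<xi> q) = \<xi> p"
    for m \<xi>
  proof -
    have "\<exists>t\<in>polyhedral_tensor_diagram hs P M N m.
        \<forall>p\<in>P. p < m \<longrightarrow> polyhedral_tensor_map hs P M N a p m t = \<Lambda> p (\<xi> p)"
    proof (rule polyhedral_tensor_extension[OF poset(1,3) m a_lin sections])
      show "\<Lambda> p (\<xi> p) \<in> polyhedral_tensor_diagram hs P M N p" if "p \<in> P" "p < m" for p
        using \<Lambda>_mem mem that by (simp add: T_def)
      show "polyhedral_tensor_map hs P M N a p q (\<Lambda> q (\<xi> q)) = \<Lambda> p (\<xi> p)"
        if "p \<in> P" "q \<in> P" "p \<le> q" "q < m" for p q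
        using \<Lambda>_nat[OF that(1-3) mem[OF that(2,4)]] compat[OF that] by (simp add: \<rho>_def)
    qed
    then obtain t where t: "t \<in> T m" "\<And>p. p \<in> P \<Longrightarrow> p < m \<Longrightarrow> \<rho> p m t = \<Lambda> p (\<xi> p)"
      by (auto simp: T_def \<rho>_def)
    then have "t \<in> \<Lambda> m ` hstar H (?S m)" using \<Lambda>_bij[OF m] by (simp add: bij_betw_def)
    then obtain y where y: "y \<in> hstar H (?S m)" "\<Lambda> m y = t" by auto
    have "hrestr Z (star p) (star m) y = \<xi> p" if p: "p \<in> P" "p < m" for p
    proof (rule inj_onD[OF bij_betw_imp_inj_on[OF \<Lambda>_bij[OF p(1)]]])
      show "\<Lambda> p (hrestr Z (star p) (star m) y) = \<Lambda> p (\<xi> p)"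
        using \<Lambda>_nat[OF p(1) m less_imp_le[OF p(2)] y(1)] t(2)[OF p] y(2) by simp
    qed (use hrestr_mem[OF star_mono[OF less_imp_le[OF p(2)]] y(1)] mem p in auto)
    then show ?thesis using y(1) by blast
  qed
  have limit: "\<exists>!y. y \<in> hstar H Z \<and> (\<forall>p\<in>P. hstar_map ind (?S p) Z id y = \<xi> p)"
    if \<xi>: "\<And>p. p \<in> P \<Longrightarrow> \<xi> p \<in> hstar H (?S p)"
      "\<And>p q. p \<in> P \<Longrightarrow> q \<in> P \<Longrightarrow> p \<le> q \<Longrightarrow> hrestr Z (star p) (star q) (\<xi> q) = \<xi> p" for \<xi>
    by (rule hstar_ordered_cover_limit[OF poset(1) openin_star star_mono star_Int star_cover]) (fact extend \<xi> | assumption)+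
  let ?R = "\<lambda>p. hstar_map ind (?S p) Z id"
  have cont_R: "continuous_map (?S p) Z id" for p by (simp add: continuous_map_from_subtopology)
  have R_mem: "?R p x \<in> hstar H (?S p)" if "x \<in> hstar H Z" for p x
    by (rule hstar_map_mem[OF cont_R that])
  have R_comp: "hrestr Z (star p) (star q) (?R q x) = ?R p x" if "p \<le> q" "x \<in> hstar H Z" for p q x
    using hstar_map_comp[OF continuous_restr[OF star_mono[OF that(1)]] cont_R that(2)] by simp
  define \<Phi> where "\<Phi> x p = (if p \<in> P then \<Lambda> p (?R p x) else 0)" for x p
  let ?L = "polyhedral_tensor_product hs P M N a"
  have mem: "\<Phi> x \<in> ?L" if x: "x \<in> hstar H Z" for x
    unfolding polyhedral_tensor_product_def mem_Collect_eq
  proof (intro conjI ballI allI impI)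
    show "\<Phi> x p \<in> polyhedral_tensor_diagram hs P M N p" if "p \<in> P" for p
      using \<Lambda>_mem[OF that R_mem[OF x]] that by (simp add: \<Phi>_def T_def)
    show "\<Phi> x p = 0" if "p \<notin> P" for p using that by (simp add: \<Phi>_def)
    show "polyhedral_tensor_map hs P M N a p q (\<Phi> x q) = \<Phi> x p" if pq: "p \<in> P" "q \<in> P" "p \<le> q" for p q
      using \<Lambda>_nat[OF pq R_mem[OF x]] R_comp[OF pq(3) x] pq by (simp add: \<Phi>_def \<rho>_def)
  qed
  have lin: "lin_on hs (fun_scale (fun_scale (*))) (hstar H Z) ?L \<Phi>"
    unfolding lin_on_def
  proof (intro conjI ballI allI image_subsetI mem)
    fix x y assume x: "x \<in> hstar H Z" and y: "y \<in> hstar H Z"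
    have "\<Lambda> p (?R p (x + y)) = \<Lambda> p (?R p x) + \<Lambda> p (?R p y)" if "p \<in> P" for p
      unfolding lin_on_add[OF lin_on_hstar_map[OF cont_R] x y]
      by (rule lin_on_add[OF \<Lambda>_lin[OF that] R_mem[OF x] R_mem[OF y]])
    then have "\<Phi> (x + y) p = \<Phi> x p + \<Phi> y p" for p
      by (cases "p \<in> P") (simp_all only: \<Phi>_def if_True if_False add_0_right)
    then show "\<Phi> (x + y) = \<Phi> x + \<Phi> y"
      unfolding plus_fun_def by (rule ext)
  next
    fix c x assume x: "x \<in> hstar H Z"
    have "\<Lambda> p (?R p (hs c x)) = fun_scale (*) c (\<Lambda> p (?R p x))" if "p \<in> P" for p
      unfolding lin_on_scale[OF lin_on_hstar_map[OF cont_R] x]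
      by (rule lin_on_scale[OF \<Lambda>_lin[OF that] R_mem[OF x]])
    moreover have "fun_scale (*) c 0 = (0 :: ('p, int \<Rightarrow> 'm, 'k) tensor)"
      by (simp add: fun_eq_iff fun_scale_def zero_fun_apply)
    ultimately have "\<Phi> (hs c x) p = fun_scale (*) c (\<Phi> x p)" for p
      by (cases "p \<in> P") (simp_all only: \<Phi>_def if_True if_False)
    then show "\<Phi> (hs c x) = fun_scale (fun_scale (*)) c (\<Phi> x)"
      unfolding fun_scale_def[of "fun_scale (*)"] by (rule ext)
  qed
  have inj: "x = y" if x: "x \<in> hstar H Z" and y: "y \<in> hstar H Z" and eq: "\<Phi> x = \<Phi> y" for x y
  proof -
    have "?R p x = ?R p y" if p: "p \<in> P" for p
    proof (rule inj_onD[OF bij_betw_imp_inj_on[OF \<Lambda>_bij[OF p]] _ R_mem[OF x] R_mem[OF y]])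
      show "\<Lambda> p (?R p x) = \<Lambda> p (?R p y)" using fun_cong[OF eq, of p] p by (simp add: \<Phi>_def)
    qed
    moreover have "\<exists>!z. z \<in> hstar H Z \<and> (\<forall>p\<in>P. ?R p z = ?R p y)"
      by (rule limit) (simp_all add: R_mem R_comp y)
    ultimately show ?thesis
      using Ex1_unique[where R = "\<lambda>z. z \<in> hstar H Z \<and> (\<forall>p\<in>P. ?R p z = ?R p y)"] x y by blast
  qed
  have sur: "\<exists>x\<in>hstar H Z. \<Phi> x = \<tau>" if \<tau>: "\<tau> \<in> ?L" for \<tau>
  proof -
    have \<tau>T: "\<tau> p \<in> T p" if "p \<in> P" for p
      using \<tau> that by (simp add: polyhedral_tensor_product_def T_def)
    have \<tau>\<rho>: "\<rho> p q (\<tau> q) = \<tau> p" if "p \<in> P" "q \<in> P" "p \<le> q" for p q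
      using \<tau> that by (simp add: polyhedral_tensor_product_def \<rho>_def)
    define \<xi> where "\<xi> p = inv_into (hstar H (?S p)) (\<Lambda> p) (\<tau> p)" for p
    have \<xi>: "\<xi> p \<in> hstar H (?S p)" "\<Lambda> p (\<xi> p) = \<tau> p" if "p \<in> P" for p
      using \<Lambda>_bij[OF that] \<tau>T[OF that]
      by (auto simp: \<xi>_def bij_betw_inv_into_right bij_betw_def inv_into_into)
    have "hrestr Z (star p) (star q) (\<xi> q) = \<xi> p" if pq: "p \<in> P" "q \<in> P" "p \<le> q" for p q
    proof (rule inj_onD[OF bij_betw_imp_inj_on[OF \<Lambda>_bij[OF pq(1)]] _ hrestr_mem[OF star_mono[OF pq(3)] \<xi>(1)[OF pq(2)]] \<xi>(1)[OF pq(1)]])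
      show "\<Lambda> p (hrestr Z (star p) (star q) (\<xi> q)) = \<Lambda> p (\<xi> p)"
        using \<Lambda>_nat[OF pq \<xi>(1)[OF pq(2)]] \<xi>(2) \<tau>\<rho>[OF pq] pq by simp
    qed
    then obtain x where x: "x \<in> hstar H Z" "\<And>p. p \<in> P \<Longrightarrow> ?R p x = \<xi> p"
      using limit[OF \<xi>(1)] by blast
    have "\<Phi> x p = \<tau> p" for p
    proof (cases "p \<in> P")
      case True
      then show ?thesis using x(2) \<xi>(2) by (simp add: \<Phi>_def)
    next
      case False
      then have "\<tau> p = 0" using \<tau> unfolding polyhedral_tensor_product_def by blast
      then show ?thesis using False by (simp only: \<Phi>_def if_False)
    qed
    then have "\<Phi> x = \<tau>" by (rule ext)
    then show ?thesis using x(1) by blast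
  qed
  have "bij_betw \<Phi> (hstar H Z) ?L"
    unfolding bij_betw_def
  proof
    show "inj_on \<Phi> (hstar H Z)" using inj by (rule inj_onI)
    show "\<Phi> ` hstar H Z = ?L" using mem sur by blast
  qed
  moreover have "\<Phi> x p \<in> tensor_degree hs ?V (polyhedral_tensor_family P M N p) n"
    if kd: "kunneth_degree_preserving sc H C \<theta>" and x: "x \<in> hstar H Z" "homogeneous n x" and p: "p \<in> P" for n x p
  proof -
    have "homogeneous n (\<kappa> p (\<Lambda> p (?R p x)))"
      unfolding \<kappa>\<Lambda>[OF p R_mem[OF x(1)]]
      by (intro homogeneous_hstar_map[OF cont_j[OF p]] homogeneous_hstar_map[OF cont_R] x(2))
    then have "\<Lambda> p (?R p x) \<in> tensor_degree hs ?V (polyhedral_tensor_family P M N p) n"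
      by (rule \<kappa>_deg[OF kd \<Lambda>_mem[OF p R_mem[OF x(1)]]])
    then show ?thesis using p by (simp only: \<Phi>_def if_True)
  qed
  ultimately show ?thesis
    using lin by (intro exI[of _ \<Phi>]) (simp add: lin_iso_def)
qed

end
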